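(* Let $\lambda,\mu,\delta$ be algebraic real numbers with $0<\lambda<1$, $\mu>0$ and $1-\lambda<\delta<d_{\lambda,\mu}$. Then the rotation number $\rho_{\lambda,\mu,\delta}$ of $f_{\lambda,\mu,\delta}$ is a rational number.
   Context: Let $I=[0,1)$; $\lfloor x\rfloor$ is the floor and $\{x\}=x-\lfloor x\rfloor$ the fractional part of $x$. For real numbers $0<\lambda<1$, $\mu>0$ put $d_{\lambda,\mu}=1$ if $\lambda\mu<1$ and $d_{\lambda,\mu}=\frac{\mu-\lambda\mu}{\mu-1}$ if $\lambda\mu\ge1$. For $1-\lambda<\delta<d_{\lambda,\mu}$ put $\eta=\frac{1-\delta}{\lambda}$ and let $f=f_{\lambda,\mu,\delta}:I\to I$ be defined by $f(x)=\lambda x+\delta$ if $0\le x<\eta$, and $f(x)=\mu(\lambda x+\delta-1)$ if $\eta\le x<1$. Its lift $F=F_{\lambda,\mu,\delta}:\mathbb R\to\mathbb R$ is $$F(x)=\begin{cases}\lambda x+\delta+(1-\lambda)\lfloor x\rfloor&\text{if }0\le\{x\}<\eta,\\ \mu(\lambda x+\delta-1)+1+(1-\lambda\mu)\lfloor x\rfloor&\text{if }\eta\le\{x\}<1.\end{cases}$$ $F$ is increasing, $F(x+1)=F(x)+1$ and $\{F(x)\}=f(\{x\})$. The rotation number of $f$ is $\rho_{\lambda,\mu,\delta}=\lim_{k\to\infty}F^k(x)/k$, which exists and does not depend on $x\in\mathbb R$ (a known fact). *)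

theory Defs
  imports "HOL-Analysis.Analysis" "HOL-Computational_Algebra.Polynomial"
begin

definition d_bound :: "real \<Rightarrow> real \<Rightarrow> real" where
  "d_bound lam \<mu> = (if lam * \<mu> < 1 then 1 else (\<mu> - lam * \<mu>) / (\<mu> - 1))"

definition eta :: "real \<Rightarrow> real \<Rightarrow> real" where
  "eta lam \<delta> = (1 - \<delta>) / lam"

text \<open>The interval map is only meaningful on \<open>{0..<1}\<close>; see \<open>pw_map_in_unit\<close> below.\<close>

definition pw_map :: "real \<Rightarrow> real \<Rightarrow> real \<Rightarrow> real \<Rightarrow> real" where
  "pw_map lam \<mu> \<delta> x =
     (if x < eta lam \<delta> then lam * x + \<delta> else \<mu> * (lam * x + \<delta> - 1))"

definition pw_lift :: "real \<Rightarrow> real \<Rightarrow> real \<Rightarrow> real \<Rightarrow> real" where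
  "pw_lift lam \<mu> \<delta> x =
     (if frac x < eta lam \<delta>
      then lam * x + \<delta> + (1 - lam) * of_int \<lfloor>x\<rfloor>
      else \<mu> * (lam * x + \<delta> - 1) + 1 + (1 - lam * \<mu>) * of_int \<lfloor>x\<rfloor>)"

text \<open>The description is proper on the relevant parameter range: the limit exists and is
  independent of the starting point, see \<open>rotation_number_limit\<close> below.\<close>

definition rotation_number :: "real \<Rightarrow> real \<Rightarrow> real \<Rightarrow> real" where
  "rotation_number lam \<mu> \<delta> =
     (THE r. \<forall>x. (\<lambda>k. (pw_lift lam \<mu> \<delta> ^^ k) x / real k) \<longlonglongrightarrow> r)"

lemma pw_lift_eq:
  "pw_lift lam \<mu> \<delta> x = of_int \<lfloor>x\<rfloor> + 
     (if frac x < eta lam \<delta> then lam * frac x + \<delta> else \<mu> * (lam * frac x + \<delta> - 1) + 1)"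
  by (simp add: pw_lift_def frac_def algebra_simps)

lemma pw_lift_add_1: "pw_lift lam \<mu> \<delta> (x + 1) = pw_lift lam \<mu> \<delta> x + 1"
  by (simp add: pw_lift_eq frac_def)

context
  fixes lam \<mu> \<delta> :: real
  assumes lam_bounds: "0 < lam" "lam < 1" and mu: "\<mu> > 0"
    and delta: "1 - lam < \<delta>" "\<delta> < d_bound lam \<mu>"
begin

lemma delta_less_1: "\<delta> < 1"
proof (cases "lam * \<mu> < 1")
  case False
  have "lam * \<mu> < \<mu>" using lam_bounds mu by simp
  hence "\<mu> > 1" using False by linarith
  hence "d_bound lam \<mu> \<le> 1" using False by (simp add: d_bound_def divide_simps)
  thus ?thesis using delta by linarith
qed (use delta in \<open>simp add: d_bound_def\<close>)

lemma eta_bounds: "0 < eta lam \<delta>" "eta lam \<delta> < 1"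
  using lam_bounds delta delta_less_1 by (auto simp: eta_def divide_simps)

lemma less_eta_iff: "y < eta lam \<delta> \<longleftrightarrow> lam * y + \<delta> < 1"
  using lam_bounds by (auto simp: eta_def field_simps)

lemma jump_pos: "\<mu> * (lam + \<delta> - 1) < \<delta>"
proof (cases "\<mu> \<le> 1")
  case True
  have "\<mu> * (lam + \<delta> - 1) \<le> 1 * (lam + \<delta> - 1)"
    using True delta by (intro mult_right_mono) auto
  also have "\<dots> < \<delta>" using lam_bounds by simp
  finally show ?thesis .
next
  case False
  have "\<delta> * (\<mu> - 1) < \<mu> - lam * \<mu>"
  proof (cases "lam * \<mu> < 1")
    case True
    have "\<delta> * (\<mu> - 1) < 1 * (\<mu> - 1)" using False delta_less_1 by simp
    also have "\<dots> < \<mu> - lam * \<mu>" using True by simp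
    finally show ?thesis .
  next
    case F: False
    thus ?thesis using False delta by (simp add: d_bound_def field_simps)
  qed
  thus ?thesis by (simp add: algebra_simps)
qed

lemma pw_map_in_unit:
  assumes "x \<in> {0..<1}"
  shows "pw_map lam \<mu> \<delta> x \<in> {0..<1}"
proof (cases "lam * x + \<delta> < 1")
  case True
  have "0 \<le> lam * x" using assms lam_bounds by simp
  thus ?thesis using True delta lam_bounds by (simp add: pw_map_def less_eta_iff)
next
  case False
  have "lam * x \<le> lam" using assms lam_bounds by (simp add: mult_left_le)
  hence "\<mu> * (lam * x + \<delta> - 1) \<le> \<mu> * (lam + \<delta> - 1)" using mu by simp
  also have "\<dots> < 1" using jump_pos delta_less_1 by (rule less_trans)
  finally show ?thesis using False mu by (simp add: pw_map_def less_eta_iff)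
qed

lemma frac_pw_lift: "frac (pw_lift lam \<mu> \<delta> x) = pw_map lam \<mu> \<delta> (frac x)"
proof -
  have m: "pw_map lam \<mu> \<delta> (frac x) \<in> {0..<1}"
    by (rule pw_map_in_unit) (simp add: frac_lt_1)
  have "pw_lift lam \<mu> \<delta> x - pw_map lam \<mu> \<delta> (frac x) \<in> \<int>"
    by (simp add: pw_lift_eq pw_map_def)
  thus ?thesis using m by (simp add: frac_unique_iff)
qed

lemma pw_lift_bounds:
  "of_int \<lfloor>x\<rfloor> + \<delta> \<le> pw_lift lam \<mu> \<delta> x" "pw_lift lam \<mu> \<delta> x \<le> of_int \<lfloor>x\<rfloor> + 1 + \<delta>"
proof -
  have 1: "0 \<le> lam * frac x" "lam * frac x \<le> lam"
    using lam_bounds by (auto simp: mult_left_le less_imp_le[OF frac_lt_1])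
  hence 2: "\<mu> * (lam * frac x + \<delta> - 1) \<le> \<mu> * (lam + \<delta> - 1)" using mu by simp
  have 3: "\<mu> * (lam * frac x + \<delta> - 1) \<ge> 0" if "\<not> lam * frac x + \<delta> < 1"
    using that mu by simp
  show "of_int \<lfloor>x\<rfloor> + \<delta> \<le> pw_lift lam \<mu> \<delta> x" "pw_lift lam \<mu> \<delta> x \<le> of_int \<lfloor>x\<rfloor> + 1 + \<delta>"
    using 1 2 3 delta_less_1 jump_pos lam_bounds delta
    unfolding pw_lift_eq less_eta_iff by (auto split: if_splits)
qed

lemma mono_pw_lift: "mono (pw_lift lam \<mu> \<delta>)"
proof (rule monoI)
  fix x y :: real assume xy: "x \<le> y"
  show "pw_lift lam \<mu> \<delta> x \<le> pw_lift lam \<mu> \<delta> y"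
  proof (cases "\<lfloor>x\<rfloor> = \<lfloor>y\<rfloor>")
    case True
    hence f: "frac x \<le> frac y" using xy by (simp add: frac_def)
    hence l: "lam * frac x \<le> lam * frac y" using lam_bounds by simp
    hence "\<mu> * (lam * frac x + \<delta> - 1) \<le> \<mu> * (lam * frac y + \<delta> - 1)" using mu by simp
    moreover have "\<mu> * (lam * frac y + \<delta> - 1) \<ge> 0" if "\<not> lam * frac y + \<delta> < 1"
      using that mu by simp
    ultimately show ?thesis using l True
      unfolding pw_lift_eq less_eta_iff by (auto split: if_splits)
  next
    case False
    hence "\<lfloor>x\<rfloor> + 1 \<le> \<lfloor>y\<rfloor>" using floor_mono[OF xy] by linarith
    hence "of_int \<lfloor>x\<rfloor> + 1 \<le> (of_int \<lfloor>y\<rfloor> :: real)" by linarith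
    thus ?thesis using pw_lift_bounds(2)[of x] pw_lift_bounds(1)[of y] by linarith
  qed
qed

lemma rotation_number_limit:
  "(\<lambda>k. (pw_lift lam \<mu> \<delta> ^^ k) x / real k) \<longlonglongrightarrow> rotation_number lam \<mu> \<delta>"
proof -
  define F where "F = pw_lift lam \<mu> \<delta>"
  have mono: "mono (F ^^ k)" for k
    unfolding F_def using mono_pw_lift by (rule mono_pow)
  have nat1: "(F ^^ k) (x + real n) = (F ^^ k) x + real n" for k n x
  proof -
    have "(F ^^ k) (x + 1) = (F ^^ k) x + 1" for x
      by (induction k) (simp_all add: F_def pw_lift_add_1)
    thus ?thesis
      by (induction n) (simp_all add: add.assoc[symmetric] add.commute[of 1])
  qed
  have int1: "(F ^^ k) (x + of_int n) = (F ^^ k) x + of_int n" for k n x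
  proof (cases "n \<ge> 0")
    case True
    thus ?thesis using nat1[of k x "nat n"] by simp
  next
    case False
    thus ?thesis using nat1[of k "x + of_int n" "nat (-n)"] by simp
  qed
  have near: "\<bar>(F ^^ k) y - y - (F ^^ k) 0\<bar> \<le> 1" for k y
  proof -
    have "(F ^^ k) (of_int \<lfloor>y\<rfloor>) \<le> (F ^^ k) y" "(F ^^ k) y \<le> (F ^^ k) (of_int (\<lfloor>y\<rfloor> + 1))"
      using mono[of k] by (auto intro!: monoD[OF mono] simp del: of_int_add) linarith
    thus ?thesis using int1[of k 0 "\<lfloor>y\<rfloor>"] int1[of k 0 "\<lfloor>y\<rfloor> + 1"]
      by (simp add: abs_le_iff) linarith
  qed
  define a where "a k = (F ^^ k) 0" for k
  have mult: "\<bar>a (m * k) - real m * a k\<bar> \<le> real m" for m k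
  proof (induction m)
    case (Suc m)
    have "a (Suc m * k) = (F ^^ k) (a (m * k))" by (simp add: a_def funpow_add)
    thus ?case using near[of k "a (m * k)"] Suc unfolding a_def[of k, symmetric]
      by (simp add: algebra_simps abs_le_iff)
  qed (simp add: a_def)
  have quot: "\<bar>a (m * k) / (real m * real k) - a k / real k\<bar> \<le> 1 / real k"
    if "m > 0" "k > 0" for m k
  proof -
    have "a (m * k) / (real m * real k) - a k / real k
        = (a (m * k) - real m * a k) / (real m * real k)"
      using that by (simp add: field_simps)
    also have "\<bar>\<dots>\<bar> = \<bar>a (m * k) - real m * a k\<bar> / (real m * real k)"
      using that by (simp add: abs_mult)
    also have "\<dots> \<le> real m / (real m * real k)"
      by (intro divide_right_mono mult) simp
    finally show ?thesis using that by simp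
  qed
  have diff: "\<bar>a m / real m - a k / real k\<bar> \<le> 1 / real m + 1 / real k"
    if "m > 0" "k > 0" for m k
    using quot[OF that] quot[OF that(2,1)] by (simp add: mult.commute)
  have "Cauchy (\<lambda>k. a k / real k)"
  proof (rule metric_CauchyI)
    fix e :: real assume e: "e > 0"
    then obtain N where N: "N > 0" "1 / real N < e / 2"
      using real_arch_inverse[of "e / 2"] by (auto simp: inverse_eq_divide)
    show "\<exists>M. \<forall>m\<ge>M. \<forall>n\<ge>M. dist (a m / real m) (a n / real n) < e"
    proof (intro exI[of _ N] allI impI)
      fix m n assume mn: "m \<ge> N" "n \<ge> N"
      have "1 / real m \<le> 1 / real N" "1 / real n \<le> 1 / real N"
        using mn N by (auto intro!: divide_left_mono)
      thus "dist (a m / real m) (a n / real n) < e"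
        using diff[of m n] mn N by (simp add: dist_real_def)
    qed
  qed
  then obtain r where r: "(\<lambda>k. a k / real k) \<longlonglongrightarrow> r"
    using Cauchy_convergent convergent_def by blast
  have lim: "(\<lambda>k. (F ^^ k) x / real k) \<longlonglongrightarrow> r" for x
  proof -
    have "(\<lambda>k. ((F ^^ k) x - a k) / real k) \<longlonglongrightarrow> 0"
    proof (rule Lim_null_comparison)
      show "\<forall>\<^sub>F k in sequentially. norm (((F ^^ k) x - a k) / real k) \<le> (\<bar>x\<bar> + 1) / real k"
      proof (intro always_eventually allI)
        fix k
        have "\<bar>(F ^^ k) x - a k\<bar> \<le> \<bar>x\<bar> + 1" using near[of k x] unfolding a_def by linarith
        thus "norm (((F ^^ k) x - a k) / real k) \<le> (\<bar>x\<bar> + 1) / real k"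
          by (simp add: divide_right_mono)
      qed
      show "(\<lambda>k. (\<bar>x\<bar> + 1) / real k) \<longlonglongrightarrow> 0" by (rule lim_const_over_n)
    qed
    from tendsto_add[OF this r] show ?thesis by (simp add: diff_divide_distrib)
  qed
  have "rotation_number lam \<mu> \<delta> = r"
    unfolding rotation_number_def F_def[symmetric]
    using lim LIMSEQ_unique by (intro the_equality) blast+
  thus ?thesis using lim by (simp add: F_def)
qed

end

end

(* Suppose that the rotation number r is irrational. The orbit of 0 under the lift then has the same
   integer parts as the sequence of multiples of r. Expanding points of the orbit close to the
   discontinuity along their backward itineraries, from either side, gives a linear relation between
   the sums U and V of lam^(i+j) mu^j over the right steps and the up steps (i,j) of the lattice walk
   of slope r/(1-r). Since lam mu^r < 1, telescoping gives a second relation, so that U and V are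
   algebraic.

   Mahler's method refutes this. Replacing a pair of blocks (a,b) of the walk by (a,ab) or (ab,b), as
   in the subtractive Euclidean algorithm, writes U and V as combinations of the same sums U_n and V_n
   at weights x_n, y_n tending to 0. By Liouville's inequality, long runs of equal steps are
   impossible, as V_n or U_n - 1 would be too small. Hence the slopes have an irrational limit point,
   and at all levels the heights of x_n, y_n, U_n are comparable to log(1/x_n) and log(1/y_n). Choose
   integer polynomials P_k(x,y), not all zero, such that the series E = sum_k P_k U^k for the limit
   slope vanishes to high order. E is not zero, because U is transcendental over Q(x,y), and its
   dominant monomial at (x_n,y_n) shows that E_n(x_n,y_n) is nonzero for infinitely many n; but it is
   too small for Liouville's inequality. *)

theory Submission
  imports Defs
begin

section \<open>A Liouville inequality for several algebraic numbers\<close>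

text \<open>A Farey step changes the slope together with the weights, so no single function
  satisfies a functional equation as in the classical form of Mahler's method. The auxiliary
  relation is therefore built once, for a limit slope; since each coefficient of
  \<open>relation2\<close> sees only a finite part of the walk, it passes to far levels of a
  subsequence. The relation is fixed before n grows, so the size of its coefficients only affects
  constants. What counts is the ratio of the order of vanishing M to the degree N: it can be made
  large, as M^2 conditions on (N + 1)^3 unknowns are solvable with M of order N^(3/2).

  Heights are measured by integer multiplication matrices on one finitely generated module, which
  avoids number fields and conjugates. Irrationality of the limit slope and separation of the
  monomials at (x_n, y_n) rest on one remark: a Farey step, read forwards on the frequencies or
  backwards on the logarithms of the weights, shrinks the coefficients of an integer linear form
  while they have opposite signs, until nothing cancels.\<close>

lemma integer_pigeonhole:
  fixes a :: "'j \<Rightarrow> 'i \<Rightarrow> int" and S :: nat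
  assumes fin: "finite I" "finite J" and less: "card J < card I"
    and bound: "\<And>i j. i \<in> I \<Longrightarrow> j \<in> J \<Longrightarrow> \<bar>a j i\<bar> \<le> int S"
  obtains c where "\<exists>i\<in>I. c i \<noteq> 0" "\<And>j. j \<in> J \<Longrightarrow> (\<Sum>i\<in>I. a j i * c i) = 0"
    "\<And>i. i \<in> I \<Longrightarrow> \<bar>c i\<bar> \<le> int ((2 * card I * S + 1) ^ card J)"
proof -
  define r where "r = card J"
  define q where "q = 2 * card I * S + 1"
  \<comment> \<open>With this side length the (B + 1)^|I| vectors of the box have at most (q (B +
    1))^r = B (B + 1)^r images, fewer than (B + 1)^(r + 1). Two vectors then share an image, and
    their difference is the solution.\<close>
  define B where "B = q ^ r"
  define X where "X = PiE I (\<lambda>_. {0..int B})"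
  define m where "m = int (card I * S * B)"
  define Y where "Y = PiE J (\<lambda>_. {-m..m})"
  define L where "L c = (\<lambda>j\<in>J. \<Sum>i\<in>I. a j i * c i)" for c :: "'i \<Rightarrow> int"
  have finX: "finite X" and finY: "finite Y"
    using fin by (auto simp: X_def Y_def intro!: finite_PiE)
  have cardX: "card X = (B + 1) ^ card I"
    using fin by (simp add: X_def card_PiE nat_add_distrib)
  have cardY: "card Y = (2 * card I * S * B + 1) ^ r"
    using fin by (simp add: Y_def card_PiE r_def m_def nat_add_distrib nat_mult_distrib algebra_simps)
  have "card Y \<le> (q * (B + 1)) ^ r"
    unfolding cardY q_def by (intro power_mono) (auto simp: algebra_simps)
  also have "\<dots> = B * (B + 1) ^ r"
    by (simp only: power_mult_distrib B_def)
  also have "\<dots> < (B + 1) * (B + 1) ^ r"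
    by simp
  also have "\<dots> = (B + 1) ^ Suc r"
    by simp
  also have "\<dots> \<le> card X"
    unfolding cardX using less by (intro power_increasing) (auto simp: r_def)
  finally have lessXY: "card Y < card X" .
  have "L ` X \<subseteq> Y"
  proof safe
    fix c assume c: "c \<in> X"
    have "\<bar>\<Sum>i\<in>I. a j i * c i\<bar> \<le> m" if "j \<in> J" for j
    proof -
      have "\<bar>\<Sum>i\<in>I. a j i * c i\<bar> \<le> (\<Sum>i\<in>I. \<bar>a j i * c i\<bar>)"
        by (rule sum_abs)
      also have "\<dots> \<le> (\<Sum>i\<in>I. int S * int B)"
      proof (rule sum_mono)
        fix i assume i: "i \<in> I"
        hence "\<bar>c i\<bar> \<le> int B" using c by (auto simp: X_def PiE_def Pi_def)
        thus "\<bar>a j i * c i\<bar> \<le> int S * int B"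
          using bound[OF i that] unfolding abs_mult by (intro mult_mono) auto
      qed
      finally show ?thesis by (simp add: m_def)
    qed
    thus "L c \<in> Y" by (auto simp: L_def Y_def abs_le_iff minus_le_iff)
  qed
  hence "card (L ` X) < card X"
    using lessXY card_mono[OF finY, of "L ` X"] by simp
  hence "\<not> inj_on L X"
    by (rule pigeonhole)
  then obtain c d where cd: "c \<in> X" "d \<in> X" "c \<noteq> d" "L c = L d"
    by (auto simp: inj_on_def)
  show ?thesis
  proof (rule that[of "\<lambda>i. c i - d i"])
    show "\<exists>i\<in>I. c i - d i \<noteq> 0"
    proof (rule ccontr)
      assume "\<not> ?thesis"
      hence "c = d" using cd by (intro PiE_ext[of c I _ d]) (auto simp: X_def)
      thus False using cd by simp
    qed
  next
    fix j assume j: "j \<in> J"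
    have "L c j = L d j" using cd by simp
    thus "(\<Sum>i\<in>I. a j i * (c i - d i)) = 0"
      using j by (simp add: L_def algebra_simps sum_subtractf)
  next
    fix i assume "i \<in> I"
    hence "c i \<in> {0..int B}" "d i \<in> {0..int B}" using cd by (auto simp: X_def)
    thus "\<bar>c i - d i\<bar> \<le> int ((2 * card I * S + 1) ^ card J)"
      by (auto simp: B_def q_def r_def)
  qed
qed

text \<open>\<open>W\<close> is only a generating set, so coordinates need not be unique. The l^1
  norm makes sizes submultiplicative without factors \<open>card W\<close>.\<close>

definition int_span :: "real set \<Rightarrow> nat \<Rightarrow> real set" where
  "int_span W S = {z. \<exists>c :: real \<Rightarrow> int. z = (\<Sum>w\<in>W. of_int (c w) * w) \<and> (\<Sum>w\<in>W. \<bar>c w\<bar>) \<le> int S}"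

text \<open>\<open>mult_size W z S\<close> bounds the rows of an integer matrix of multiplication by \<open>z\<close> on the module
  generated by \<open>W\<close>. It plays the role of a height: such bounds add under sums and multiply under products.\<close>

definition mult_size :: "real set \<Rightarrow> real \<Rightarrow> nat \<Rightarrow> bool" where
  "mult_size W z S \<longleftrightarrow> (\<forall>w\<in>W. z * w \<in> int_span W S)"

section \<open>Calculus of integer spans and multiplication sizes\<close>

lemma int_span_mono: "z \<in> int_span W S \<Longrightarrow> S \<le> S' \<Longrightarrow> z \<in> int_span W S'"
  unfolding int_span_def by force

lemma int_span_zero: "0 \<in> int_span W S"
  unfolding int_span_def by (auto intro!: exI[of _ "\<lambda>_. 0"])

lemma int_span_base: "finite W \<Longrightarrow> w \<in> W \<Longrightarrow> w \<in> int_span W 1"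
  unfolding int_span_def
  by (auto intro!: exI[of _ "\<lambda>v. if v = w then 1 else 0"] simp: if_distrib[of abs] if_distrib[of of_int] if_distrib[of "\<lambda>x. x * _"] cong: if_cong)

lemma int_span_add:
  assumes "z \<in> int_span W S" "z' \<in> int_span W S'"
  shows "z + z' \<in> int_span W (S + S')"
proof -
  obtain c c' where "z = (\<Sum>w\<in>W. of_int (c w) * w)" "(\<Sum>w\<in>W. \<bar>c w\<bar>) \<le> int S"
    "z' = (\<Sum>w\<in>W. of_int (c' w) * w)" "(\<Sum>w\<in>W. \<bar>c' w\<bar>) \<le> int S'"
    using assms unfolding int_span_def by auto
  moreover have "(\<Sum>w\<in>W. \<bar>c w + c' w\<bar>) \<le> (\<Sum>w\<in>W. \<bar>c w\<bar> + \<bar>c' w\<bar>)"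
    by (rule sum_mono) simp
  ultimately show ?thesis unfolding int_span_def
    by (auto intro!: exI[of _ "\<lambda>w. c w + c' w"] simp: sum.distrib algebra_simps)
qed

lemma int_span_scale:
  assumes "z \<in> int_span W S"
  shows "of_int k * z \<in> int_span W (nat \<bar>k\<bar> * S)"
proof -
  obtain c where c: "z = (\<Sum>w\<in>W. of_int (c w) * w)" "(\<Sum>w\<in>W. \<bar>c w\<bar>) \<le> int S"
    using assms unfolding int_span_def by auto
  have "(\<Sum>w\<in>W. \<bar>k * c w\<bar>) = \<bar>k\<bar> * (\<Sum>w\<in>W. \<bar>c w\<bar>)"
    by (simp add: abs_mult sum_distrib_left)
  also have "\<dots> \<le> \<bar>k\<bar> * int S" using c by (intro mult_left_mono) auto
  finally show ?thesis using c unfolding int_span_def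
    by (auto intro!: exI[of _ "\<lambda>w. k * c w"] simp: sum_distrib_left mult.assoc)
qed

lemma int_span_sum:
  assumes "finite I" "\<And>i. i \<in> I \<Longrightarrow> f i \<in> int_span W S"
  shows "(\<Sum>i\<in>I. of_int (c i) * f i) \<in> int_span W (nat (\<Sum>i\<in>I. \<bar>c i\<bar>) * S)"
  using assms
proof (induction I rule: finite_induct)
  case empty
  show ?case by (simp add: int_span_zero)
next
  case (insert i I)
  have "of_int (c i) * f i + (\<Sum>i\<in>I. of_int (c i) * f i)
      \<in> int_span W (nat \<bar>c i\<bar> * S + nat (\<Sum>i\<in>I. \<bar>c i\<bar>) * S)"
    using insert by (intro int_span_add int_span_scale) auto
  moreover have "0 \<le> (\<Sum>i\<in>I. \<bar>c i\<bar>)" by (rule sum_nonneg) auto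
  ultimately show ?case using insert by (simp add: nat_add_distrib algebra_simps)
qed

lemma mult_size_mono: "mult_size W z S \<Longrightarrow> S \<le> S' \<Longrightarrow> mult_size W z S'"
  unfolding mult_size_def using int_span_mono by blast

lemma mult_size_of_int: "finite W \<Longrightarrow> mult_size W (of_int k) (nat \<bar>k\<bar>)"
  unfolding mult_size_def using int_span_scale[OF int_span_base] by fastforce

lemma mult_size_of_nat: "finite W \<Longrightarrow> mult_size W (of_nat k) k"
  using mult_size_of_int[of W "int k"] by simp

lemma mult_size_add: "mult_size W z S \<Longrightarrow> mult_size W z' S' \<Longrightarrow> mult_size W (z + z') (S + S')"
  unfolding mult_size_def using int_span_add by (simp add: distrib_right)

lemma mult_size_mult_span:
  assumes "finite W" "mult_size W z S" "v \<in> int_span W S'"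
  shows "z * v \<in> int_span W (S * S')"
proof -
  obtain c where c: "v = (\<Sum>w\<in>W. of_int (c w) * w)" "(\<Sum>w\<in>W. \<bar>c w\<bar>) \<le> int S'"
    using assms unfolding int_span_def by auto
  have "z * v = (\<Sum>w\<in>W. of_int (c w) * (z * w))"
    by (simp add: c sum_distrib_left mult_ac)
  also have "\<dots> \<in> int_span W (nat (\<Sum>w\<in>W. \<bar>c w\<bar>) * S)"
    using assms by (intro int_span_sum) (auto simp: mult_size_def)
  finally show ?thesis
    by (rule int_span_mono) (use c(2) in \<open>simp add: mult.commute nat_le_iff\<close>)
qed

lemma mult_size_mult:
  assumes "finite W" "mult_size W z S" "mult_size W z' S'"
  shows "mult_size W (z * z') (S * S')"
  using mult_size_mult_span[OF assms(1,2)] assms(3) by (simp add: mult_size_def mult.assoc)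

lemma mult_size_minus: "mult_size W z S \<Longrightarrow> mult_size W (- z) S"
  unfolding mult_size_def using int_span_scale[where k="-1"] by fastforce

lemma mult_size_diff: "mult_size W z S \<Longrightarrow> mult_size W z' S' \<Longrightarrow> mult_size W (z - z') (S + S')"
  using mult_size_add[OF _ mult_size_minus, of W z S z' S'] by simp

lemma mult_size_power: "finite W \<Longrightarrow> mult_size W z S \<Longrightarrow> mult_size W (z ^ n) (S ^ n)"
  by (induction n) (use mult_size_of_nat[of W 1] in \<open>auto intro: mult_size_mult\<close>)

lemma mult_size_sum:
  assumes "finite I" "finite W" "\<And>i. i \<in> I \<Longrightarrow> mult_size W (f i) (s i)"
  shows "mult_size W (\<Sum>i\<in>I. f i) (\<Sum>i\<in>I. s i)"
  using assms(1,3)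
proof (induction I rule: finite_induct)
  case empty
  show ?case using mult_size_of_nat[OF assms(2), of 0] by simp
qed (auto intro: mult_size_add)

text \<open>The powers of \<open>z\<close> have bounded integer coordinates in \<open>W\<close>; the pigeonhole principle makes
  \<open>z\<close> a root of an integer polynomial of bounded degree and height.\<close>

lemma mult_size_lower_bound:
  assumes fin: "finite W" and one: "1 \<in> W"
  obtains C D :: nat where "C > 0"
    "\<And>z S. mult_size W z S \<Longrightarrow> z \<noteq> 0 \<Longrightarrow> S \<ge> 1 \<Longrightarrow> \<bar>z\<bar> * (real C * real S ^ D) \<ge> 1"
proof -
  define r where "r = card W"
  \<comment> \<open>The pigeonhole bound for \<open>r\<close> equations with entries up to
    \<open>S ^ r\<close> is at most (2 (r + 1) + 1)^r S^(r r); the factor \<open>r + 1\<close>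
    accounts for the number of terms of the polynomial.\<close>
  define C where "C = (r + 1) * (2 * (r + 1) + 1) ^ r"
  show ?thesis
  proof (rule that[of C "r * r"])
    show "C > 0" by (simp add: C_def)
  next
    fix z S assume z: "mult_size W z S" "z \<noteq> 0" and S: "S \<ge> 1"
    have "\<forall>k. \<exists>c :: real \<Rightarrow> int. z ^ k = (\<Sum>w\<in>W. of_int (c w) * w) \<and> (\<Sum>w\<in>W. \<bar>c w\<bar>) \<le> int (S ^ k)"
      using mult_size_power[OF fin z(1)] one unfolding mult_size_def int_span_def by fastforce
    then obtain c :: "nat \<Rightarrow> real \<Rightarrow> int" where c: "\<And>k. z ^ k = (\<Sum>w\<in>W. of_int (c k w) * w)"
        "\<And>k. (\<Sum>w\<in>W. \<bar>c k w\<bar>) \<le> int (S ^ k)"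
      by metis
    have cb: "\<bar>c k w\<bar> \<le> int (S ^ r)" if "w \<in> W" "k \<in> {..r}" for k w
    proof -
      have "\<bar>c k w\<bar> \<le> (\<Sum>w\<in>W. \<bar>c k w\<bar>)" using that fin by (intro member_le_sum) auto
      also have "\<dots> \<le> int (S ^ k)" by (rule c)
      also have "\<dots> \<le> int (S ^ r)" using S that by (simp add: power_increasing del: of_nat_power)
      finally show ?thesis .
    qed
    define B where "B = (2 * (r + 1) * S ^ r + 1) ^ r"
    obtain b where b: "\<exists>i\<in>{..r}. b i \<noteq> 0" "\<And>w. w \<in> W \<Longrightarrow> (\<Sum>k\<in>{..r}. c k w * b k) = 0"
        "\<And>k. k \<in> {..r} \<Longrightarrow> \<bar>b k\<bar> \<le> int B"
      using integer_pigeonhole[of "{..r}" W "\<lambda>w k. c k w" "S ^ r"] fin cb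
      unfolding B_def r_def by auto
    \<comment> \<open>Dividing by \<open>z ^ k0\<close> leaves the nonzero integer
      \<open>b k0\<close> as constant term, while all other terms contain \<open>z\<close>. Hence 1
      is at most |z| times a bounded sum if |z| < 1.\<close>
    define k0 where "k0 = (LEAST k. k \<le> r \<and> b k \<noteq> 0)"
    have k0: "k0 \<le> r" "b k0 \<noteq> 0"
      using LeastI_ex[of "\<lambda>k. k \<le> r \<and> b k \<noteq> 0"] b(1) unfolding k0_def by auto
    have below: "b k = 0" if "k < k0" for k
      using not_less_Least[of k "\<lambda>k. k \<le> r \<and> b k \<noteq> 0"] that k0 unfolding k0_def by auto
    have "(\<Sum>k\<le>r. of_int (b k) * z ^ k) = (\<Sum>k\<le>r. \<Sum>w\<in>W. of_int (b k) * (of_int (c k w) * w))"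
      unfolding c(1) sum_distrib_left ..
    also have "\<dots> = (\<Sum>w\<in>W. \<Sum>k\<le>r. of_int (b k) * (of_int (c k w) * w))"
      by (rule sum.swap)
    also have "\<dots> = (\<Sum>w\<in>W. of_int (\<Sum>k\<in>{..r}. c k w * b k) * w)"
      by (simp add: sum_distrib_left mult_ac)
    also have "\<dots> = 0" using b(2) by simp
    finally have "(\<Sum>k\<le>r. of_int (b k) * z ^ k) = 0" .
    moreover have "(\<Sum>k\<le>r. of_int (b k) * z ^ k) = z ^ k0 * (\<Sum>k\<in>{k0..r}. of_int (b k) * z ^ (k - k0))"
    proof -
      have "(\<Sum>k\<le>r. of_int (b k) * z ^ k) = (\<Sum>k\<in>{k0..r}. of_int (b k) * z ^ k)"
        using below by (intro sum.mono_neutral_right) (auto simp: not_le)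
      also have "\<dots> = z ^ k0 * (\<Sum>k\<in>{k0..r}. of_int (b k) * z ^ (k - k0))"
        unfolding sum_distrib_left
        by (intro sum.cong) (auto simp: mult_ac simp flip: power_add)
      finally show ?thesis .
    qed
    ultimately have "(\<Sum>k\<in>{k0..r}. of_int (b k) * z ^ (k - k0)) = 0"
      using z by simp
    moreover have "(\<Sum>k\<in>{k0..r}. of_int (b k) * z ^ (k - k0))
        = of_int (b k0) + z * (\<Sum>k\<in>{k0<..r}. of_int (b k) * z ^ (k - Suc k0))"
    proof -
      have "z * (of_int (b k) * z ^ (k - Suc k0)) = of_int (b k) * z ^ (k - k0)" if "k > k0" for k
        using that by (simp add: Suc_diff_Suc[symmetric] del: Suc_diff_Suc)
      hence "z * (\<Sum>k\<in>{k0<..r}. of_int (b k) * z ^ (k - Suc k0)) = (\<Sum>k\<in>{k0<..r}. of_int (b k) * z ^ (k - k0))"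
        unfolding sum_distrib_left by (intro sum.cong) auto
      moreover have "{k0..r} = insert k0 {k0<..r}" using k0 by auto
      ultimately show ?thesis by simp
    qed
    ultimately have eq: "\<bar>of_int (b k0)\<bar> = \<bar>z\<bar> * \<bar>\<Sum>k\<in>{k0<..r}. of_int (b k) * z ^ (k - Suc k0)\<bar>"
      by (simp add: eq_neg_iff_add_eq_0 flip: abs_mult)
    have CB: "real (r + 1) * real B \<le> real C * real S ^ (r * r)"
    proof -
      have "B \<le> ((2 * (r + 1) + 1) * S ^ r) ^ r"
        unfolding B_def using S by (intro power_mono) (auto simp: algebra_simps)
      hence "(r + 1) * B \<le> C * S ^ (r * r)"
        unfolding C_def by (simp only: power_mult_distrib power_mult mult.assoc mult_le_mono)
      hence "real ((r + 1) * B) \<le> real (C * S ^ (r * r))" by (simp only: of_nat_le_iff)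
      thus ?thesis by (simp only: of_nat_mult of_nat_power)
    qed
    have B1: "real B \<ge> 1" by (simp add: B_def)
    show "\<bar>z\<bar> * (real C * real S ^ (r * r)) \<ge> 1"
    proof (cases "\<bar>z\<bar> \<ge> 1")
      case True
      have "1 * 1 \<le> real (r + 1) * real B" using B1 by (intro mult_mono) auto
      hence "1 * 1 \<le> \<bar>z\<bar> * (real C * real S ^ (r * r))"
        using True CB by (intro mult_mono) auto
      thus ?thesis by simp
    next
      case False
      have "1 \<le> \<bar>real_of_int (b k0)\<bar>" using k0 by simp
      also note eq
      also have "\<bar>\<Sum>k\<in>{k0<..r}. of_int (b k) * z ^ (k - Suc k0)\<bar>
          \<le> (\<Sum>k\<in>{k0<..r}. \<bar>of_int (b k) * z ^ (k - Suc k0)\<bar>)"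
        by (rule sum_abs)
      also have "\<dots> \<le> (\<Sum>k\<in>{k0<..r}. real B * 1)"
      proof (rule sum_mono)
        fix k assume "k \<in> {k0<..r}"
        hence "\<bar>b k\<bar> \<le> int B" using b(3) by auto
        hence "\<bar>real_of_int (b k)\<bar> \<le> real B" by linarith
        thus "\<bar>of_int (b k) * z ^ (k - Suc k0)\<bar> \<le> real B * 1"
          using False unfolding abs_mult power_abs
          by (intro mult_mono) (auto intro: power_le_one)
      qed
      also have "\<dots> \<le> real (r + 1) * real B" by (simp add: mult_right_mono)
      also note CB
      finally show ?thesis by (simp add: mult_left_mono)
    qed
  qed
qed

text \<open>Multiplication by \<open>z\<close> acts on the left factors alone, with the same integer
  matrix. Products of generators thus carry the action of whatever acts on either factor, which
  brings several algebraic numbers onto one module.\<close>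

lemma mult_size_products:
  assumes fin: "finite W" "finite W'" and z: "mult_size W z S"
  shows "mult_size ((\<lambda>(w, w'). w * w') ` (W \<times> W')) z S"
  unfolding mult_size_def
proof safe
  fix w w' assume w: "w \<in> W" "w' \<in> W'"
  define V where "V = (\<lambda>(w, w'). w * w') ` (W \<times> W')"
  have "finite V" using fin by (simp add: V_def)
  obtain c where c: "z * w = (\<Sum>v\<in>W. of_int (c v) * v)" "(\<Sum>w\<in>W. \<bar>c w\<bar>) \<le> int S"
    using z w unfolding mult_size_def int_span_def by auto
  have "z * (w * w') = (\<Sum>v\<in>W. of_int (c v) * (v * w'))"
    by (simp add: c mult.assoc[symmetric] sum_distrib_right)
  also have "\<dots> \<in> int_span V (nat (\<Sum>w\<in>W. \<bar>c w\<bar>) * 1)"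
    using fin w \<open>finite V\<close> by (intro int_span_sum int_span_base) (auto simp: V_def)
  finally show "z * (w * w') \<in> int_span V S"
    by (rule int_span_mono) (use c in simp)
qed

text \<open>On the powers of \<open>z\<close> below the degree, the leading coefficient times
  \<open>z\<close> raises the exponent and scales. Only the top power leaves the range, and there
  the integer equation is applied once.\<close>

lemma mult_size_algebraic:
  assumes "algebraic (z :: real)"
  obtains W a S where "finite W" "1 \<in> W" "a > (0::nat)" "mult_size W (real a * z) S"
proof (cases "z = 0")
  case True
  show ?thesis
    by (rule that[of "{1}" 1 0]) (use True mult_size_of_nat[of "{1}" 0] in auto)
next
  case False
  obtain p where p: "poly (map_poly of_int p) z = 0" "p \<noteq> 0"
    using assms by (elim algebraicE'_nonzero[OF _ False]) auto
  define d where "d = degree p"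
  define a where "a = nat \<bar>lead_coeff p\<bar>"
  have lc: "lead_coeff p \<noteq> 0" using p by simp
  have root: "(\<Sum>i\<le>d. of_int (coeff p i) * z ^ i) = 0"
    using p(1) unfolding poly_altdef d_def by (simp add: coeff_map_poly degree_map_poly)
  have d0: "d > 0"
  proof (rule ccontr)
    assume "\<not> d > 0"
    thus False using root lc by (simp add: d_def)
  qed
  define T where "T = nat (\<Sum>i<d. \<bar>coeff p i\<bar>) + a"
  have top: "of_int (lead_coeff p) * z ^ d = (\<Sum>i<d. of_int (- coeff p i) * z ^ i)"
    using root unfolding d_def[symmetric]
    by (simp add: lessThan_Suc_atMost[symmetric] sum_negf d_def eq_neg_iff_add_eq_0)
  have "of_int (lead_coeff p) * z ^ d \<in> int_span ((\<lambda>i. z ^ i) ` {..<d}) (nat (\<Sum>i<d. \<bar>- coeff p i\<bar>) * 1)"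
    unfolding top by (intro int_span_sum int_span_base) auto
  hence spanlc: "of_int (lead_coeff p) * z ^ d \<in> int_span ((\<lambda>i. z ^ i) ` {..<d}) (nat (\<Sum>i<d. \<bar>coeff p i\<bar>))"
    by simp
  have "mult_size ((\<lambda>i. z ^ i) ` {..<d}) (of_int (lead_coeff p) * z) T"
    unfolding mult_size_def
  proof safe
    fix i assume i: "i < d"
    show "of_int (lead_coeff p) * z * z ^ i \<in> int_span ((\<lambda>i. z ^ i) ` {..<d}) T"
    proof (cases "Suc i = d")
      case True
      thus ?thesis using int_span_mono[OF spanlc, of T] by (auto simp: T_def mult.assoc)
    next
      case False
      hence "z ^ Suc i \<in> int_span ((\<lambda>i. z ^ i) ` {..<d}) 1"
        using i by (intro int_span_base) (auto simp del: power_Suc)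
      from int_span_mono[OF int_span_scale[OF this, of "lead_coeff p"], of T] show ?thesis
        by (simp add: T_def a_def mult.assoc)
    qed
  qed
  moreover have "real a * z = of_int (lead_coeff p) * z \<or> real a * z = - (of_int (lead_coeff p) * z)"
    by (auto simp: a_def abs_if)
  ultimately have "mult_size ((\<lambda>i. z ^ i) ` {..<d}) (real a * z) T"
    using mult_size_minus by metis
  thus ?thesis
    by (rule that[rotated 3]) (use d0 lc in \<open>auto simp: a_def intro!: image_eqI[of _ _ 0]\<close>)
qed

lemma mult_size_algebraic_finite:
  assumes "finite Z" "\<And>z. z \<in> Z \<Longrightarrow> algebraic (z :: real)"
  shows "\<exists>W a S. finite W \<and> 1 \<in> W \<and> a > (0::nat) \<and> (\<forall>z\<in>Z. mult_size W (real a * z) S)"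
  using assms
proof (induction Z rule: finite_induct)
  case empty
  show ?case by (intro exI[of _ "{1}"] exI[of _ 1]) auto
next
  case (insert z Z)
  obtain W a S where 1: "finite W" "1 \<in> W" "a > (0::nat)" "\<forall>z\<in>Z. mult_size W (real a * z) S"
    using insert by auto
  obtain W' a' S' where 2: "finite W'" "1 \<in> W'" "a' > (0::nat)" "mult_size W' (real a' * z) S'"
    using insert.prems mult_size_algebraic[of z] by (metis insertI1)
  define V where "V = (\<lambda>(w, w'). w * w') ` (W \<times> W')"
  \<comment> \<open>Reading the product in both orders lets \<open>mult_size_products\<close> serve
    the old numbers through \<open>W\<close> and the new one through \<open>W'\<close>.\<close>
  have V: "V = (\<lambda>(w, w'). w * w') ` (W' \<times> W)"
    unfolding V_def by (auto simp: image_iff Bex_def) (metis mult.commute)+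
  have fin: "finite V" using 1 2 by (simp add: V_def)
  have "mult_size V (real (a * a') * y) (a' * S + a * S')" if "y \<in> insert z Z" for y
  proof (cases "y = z")
    case True
    have "mult_size V (real a * (real a' * y)) (a * S')"
      using True mult_size_products[OF 2(1) 1(1) 2(4)] unfolding V[symmetric]
      by (intro mult_size_mult mult_size_of_nat fin) auto
    thus ?thesis by (auto simp: mult_ac elim: mult_size_mono)
  next
    case False
    hence "mult_size W (real a * y) S" using 1 that by auto
    hence "mult_size V (real a' * (real a * y)) (a' * S)"
      using mult_size_products[OF 1(1) 2(1)] unfolding V_def[symmetric]
      by (intro mult_size_mult mult_size_of_nat fin) auto
    thus ?thesis by (auto simp: mult_ac elim: mult_size_mono)
  qed
  moreover have "1 \<in> V" using 1 2 by (force simp: V_def)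
  ultimately show ?case using fin 1 2
    by (intro exI[of _ V] exI[of _ "a * a'"] exI[of _ "a' * S + a * S'"]) auto
qed

section \<open>Sums over lattice steps\<close>

text \<open>Walk in the lattice from the origin along a line of direction \<open>(\<alpha>, \<beta>)\<close>, staying weakly below it: step up
  whenever possible, otherwise step right. The set \<open>steps_x \<alpha> \<beta>\<close> consists of the points left by a
  step to the right and \<open>steps_y \<alpha> \<beta>\<close> of the points left by a step up.\<close>

definition steps_x :: "real \<Rightarrow> real \<Rightarrow> (nat \<times> nat) set" where
  "steps_x \<alpha> \<beta> = {(i, j). real j * \<alpha> \<le> real i * \<beta> \<and> real i * \<beta> < (real j + 1) * \<alpha>}"

definition steps_y :: "real \<Rightarrow> real \<Rightarrow> (nat \<times> nat) set" where
  "steps_y \<alpha> \<beta> = {(i, j). (real i - 1) * \<beta> < (real j + 1) * \<alpha> \<and> (real j + 1) * \<alpha> \<le> real i * \<beta>}"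

lemma steps_x_scale: "s > 0 \<Longrightarrow> (i, j) \<in> steps_x (a / s) (c / s) \<longleftrightarrow> (i, j) \<in> steps_x a c"
  by (auto simp: steps_x_def divide_le_cancel divide_less_cancel)

definition mono2 :: "real \<Rightarrow> real \<Rightarrow> nat \<times> nat \<Rightarrow> real" where
  "mono2 x y = (\<lambda>(i, j). x ^ i * y ^ j)"

definition sum_x :: "real \<Rightarrow> real \<Rightarrow> real \<Rightarrow> real \<Rightarrow> real" where
  "sum_x \<alpha> \<beta> x y = infsum (mono2 x y) (steps_x \<alpha> \<beta>)"

definition sum_y :: "real \<Rightarrow> real \<Rightarrow> real \<Rightarrow> real \<Rightarrow> real" where
  "sum_y \<alpha> \<beta> x y = infsum (mono2 x y) (steps_y \<alpha> \<beta>)"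

text \<open>Each block of the coarse walk starts with a step to the right: a coarse right step is
  that step alone, a coarse up step is it followed by a step up. A coarse position (i, j) lies at (i
  + j, j), since every up block contains a right step.\<close>

lemma steps_x_farey_less:
  assumes "0 < \<beta>" "\<beta> < \<alpha>"
  shows "steps_x \<alpha> \<beta> = (\<lambda>(i, j). (i + j, j)) ` (steps_x (\<alpha> - \<beta>) \<beta> \<union> steps_y (\<alpha> - \<beta>) \<beta>)"
proof (intro equalityI subsetI)
  fix p assume "p \<in> steps_x \<alpha> \<beta>"
  then obtain i j where p: "p = (i, j)" "real j * \<alpha> \<le> real i * \<beta>" "real i * \<beta> < (real j + 1) * \<alpha>"
    by (auto simp: steps_x_def)
  have "real j * \<beta> \<le> real j * \<alpha>" using assms by (intro mult_left_mono) auto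
  hence "real j * \<beta> \<le> real i * \<beta>" using p by linarith
  hence "j \<le> i" using assms by simp
  hence "p = (i - j + j, j)" "(i - j, j) \<in> steps_x (\<alpha> - \<beta>) \<beta> \<union> steps_y (\<alpha> - \<beta>) \<beta>"
    using p by (auto simp: steps_x_def steps_y_def of_nat_diff algebra_simps)
  thus "p \<in> (\<lambda>(i, j). (i + j, j)) ` (steps_x (\<alpha> - \<beta>) \<beta> \<union> steps_y (\<alpha> - \<beta>) \<beta>)"
    by (intro image_eqI[of _ _ "(i - j, j)"]) auto
qed (use assms in \<open>auto simp: steps_x_def steps_y_def algebra_simps\<close>)

lemma steps_y_farey_less:
  assumes "0 < \<beta>" "\<beta> < \<alpha>"
  shows "steps_y \<alpha> \<beta> = (\<lambda>(i, j). (i + j + 1, j)) ` steps_y (\<alpha> - \<beta>) \<beta>"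
proof (intro equalityI subsetI)
  fix p assume "p \<in> steps_y \<alpha> \<beta>"
  then obtain i j where p: "p = (i, j)" "(real i - 1) * \<beta> < (real j + 1) * \<alpha>" "(real j + 1) * \<alpha> \<le> real i * \<beta>"
    by (auto simp: steps_y_def)
  have "(real j + 1) * \<beta> \<le> (real j + 1) * \<alpha>" using assms by (intro mult_left_mono) auto
  hence "(real j + 1) * \<beta> \<le> real i * \<beta>" using p by linarith
  hence "j + 1 \<le> i" using assms by simp
  hence "p = (i - (j + 1) + j + 1, j)" "(i - (j + 1), j) \<in> steps_y (\<alpha> - \<beta>) \<beta>"
    using p by (auto simp: steps_y_def of_nat_diff algebra_simps)
  thus "p \<in> (\<lambda>(i, j). (i + j + 1, j)) ` steps_y (\<alpha> - \<beta>) \<beta>"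
    by (intro image_eqI[of _ _ "(i - (j + 1), j)"]) auto
qed (auto simp: steps_y_def algebra_simps)

text \<open>Up steps are now the more frequent ones: a coarse right step is a right step followed by
  a step up, a coarse up step is a single step up, and (i, j) lies at (i, i + j).\<close>

lemma steps_x_farey_greater:
  assumes "0 < \<alpha>" "\<alpha> < \<beta>"
  shows "steps_x \<alpha> \<beta> = (\<lambda>(i, j). (i, i + j)) ` steps_x \<alpha> (\<beta> - \<alpha>)"
proof (intro equalityI subsetI)
  fix p assume "p \<in> steps_x \<alpha> \<beta>"
  then obtain i j where p: "p = (i, j)" "real j * \<alpha> \<le> real i * \<beta>" "real i * \<beta> < (real j + 1) * \<alpha>"
    by (auto simp: steps_x_def)
  have "real i * \<alpha> \<le> real i * \<beta>" using assms by (intro mult_left_mono) auto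
  hence "real i * \<alpha> < (real j + 1) * \<alpha>" using p by linarith
  hence "i \<le> j" using assms by simp
  hence "p = (i, i + (j - i))" "(i, j - i) \<in> steps_x \<alpha> (\<beta> - \<alpha>)"
    using p by (auto simp: steps_x_def of_nat_diff algebra_simps)
  thus "p \<in> (\<lambda>(i, j). (i, i + j)) ` steps_x \<alpha> (\<beta> - \<alpha>)"
    by (intro image_eqI[of _ _ "(i, j - i)"]) auto
qed (auto simp: steps_x_def algebra_simps)

lemma steps_y_pos: "0 < \<alpha> \<Longrightarrow> (i, j) \<in> steps_y \<alpha> \<beta> \<Longrightarrow> 0 < i"
  by (rule ccontr) (auto simp: steps_y_def mult_le_0_iff)

lemma steps_y_farey_greater:
  assumes "0 < \<alpha>" "\<alpha> < \<beta>"
  shows "steps_y \<alpha> \<beta> = (\<lambda>(i, j). (i + 1, i + j)) ` steps_x \<alpha> (\<beta> - \<alpha>) \<union> (\<lambda>(i, j). (i, i + j)) ` steps_y \<alpha> (\<beta> - \<alpha>)"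
    (is "_ = ?R")
proof (intro equalityI subsetI)
  fix p assume p': "p \<in> steps_y \<alpha> \<beta>"
  then obtain i j where p: "p = (i, j)" "(real i - 1) * \<beta> < (real j + 1) * \<alpha>" "(real j + 1) * \<alpha> \<le> real i * \<beta>"
    by (auto simp: steps_y_def)
  have i: "0 < i" using p' p steps_y_pos[of \<alpha> i j \<beta>] assms by auto
  have "(real i - 1) * \<alpha> \<le> (real i - 1) * \<beta>" using assms i by (intro mult_left_mono) auto
  hence "(real i - 1) * \<alpha> < (real j + 1) * \<alpha>" using p by linarith
  hence ij: "i \<le> j + 1" using assms by simp
  \<comment> \<open>The condition below says that the step up is a coarse up block at (i, j - i).
    Otherwise it closes the coarse right block that starts from (i - 1, j + 1 - i). The requirement
    \<open>i \<le> j\<close> guards the natural subtraction.\<close>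
  show "p \<in> ?R"
  proof (cases "(real i - 1) * (\<beta> - \<alpha>) < (real j - real i + 1) * \<alpha> \<and> i \<le> j")
    case True
    hence "p = (i, i + (j - i))" "(i, j - i) \<in> steps_y \<alpha> (\<beta> - \<alpha>)"
      using p by (auto simp: steps_y_def of_nat_diff algebra_simps)
    thus ?thesis by (intro UnI2 image_eqI[of _ _ "(i, j - i)"]) auto
  next
    case False
    have "real (j + 1 - i) * \<alpha> \<le> real (i - 1) * (\<beta> - \<alpha>)"
    proof (cases "i \<le> j")
      case True
      thus ?thesis using False p i ij by (auto simp: of_nat_diff algebra_simps)
    next
      case False
      hence "j + 1 - i = 0" using ij by simp
      thus ?thesis using assms by simp
    qed
    hence "p = (i - 1 + 1, i - 1 + (j + 1 - i))" "(i - 1, j + 1 - i) \<in> steps_x \<alpha> (\<beta> - \<alpha>)"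
      using p i ij by (auto simp: steps_x_def of_nat_diff algebra_simps)
    thus ?thesis by (intro UnI1 image_eqI[of _ _ "(i - 1, j + 1 - i)"]) auto
  qed
qed (use assms in \<open>auto simp: steps_x_def steps_y_def algebra_simps\<close>)

text \<open>A linear substitution of exponents means new weights, up to the monomial
  \<open>c\<close>. This turns the set identities for the walk into functional equations for its
  sums.\<close>

lemma infsum_mono2_image:
  assumes "inj_on h A" "\<And>p. p \<in> A \<Longrightarrow> mono2 x y (h p) = c * mono2 x' y' p"
  shows "infsum (mono2 x y) (h ` A) = c * infsum (mono2 x' y') A"
proof -
  have "infsum (mono2 x y) (h ` A) = infsum (\<lambda>p. c * mono2 x' y' p) A"
    using assms by (simp add: infsum_reindex o_def cong: infsum_cong)
  thus ?thesis by (simp add: infsum_cmult_right')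
qed

lemma summable_mono2_image:
  assumes "inj_on h A" "\<And>p. p \<in> A \<Longrightarrow> mono2 x y (h p) = c * mono2 x' y' p" "c \<noteq> 0"
  shows "mono2 x y summable_on (h ` A) \<longleftrightarrow> mono2 x' y' summable_on A"
proof -
  have "mono2 x y summable_on (h ` A) \<longleftrightarrow> (\<lambda>p. c * mono2 x' y' p) summable_on A"
    using assms by (simp add: summable_on_reindex o_def cong: summable_on_cong)
  thus ?thesis using assms by (simp add: summable_on_cmult_right')
qed

lemma farey_sums_less:
  assumes "0 < \<beta>" "\<beta> < \<alpha>" and sx: "mono2 x y summable_on steps_x \<alpha> \<beta>"
  shows "mono2 x (x * y) summable_on steps_x (\<alpha> - \<beta>) \<beta>" "mono2 x (x * y) summable_on steps_y (\<alpha> - \<beta>) \<beta>"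
    "sum_x \<alpha> \<beta> x y = sum_x (\<alpha> - \<beta>) \<beta> x (x * y) + sum_y (\<alpha> - \<beta>) \<beta> x (x * y)"
    "sum_y \<alpha> \<beta> x y = x * sum_y (\<alpha> - \<beta>) \<beta> x (x * y)"
proof -
  have i: "inj (\<lambda>(i :: nat, j :: nat). (i + j, j))" "inj (\<lambda>(i :: nat, j :: nat). (i + j + 1, j))"
    by (auto simp: inj_def)
  note i = inj_on_subset[OF i(1) subset_UNIV] inj_on_subset[OF i(2) subset_UNIV]
  have m: "mono2 x y (case p of (i, j) \<Rightarrow> (i + j, j)) = 1 * mono2 x (x * y) p"
    "mono2 x y (case p of (i, j) \<Rightarrow> (i + j + 1, j)) = x * mono2 x (x * y) p" for p
    by (auto simp: mono2_def power_add power_mult_distrib split: prod.splits)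
  have sU: "mono2 x (x * y) summable_on (steps_x (\<alpha> - \<beta>) \<beta> \<union> steps_y (\<alpha> - \<beta>) \<beta>)"
    using sx unfolding steps_x_farey_less[OF assms(1,2)]
    by (subst (asm) summable_mono2_image[OF i(1) m(1)]) auto
  show s: "mono2 x (x * y) summable_on steps_x (\<alpha> - \<beta>) \<beta>" "mono2 x (x * y) summable_on steps_y (\<alpha> - \<beta>) \<beta>"
    by (rule summable_on_subset_banach[OF sU]; blast)+
  have "steps_x (\<alpha> - \<beta>) \<beta> \<inter> steps_y (\<alpha> - \<beta>) \<beta> = {}" by (auto simp: steps_x_def steps_y_def)
  thus "sum_x \<alpha> \<beta> x y = sum_x (\<alpha> - \<beta>) \<beta> x (x * y) + sum_y (\<alpha> - \<beta>) \<beta> x (x * y)"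
    unfolding sum_x_def sum_y_def steps_x_farey_less[OF assms(1,2)] infsum_mono2_image[OF i(1) m(1)]
    by (simp add: infsum_Un_disjoint s)
  show "sum_y \<alpha> \<beta> x y = x * sum_y (\<alpha> - \<beta>) \<beta> x (x * y)"
    unfolding sum_x_def sum_y_def steps_y_farey_less[OF assms(1,2)] infsum_mono2_image[OF i(2) m(2)] ..
qed

lemma farey_sums_greater:
  assumes "0 < \<alpha>" "\<alpha> < \<beta>"
    and sx: "mono2 x y summable_on steps_x \<alpha> \<beta>" and sy: "mono2 x y summable_on steps_y \<alpha> \<beta>"
  shows "mono2 (x * y) y summable_on steps_x \<alpha> (\<beta> - \<alpha>)" "mono2 (x * y) y summable_on steps_y \<alpha> (\<beta> - \<alpha>)"
    "sum_x \<alpha> \<beta> x y = sum_x \<alpha> (\<beta> - \<alpha>) (x * y) y"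
    "sum_y \<alpha> \<beta> x y = x * sum_x \<alpha> (\<beta> - \<alpha>) (x * y) y + sum_y \<alpha> (\<beta> - \<alpha>) (x * y) y"
proof -
  define h1 h2 where "h1 = (\<lambda>(i :: nat, j :: nat). (i, i + j))" and "h2 = (\<lambda>(i :: nat, j :: nat). (i + 1, i + j))"
  have "inj h1" "inj h2"
    by (auto simp: inj_def h1_def h2_def)
  note i = inj_on_subset[OF this(1) subset_UNIV] inj_on_subset[OF this(2) subset_UNIV]
  have m: "mono2 x y (h1 p) = 1 * mono2 (x * y) y p" "mono2 x y (h2 p) = x * mono2 (x * y) y p" for p
    by (auto simp: mono2_def h1_def h2_def power_add power_mult_distrib split: prod.splits)
  note Sx = steps_x_farey_greater[OF assms(1,2), folded h1_def]
    and Sy = steps_y_farey_greater[OF assms(1,2), folded h1_def h2_def]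
  show s: "mono2 (x * y) y summable_on steps_x \<alpha> (\<beta> - \<alpha>)"
    using sx unfolding Sx by (subst (asm) summable_mono2_image[OF i(1) m(1)]) auto
  have s12: "mono2 x y summable_on h2 ` steps_x \<alpha> (\<beta> - \<alpha>)" "mono2 x y summable_on h1 ` steps_y \<alpha> (\<beta> - \<alpha>)"
    by (rule summable_on_subset_banach[OF sy[unfolded Sy]]; blast)+
  show s': "mono2 (x * y) y summable_on steps_y \<alpha> (\<beta> - \<alpha>)"
    using s12(2) by (subst (asm) summable_mono2_image[OF i(1) m(1)]) auto
  show "sum_x \<alpha> \<beta> x y = sum_x \<alpha> (\<beta> - \<alpha>) (x * y) y"
    unfolding sum_x_def Sx infsum_mono2_image[OF i(1) m(1)] by simp
  have "h2 ` steps_x \<alpha> (\<beta> - \<alpha>) \<inter> h1 ` steps_y \<alpha> (\<beta> - \<alpha>) = {}"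
    using assms(1) by (auto simp: steps_x_def steps_y_def h1_def h2_def algebra_simps)
  thus "sum_y \<alpha> \<beta> x y = x * sum_x \<alpha> (\<beta> - \<alpha>) (x * y) y + sum_y \<alpha> (\<beta> - \<alpha>) (x * y) y"
    unfolding sum_x_def sum_y_def Sy using s12
    by (simp add: infsum_Un_disjoint infsum_mono2_image[OF i(1) m(1)] infsum_mono2_image[OF i(2) m(2)])
qed

section \<open>Products and geometric majorants of double series\<close>

lemma has_sum_times:
  fixes f :: "'a \<Rightarrow> real" and g :: "'b \<Rightarrow> real"
  assumes f: "(f has_sum a) A" and g: "(g has_sum b) B"
  shows "((\<lambda>(p, q). f p * g q) has_sum (a * b)) (A \<times> B)"
proof (rule has_sum_SigmaI[where g = "\<lambda>p. f p * b"])
  have "f summable_on A" "g summable_on B"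
    using f g by (auto simp: has_sum_imp_summable)
  hence s: "(\<lambda>p. norm (f p)) summable_on A" "(\<lambda>p. norm (g p)) summable_on B"
    by (blast intro: iffD1[OF summable_on_iff_abs_summable_on_real])+
  have "(\<lambda>(p, q). norm (f p) * norm (g q)) summable_on (A \<times> B)"
  proof (rule summable_on_SigmaI)
    show "(\<lambda>p. norm (f p) * infsum (\<lambda>q. norm (g q)) B) summable_on A"
      by (intro summable_on_cmult_left s)
  qed (use s in \<open>auto intro!: has_sum_cmult_right\<close>)
  hence "(\<lambda>z. norm (case z of (p, q) \<Rightarrow> f p * g q)) summable_on (A \<times> B)"
    by (simp add: case_prod_unfold abs_mult)
  thus "(\<lambda>(p, q). f p * g q) summable_on (A \<times> B)"
    by (rule iffD2[OF summable_on_iff_abs_summable_on_real])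
qed (auto intro: has_sum_cmult_right has_sum_cmult_left f g)

lemma geometric_has_sum2:
  fixes x y :: real
  assumes "0 \<le> x" "x < 1" "0 \<le> y" "y < 1"
  shows "(mono2 x y has_sum (1 / (1 - x) * (1 / (1 - y)))) UNIV"
proof -
  have "((\<lambda>n. z ^ n) has_sum (1 / (1 - z))) UNIV" if "0 \<le> z" "z < 1" for z :: real
    using that geometric_sums[of z] by (intro sums_nonneg_imp_has_sum) auto
  from has_sum_times[OF this this, of x y] assms show ?thesis by (simp add: mono2_def)
qed

lemma summable_mono2:
  "0 \<le> x \<Longrightarrow> x < 1 \<Longrightarrow> 0 \<le> y \<Longrightarrow> y < 1 \<Longrightarrow> mono2 x y summable_on A"
  using summable_on_subset_banach[OF has_sum_imp_summable[OF geometric_has_sum2]] by simp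

text \<open>Comparison with the full quadrant with corner (a, b); 4 bounds the product of the two
  geometric sums for weights up to 1/2.\<close>

lemma infsum_mono2_le:
  assumes x: "0 \<le> x" "x \<le> 1 / 2" and y: "0 \<le> y" "y \<le> 1 / 2"
    and A: "\<And>i j. (i, j) \<in> A \<Longrightarrow> a \<le> i \<and> b \<le> j"
  shows "infsum (mono2 x y) A \<le> 4 * (x ^ a * y ^ b)"
proof -
  define h where "h = (\<lambda>(i :: nat, j :: nat). (a + i, b + j))"
  have "inj h" by (auto simp: inj_def h_def)
  have m: "mono2 x y (h p) = (x ^ a * y ^ b) * mono2 x y p" for p
    by (auto simp: mono2_def h_def power_add split: prod.splits)
  have "A \<subseteq> h ` UNIV"
  proof
    fix p assume "p \<in> A"
    hence "a \<le> fst p" "b \<le> snd p" using A[of "fst p" "snd p"] by auto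
    thus "p \<in> h ` UNIV" by (intro image_eqI[of _ _ "(fst p - a, snd p - b)"]) (auto simp: h_def)
  qed
  hence "infsum (mono2 x y) A \<le> infsum (mono2 x y) (h ` UNIV)"
    using x y by (intro infsum_mono2 summable_mono2) (auto simp: mono2_def)
  also have "\<dots> = (x ^ a * y ^ b) * infsum (mono2 x y) UNIV"
    by (rule infsum_mono2_image[OF \<open>inj h\<close> m])
  also have "infsum (mono2 x y) UNIV = 1 / (1 - x) * (1 / (1 - y))"
    using geometric_has_sum2[of x y] x y by (intro infsumI) auto
  also have "(x ^ a * y ^ b) * (1 / (1 - x) * (1 / (1 - y))) \<le> (x ^ a * y ^ b) * (2 * 2)"
    using x y by (intro mult_left_mono mult_mono) (auto simp: field_simps)
  finally show ?thesis by simp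
qed

section \<open>Polynomial relations for step series\<close>

text \<open>Series in two variables are encoded as \<open>fps\<close> over \<open>fps\<close>, which
  supplies the ring structure; the outer variable is x.\<close>

definition coeff2 :: "'a :: zero fps fps \<Rightarrow> nat \<Rightarrow> nat \<Rightarrow> 'a" where
  "coeff2 f i j = fps_nth (fps_nth f i) j"

text \<open>A relation rather than a function: unordered summation over all exponents carries the
  absolute convergence on which the evaluation of products rests.\<close>

definition eval2 :: "int fps fps \<Rightarrow> real \<Rightarrow> real \<Rightarrow> real \<Rightarrow> bool" where
  "eval2 f x y s \<longleftrightarrow> ((\<lambda>(i, j). of_int (coeff2 f i j) * mono2 x y (i, j)) has_sum s) UNIV"

lemma coeff2_mult:
  fixes f g :: "'a :: comm_ring_1 fps fps"
  shows "coeff2 (f * g) i j = (\<Sum>(i', j')\<in>{..i} \<times> {..j}. coeff2 f i' j' * coeff2 g (i - i') (j - j'))"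
  by (simp add: coeff2_def fps_mult_nth fps_sum_nth sum.cartesian_product atMost_atLeast0)

lemma eval2_add: "eval2 f x y s \<Longrightarrow> eval2 g x y t \<Longrightarrow> eval2 (f + g) x y (s + t)"
  unfolding eval2_def by (drule (1) has_sum_add) (simp add: coeff2_def case_prod_unfold distrib_right)

lemma eval2_zero: "eval2 0 x y 0"
  by (simp add: eval2_def coeff2_def case_prod_unfold)

lemma eval2_finite:
  assumes "finite A" "\<And>i j. (i, j) \<notin> A \<Longrightarrow> coeff2 f i j = 0"
  shows "eval2 f x y (\<Sum>(i, j)\<in>A. of_int (coeff2 f i j) * mono2 x y (i, j))"
  unfolding eval2_def using assms by (intro has_sum_finite_neutralI) auto

lemma eval2_one: "eval2 1 x y 1"
proof -
  have "coeff2 (1 :: int fps fps) i j = (if i = 0 \<and> j = 0 then 1 else 0)" for i j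
    by (simp add: coeff2_def)
  with eval2_finite[of "{(0, 0)}" 1 x y] show ?thesis by (simp add: mono2_def)
qed

lemma eval2_sum: "(\<And>i. i \<in> I \<Longrightarrow> eval2 (f i) x y (s i)) \<Longrightarrow> eval2 (\<Sum>i\<in>I. f i) x y (\<Sum>i\<in>I. s i)"
  by (induction I rule: infinite_finite_induct) (auto intro: eval2_add eval2_zero)

lemma eval2_mult:
  assumes "eval2 f x y s" "eval2 g x y t"
  shows "eval2 (f * g) x y (s * t)"
proof -
  define F where "F = (\<lambda>(i, j). of_int (coeff2 f i j) * mono2 x y (i, j))"
  define G where "G = (\<lambda>(i, j). of_int (coeff2 g i j) * mono2 x y (i, j))"
  define B where "B = (\<lambda>(i :: nat, j :: nat). {..i} \<times> {..j})"
  define h where "h = (\<lambda>((i :: nat, j :: nat), (i' :: nat, j' :: nat)). ((i', j'), (i - i', j - j')))"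
  define c where "c = (\<lambda>(i, j). of_int (coeff2 (f * g) i j) * mono2 x y (i, j))"
  define K where "K = (\<lambda>z. (\<lambda>(p, q). F p * G q) (h z))"
  have "bij_betw h (Sigma UNIV B) (UNIV \<times> UNIV)"
    by (rule bij_betwI[where g = "\<lambda>((i', j'), (i, j)). ((i' + i, j' + j), (i', j'))"])
       (auto simp: h_def B_def)
  moreover have "((\<lambda>(p, q). F p * G q) has_sum (s * t)) (UNIV \<times> UNIV)"
    using assms unfolding eval2_def F_def G_def by (rule has_sum_times)
  ultimately have "(K has_sum (s * t)) (Sigma UNIV B)"
    unfolding K_def by (subst has_sum_reindex_bij_betw)
  moreover have "((\<lambda>q. K (r, q)) has_sum c r) (B r)" for r
  proof (cases r)
    case r: (Pair i j)
    have "(\<Sum>q\<in>B r. K (r, q)) = of_int (coeff2 (f * g) i j) * mono2 x y (i, j)"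
      unfolding r B_def prod.case coeff2_mult of_int_sum sum_distrib_right
    proof (rule sum.cong[OF refl])
      fix q assume "q \<in> {..i} \<times> {..j}"
      then obtain i' j' where q: "q = (i', j')" "i' \<le> i" "j' \<le> j" by auto
      hence "x ^ i' * x ^ (i - i') = x ^ i" "y ^ j' * y ^ (j - j') = y ^ j"
        by (simp_all flip: power_add)
      moreover have "mono2 x y (i', j') * mono2 x y (i - i', j - j')
          = (x ^ i' * x ^ (i - i')) * (y ^ j' * y ^ (j - j'))"
        by (simp add: mono2_def mult_ac)
      ultimately have "mono2 x y (i', j') * mono2 x y (i - i', j - j') = mono2 x y (i, j)"
        by (simp add: mono2_def)
      thus "K ((i, j), q) = real_of_int (case q of (i', j') \<Rightarrow>
          coeff2 f i' j' * coeff2 g (i - i') (j - j')) * mono2 x y (i, j)"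
        by (simp add: q K_def h_def F_def G_def mult_ac)
    qed
    moreover have "finite (B r)" by (simp add: B_def r)
    ultimately show ?thesis using r by (intro has_sum_finiteI) (auto simp: c_def)
  qed
  ultimately have "(c has_sum (s * t)) UNIV"
    by (rule has_sum_SigmaD[where A = UNIV and B = B])
  thus ?thesis by (simp only: eval2_def c_def)
qed

lemma eval2_power: "eval2 f x y s \<Longrightarrow> eval2 (f ^ n) x y (s ^ n)"
  by (induction n) (auto intro: eval2_mult eval2_one)

definition ind2 :: "(nat \<times> nat) set \<Rightarrow> int fps fps" where
  "ind2 S = Abs_fps (\<lambda>i. Abs_fps (\<lambda>j. if (i, j) \<in> S then 1 else 0))"

definition box2 :: "nat \<Rightarrow> (nat \<Rightarrow> nat \<Rightarrow> int) \<Rightarrow> int fps fps" where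
  "box2 N c = Abs_fps (\<lambda>i. Abs_fps (\<lambda>j. if i \<le> N \<and> j \<le> N then c i j else 0))"

definition relation2 :: "nat \<Rightarrow> (nat \<Rightarrow> nat \<Rightarrow> nat \<Rightarrow> int) \<Rightarrow> (nat \<times> nat) set \<Rightarrow> int fps fps" where
  "relation2 N P S = (\<Sum>l\<le>N. box2 N (P l) * ind2 S ^ l)"

section \<open>Supports of powers of the indicator series and nonvanishing of relations\<close>

lemma coeff2_ind2: "coeff2 (ind2 S) i j = (if (i, j) \<in> S then 1 else 0)"
  by (simp add: coeff2_def ind2_def)

lemma coeff2_box2: "coeff2 (box2 N c) i j = (if i \<le> N \<and> j \<le> N then c i j else 0)"
  by (simp add: coeff2_def box2_def)

lemma coeff2_one: "coeff2 1 i j = (if i = 0 \<and> j = 0 then 1 else (0 :: int))"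
  by (simp add: coeff2_def)

lemma coeff2_sum: "coeff2 (\<Sum>l\<in>I. f l) i j = (\<Sum>l\<in>I. coeff2 (f l) i j)"
  by (simp add: coeff2_def fps_sum_nth)

lemma coeff2_mult_nonzero:
  fixes f g :: "int fps fps"
  assumes "coeff2 (f * g) i j \<noteq> 0"
  obtains i' j' where "i' \<le> i" "j' \<le> j" "coeff2 f i' j' \<noteq> 0" "coeff2 g (i - i') (j - j') \<noteq> 0"
proof -
  obtain z where "z \<in> {..i} \<times> {..j}" "(case z of (i', j') \<Rightarrow> coeff2 f i' j' * coeff2 g (i - i') (j - j')) \<noteq> 0"
    using assms unfolding coeff2_mult by (rule sum.not_neutral_contains_not_neutral)
  thus ?thesis using that by auto
qed

lemma coeff2_ind2_power_nonneg: "coeff2 (ind2 S ^ l) i j \<ge> 0"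
proof (induction l arbitrary: i j)
  case (Suc l)
  thus ?case by (auto simp: coeff2_mult coeff2_ind2 intro!: sum_nonneg)
qed (simp add: coeff2_one)

lemma coeff2_ind2_power_pos:
  assumes "(i, j) \<in> S"
  shows "coeff2 (ind2 S ^ l) (l * i) (l * j) \<ge> 1"
proof (induction l)
  case (Suc l)
  have "1 \<le> (case (i, j) of (i', j') \<Rightarrow> coeff2 (ind2 S) i' j' * coeff2 (ind2 S ^ l) (Suc l * i - i') (Suc l * j - j'))"
    using Suc assms by (simp add: coeff2_ind2)
  also have "\<dots> \<le> coeff2 (ind2 S ^ Suc l) (Suc l * i) (Suc l * j)"
    unfolding power_Suc coeff2_mult
    by (rule member_le_sum) (auto simp: coeff2_ind2 coeff2_ind2_power_nonneg)
  finally show ?case .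
qed (simp add: coeff2_one)

text \<open>On \<open>steps_x\<close> the form i \<beta> - j \<alpha> is \<alpha> times the
  fractional part of i \<beta> / \<alpha>, and Kronecker's theorem brings these fractional parts
  close to 1.\<close>

lemma steps_x_near_top:
  assumes "\<alpha> > 0" "\<beta> > 0" and indep: "\<And>d e :: int. of_int d * \<alpha> + of_int e * \<beta> = 0 \<Longrightarrow> d = 0 \<and> e = 0"
    and "\<epsilon> > 0"
  obtains i j where "(i, j) \<in> steps_x \<alpha> \<beta>" "real i * \<beta> - real j * \<alpha> > \<alpha> - \<epsilon>"
proof -
  have "\<beta> / \<alpha> \<notin> \<rat>"
  proof
    assume "\<beta> / \<alpha> \<in> \<rat>"
    then obtain a b :: int where ab: "b > 0" "\<beta> / \<alpha> = of_int a / of_int b"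
      by (elim Rats_cases') auto
    hence "of_int a * \<alpha> + of_int (- b) * \<beta> = 0" using assms by (simp add: field_simps)
    thus False using indep ab by fastforce
  qed
  then obtain k where k: "\<bar>frac (real k * (\<beta> / \<alpha>)) - 1\<bar> < \<epsilon> / \<alpha>"
    by (rule Kronecker_approx_1_explicit[of _ 1 "\<epsilon> / \<alpha>"]) (use assms in auto)
  define j where "j = nat \<lfloor>real k * (\<beta> / \<alpha>)\<rfloor>"
  have j: "real j = real k * (\<beta> / \<alpha>) - frac (real k * (\<beta> / \<alpha>))"
    using assms by (simp add: j_def frac_def)
  have eq: "real k * \<beta> - real j * \<alpha> = \<alpha> * frac (real k * (\<beta> / \<alpha>))"
    using assms unfolding j by (simp add: field_simps)
  have "0 \<le> \<alpha> * frac (real k * (\<beta> / \<alpha>))" "\<alpha> * frac (real k * (\<beta> / \<alpha>)) < \<alpha> * 1"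
    using assms frac_lt_1 by (auto intro!: mult_strict_left_mono)
  hence "(k, j) \<in> steps_x \<alpha> \<beta>"
    unfolding steps_x_def eq[symmetric] by (auto simp: algebra_simps)
  moreover have "real k * \<beta> - real j * \<alpha> > \<alpha> - \<epsilon>"
  proof -
    have "frac (real k * (\<beta> / \<alpha>)) > 1 - \<epsilon> / \<alpha>" using k by linarith
    hence "\<alpha> * frac (real k * (\<beta> / \<alpha>)) > \<alpha> * (1 - \<epsilon> / \<alpha>)" using assms by simp
    thus ?thesis unfolding eq using assms by (simp add: algebra_simps)
  qed
  ultimately show ?thesis using that by blast
qed

text \<open>Order monomials by the linear form \<open>h(i, j) = i \<beta> - j \<alpha>\<close>, which is injective on lattice
  points. On the support of the indicator series \<open>h\<close> stays below \<open>\<alpha>\<close> but comes arbitrarily close to it.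
  Among the terms of the relation whose values of \<open>h\<close> come closest to the supremum, those with the
  smallest exponent \<open>l\<close> contribute a monomial of least degree which no other term can cancel.\<close>

lemma relation2_nonzero:
  assumes \<alpha>: "\<alpha> > 0" and \<beta>: "\<beta> > 0"
    and indep: "\<And>d e :: int. of_int d * \<alpha> + of_int e * \<beta> = 0 \<Longrightarrow> d = 0 \<and> e = 0"
    and P: "l1 \<le> N" "p1 \<le> N" "q1 \<le> N" "P l1 p1 q1 \<noteq> 0"
  shows "\<exists>i j. coeff2 (relation2 N P (steps_x \<alpha> \<beta>)) i j \<noteq> 0"
proof -
  define G where "G = ind2 (steps_x \<alpha> \<beta>)"
  define h where "h i j = real i * \<beta> - real j * \<alpha>" for i j :: nat
  have h_supp: "h i j \<le> real l * \<alpha>" if "coeff2 (G ^ l) i j \<noteq> 0" for l i j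
    using that
  proof (induction l arbitrary: i j)
    case 0
    thus ?case by (auto simp: coeff2_one h_def split: if_splits)
  next
    case (Suc l)
    then obtain i' j' where ij: "i' \<le> i" "j' \<le> j" "coeff2 G i' j' \<noteq> 0" "coeff2 (G ^ l) (i - i') (j - j') \<noteq> 0"
      unfolding power_Suc by (elim coeff2_mult_nonzero)
    hence "h i' j' \<le> \<alpha>"
      by (auto simp: G_def coeff2_ind2 steps_x_def h_def algebra_simps split: if_splits)
    moreover have "h (i - i') (j - j') \<le> real l * \<alpha>" using Suc ij by blast
    moreover have "h i j = h i' j' + h (i - i') (j - j')"
      using ij by (simp add: h_def of_nat_diff algebra_simps)
    ultimately show ?case by (simp add: algebra_simps)
  qed
  define T where "T = {(l, p, q). l \<le> N \<and> p \<le> N \<and> q \<le> N \<and> P l p q \<noteq> 0}"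
  \<comment> \<open>As \<open>h\<close> is at most \<open>l * \<alpha>\<close> on the support of
    \<open>G ^ l\<close>, this bounds \<open>h\<close> on the contribution of the coefficient at (l,
    p, q); by \<open>steps_x_near_top\<close> the bound is approached.\<close>
  define \<phi> where "\<phi> = (\<lambda>(l, p, q). h p q + real l * \<alpha>)"
  have "T \<subseteq> {..N} \<times> {..N} \<times> {..N}" by (auto simp: T_def)
  hence finT: "finite T" by (rule finite_subset) auto
  have T1: "(l1, p1, q1) \<in> T" using P by (simp add: T_def)
  define H where "H = Max (\<phi> ` T)"
  have H: "\<phi> t \<le> H" if "t \<in> T" for t unfolding H_def using finT that by simp
  have "H \<in> \<phi> ` T" unfolding H_def using finT T1 by (intro Max_in) auto
  then obtain t0 where "t0 \<in> T \<and> \<phi> t0 = H" by auto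
  then obtain t0 where t0: "t0 \<in> T \<and> \<phi> t0 = H"
      and t0_min: "\<And>t. t \<in> T \<and> \<phi> t = H \<Longrightarrow> fst t0 \<le> fst t"
    using ex_has_least_nat[of "\<lambda>t. t \<in> T \<and> \<phi> t = H" t0 fst] by blast
  obtain l0 p0 q0 where t0': "t0 = (l0, p0, q0)" by (cases t0)
  obtain \<epsilon> where \<epsilon>: "\<epsilon> > 0" "\<And>t. t \<in> T \<Longrightarrow> \<phi> t > H - \<epsilon> \<Longrightarrow> \<phi> t = H"
  proof -
    define D where "D = {t \<in> T. \<phi> t \<noteq> H}"
    show ?thesis
    proof (cases "D = {}")
      case True
      thus ?thesis using that[of 1] by (auto simp: D_def)
    next
      case False
      define \<epsilon> where "\<epsilon> = H - Max (\<phi> ` D)"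
      have "finite D" using finT by (simp add: D_def)
      hence "Max (\<phi> ` D) \<in> \<phi> ` D" using False by (intro Max_in) auto
      hence "Max (\<phi> ` D) < H" using H by (force simp: D_def)
      moreover have "\<phi> t \<le> Max (\<phi> ` D)" if "t \<in> T" "\<phi> t \<noteq> H" for t
        using \<open>finite D\<close> that by (intro Max_ge) (auto simp: D_def)
      ultimately show ?thesis using that[of \<epsilon>] by (force simp: \<epsilon>_def)
    qed
  qed
  \<comment> \<open>These monomials of \<open>G ^ l0\<close> are so close to the top that,
    multiplied by x^p0 y^q0, they cannot occur in a contribution whose \<open>\<phi>\<close> is
    below \<open>H\<close>.\<close>
  define near where "near = (\<lambda>(i, j). coeff2 (G ^ l0) i j \<noteq> 0 \<and> h i j > real l0 * \<alpha> - \<epsilon>)"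
  obtain a b where ab: "(a, b) \<in> steps_x \<alpha> \<beta>" "h a b > \<alpha> - \<epsilon> / (real l0 + 1)"
    using steps_x_near_top[OF \<alpha> \<beta> indep, of "\<epsilon> / (real l0 + 1)"] \<epsilon> unfolding h_def by auto
  have "near (l0 * a, l0 * b)"
  proof -
    have "real l0 * h a b \<ge> real l0 * (\<alpha> - \<epsilon> / (real l0 + 1))"
      using ab by (intro mult_left_mono) auto
    moreover have "real l0 * (\<epsilon> / (real l0 + 1)) < \<epsilon>"
      using \<epsilon> by (simp add: divide_simps)
    ultimately have "real l0 * h a b > real l0 * \<alpha> - \<epsilon>" by (simp add: right_diff_distrib)
    moreover have "h (l0 * a) (l0 * b) = real l0 * h a b" by (simp add: h_def algebra_simps)
    ultimately show ?thesis
      using coeff2_ind2_power_pos[OF ab(1), of l0] by (auto simp: near_def G_def)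
  qed
  then obtain \<tau> where \<tau>: "near \<tau>" "\<And>s. near s \<Longrightarrow> fst \<tau> + snd \<tau> \<le> fst s + snd s"
    using ex_has_least_nat[of near _ "\<lambda>s. fst s + snd s"] by blast
  obtain i j where ij: "\<tau> = (i, j)" by (cases \<tau>)
  define I where "I = {..N} \<times> {..p0 + i} \<times> {..q0 + j}"
  define trm where "trm = (\<lambda>(l, p, q). coeff2 (box2 N (P l)) p q * coeff2 (G ^ l) (p0 + i - p) (q0 + j - q))"
  have "coeff2 (relation2 N P (steps_x \<alpha> \<beta>)) (p0 + i) (q0 + j) = (\<Sum>t\<in>I. trm t)"
    unfolding relation2_def coeff2_sum coeff2_mult G_def[symmetric] I_def trm_def
    by (subst sum.cartesian_product) (simp add: case_prod_unfold)
  also have "\<dots> = (\<Sum>t\<in>{t0}. trm t)"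
  proof (rule sum.mono_neutral_right)
    show "{t0} \<subseteq> I" using t0 t0' by (auto simp: T_def I_def)
    show "\<forall>t\<in>I - {t0}. trm t = 0"
    proof (intro ballI, rule ccontr)
      fix t assume t: "t \<in> I - {t0}" "trm t \<noteq> 0"
      obtain l p q where lpq: "t = (l, p, q)" by (cases t)
      have le: "p \<le> p0 + i" "q \<le> q0 + j" using t lpq by (auto simp: I_def)
      have tT: "t \<in> T"
        using t lpq by (auto simp: trm_def coeff2_box2 T_def I_def split: if_splits)
      have supp: "coeff2 (G ^ l) (p0 + i - p) (q0 + j - q) \<noteq> 0"
        using t lpq by (auto simp: trm_def)
      have hsum: "h p q + h (p0 + i - p) (q0 + j - q) = h p0 q0 + h i j"
        using le by (simp add: h_def of_nat_diff algebra_simps)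
      have "\<phi> t \<ge> h p q + h (p0 + i - p) (q0 + j - q)"
        using h_supp[OF supp] lpq by (simp add: \<phi>_def)
      hence "\<phi> t > H - \<epsilon>"
        using \<tau>(1) t0 t0' ij hsum by (auto simp: near_def \<phi>_def)
      hence top: "\<phi> t = H" using \<epsilon> tT by blast
      hence l: "l0 \<le> l" using t0_min[of t] tT t0' lpq by simp
      \<comment> \<open>Injectivity of the linear form leaves one way to reach \<open>H\<close> with
        a larger \<open>l\<close>: the same \<open>p\<close>, and one more power of y for each
        additional factor \<open>G\<close>.\<close>
      have "of_int (int q - int q0 - int (l - l0)) * \<alpha> + of_int (int p0 - int p) * \<beta> = 0"
        using top t0 t0' lpq l by (simp add: \<phi>_def h_def of_nat_diff algebra_simps)
      from indep[OF this] have pq: "p = p0" "q = q0 + (l - l0)" by auto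
      have l': "l0 < l"
        using t(1) l pq t0' lpq by (cases "l = l0") auto
      have j: "l - l0 \<le> j" using le pq by simp
      have s: "p0 + i - p = i" "q0 + j - q = j - (l - l0)" using pq by auto
      \<comment> \<open>The additional factors contribute at most \<open>(l - l0) * \<alpha>\<close>
        to \<open>h\<close>, so the cofactor (i', j') in \<open>G ^ l0\<close> has \<open>h\<close>
        at least \<open>h i j\<close>. It is near the top again but of smaller degree than
        \<open>\<tau>\<close>.\<close>
      have "G ^ l = G ^ l0 * G ^ (l - l0)" using l by (simp flip: power_add)
      hence "coeff2 (G ^ l0 * G ^ (l - l0)) i (j - (l - l0)) \<noteq> 0"
        using supp unfolding s by simp
      then obtain i' j' where ij': "i' \<le> i" "j' \<le> j - (l - l0)" "coeff2 (G ^ l0) i' j' \<noteq> 0"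
          "coeff2 (G ^ (l - l0)) (i - i') (j - (l - l0) - j') \<noteq> 0"
        by (rule coeff2_mult_nonzero)
      have "h (i - i') (j - (l - l0) - j') \<le> real (l - l0) * \<alpha>"
        by (rule h_supp) fact
      moreover have "h i' j' + h (i - i') (j - (l - l0) - j') = h i j + real (l - l0) * \<alpha>"
        using ij' j by (simp add: h_def of_nat_diff algebra_simps)
      moreover have "h i j > real l0 * \<alpha> - \<epsilon>" using \<tau>(1) ij by (simp add: near_def)
      ultimately have "near (i', j')" using ij' by (simp add: near_def)
      from \<tau>(2)[OF this] show False using ij ij' l' j by simp
    qed
  qed (simp add: I_def)
  also have "\<dots> = P l0 p0 q0 * coeff2 (G ^ l0) i j"
    using t0 t0' by (simp add: trm_def coeff2_box2 T_def)
  also have "\<dots> \<noteq> 0"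
    using \<tau>(1) ij t0 t0' by (auto simp: near_def T_def)
  finally show ?thesis by blast
qed

section \<open>Dependence on the slope, evaluation, and tail estimates\<close>

lemma coeff2_ind2_power_cong:
  assumes "\<And>i j. i < B \<Longrightarrow> j < B \<Longrightarrow> (i, j) \<in> S \<longleftrightarrow> (i, j) \<in> S'" "i < B" "j < B"
  shows "coeff2 (ind2 S ^ l) i j = coeff2 (ind2 S' ^ l) i j"
  using assms(2,3)
proof (induction l arbitrary: i j)
  case (Suc l)
  show ?case unfolding power_Suc coeff2_mult
    by (rule sum.cong) (use Suc assms(1) in \<open>auto simp: coeff2_ind2\<close>)
qed simp

lemma coeff2_relation2:
  "coeff2 (relation2 N P S) i j = (\<Sum>(l, p, q)\<in>{..N} \<times> {..N} \<times> {..N}.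
     if p \<le> i \<and> q \<le> j then P l p q * coeff2 (ind2 S ^ l) (i - p) (j - q) else 0)"
proof -
  have "coeff2 (box2 N (P l) * ind2 S ^ l) i j = (\<Sum>(p, q)\<in>{..N} \<times> {..N}.
      if p \<le> i \<and> q \<le> j then P l p q * coeff2 (ind2 S ^ l) (i - p) (j - q) else 0)" for l
    unfolding coeff2_mult by (rule sum.mono_neutral_cong) (auto simp: coeff2_box2 split: if_splits)
  thus ?thesis
    by (simp add: relation2_def coeff2_sum sum.cartesian_product case_prod_unfold)
qed

text \<open>Coefficients in a box see the slope only through the walk in that box. This carries a
  relation made for the limit slope over to nearby slopes.\<close>

lemma coeff2_relation2_cong:
  assumes "\<And>i j. i < B \<Longrightarrow> j < B \<Longrightarrow> (i, j) \<in> S \<longleftrightarrow> (i, j) \<in> S'" "i < B" "j < B"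
  shows "coeff2 (relation2 N P S) i j = coeff2 (relation2 N P S') i j"
  unfolding coeff2_relation2
  by (intro sum.cong refl) (use coeff2_ind2_power_cong[OF assms(1)] assms(2,3) in auto)

lemma abs_coeff2_relation2:
  "\<bar>coeff2 (relation2 N P S) i j\<bar> \<le> coeff2 (relation2 N (\<lambda>l p q. \<bar>P l p q\<bar>) S) i j"
  unfolding coeff2_relation2
  by (rule order_trans[OF sum_abs sum_mono]) (auto simp: abs_mult coeff2_ind2_power_nonneg)

lemma eval2_ind2:
  assumes "mono2 x y summable_on S"
  shows "eval2 (ind2 S) x y (infsum (mono2 x y) S)"
proof -
  have "(mono2 x y has_sum infsum (mono2 x y) S) S" using assms by simp
  thus ?thesis unfolding eval2_def
    by (subst has_sum_cong_neutral[where T = S and g = "mono2 x y"]) (auto simp: coeff2_ind2)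
qed

definition box_value :: "nat \<Rightarrow> (nat \<Rightarrow> nat \<Rightarrow> int) \<Rightarrow> real \<Rightarrow> real \<Rightarrow> real" where
  "box_value N c x y = (\<Sum>(p, q)\<in>{..N} \<times> {..N}. of_int (c p q) * (x ^ p * y ^ q))"

lemma eval2_relation2:
  assumes "mono2 x y summable_on S"
  shows "eval2 (relation2 N P S) x y (\<Sum>l\<le>N. box_value N (P l) x y * infsum (mono2 x y) S ^ l)"
proof -
  have "eval2 (box2 N c) x y (box_value N c x y)" for c
  proof -
    have "eval2 (box2 N c) x y (\<Sum>(i, j)\<in>{..N} \<times> {..N}. of_int (coeff2 (box2 N c) i j) * mono2 x y (i, j))"
      by (rule eval2_finite) (auto simp: coeff2_box2)
    also have "(\<Sum>(i, j)\<in>{..N} \<times> {..N}. of_int (coeff2 (box2 N c) i j) * mono2 x y (i, j)) = box_value N c x y"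
      unfolding box_value_def by (rule sum.cong) (auto simp: coeff2_box2 mono2_def)
    finally show ?thesis .
  qed
  thus ?thesis unfolding relation2_def
    using assms by (intro eval2_sum eval2_mult eval2_power eval2_ind2)
qed

text \<open>A monomial at (x, y) is at most (2 \<mu>)^(i + j) times its value at (1/2, 1/2), so
  terms of degree at least \<open>K\<close> gain the factor (2 \<mu>)^K over the majorant
  \<open>g\<close>. Evaluating \<open>g\<close> at a fixed point makes the bound uniform over
  levels.\<close>

lemma eval2_tail:
  assumes f: "eval2 f x y v" and g: "eval2 g (1 / 2) (1 / 2) s"
    and le: "\<And>i j. \<bar>coeff2 f i j\<bar> \<le> coeff2 g i j"
    and x: "0 \<le> x" "x \<le> \<mu>" and y: "0 \<le> y" "y \<le> \<mu>" and \<mu>: "\<mu> \<le> 1 / 2"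
    and A: "finite A" "\<And>i j. i + j < K \<Longrightarrow> (i, j) \<notin> A \<Longrightarrow> coeff2 f i j = 0"
  shows "\<bar>v - (\<Sum>(i, j)\<in>A. of_int (coeff2 f i j) * mono2 x y (i, j))\<bar> \<le> (2 * \<mu>) ^ K * s"
proof -
  define F where "F = (\<lambda>(i, j). of_int (coeff2 f i j) * mono2 x y (i, j))"
  define G where "G = (\<lambda>(i, j). of_int (coeff2 g i j) * mono2 (1 / 2) (1 / 2) (i, j))"
  have hF: "(F has_sum (v - sum F A)) (UNIV - A)"
    using f A unfolding eval2_def F_def by (intro has_sum_Diff has_sum_finite) auto
  have "(G has_sum (s - sum G A)) (UNIV - A)"
    using g A unfolding eval2_def G_def by (intro has_sum_Diff has_sum_finite) auto
  hence hG: "((\<lambda>p. (2 * \<mu>) ^ K * G p) has_sum ((2 * \<mu>) ^ K * (s - sum G A))) (UNIV - A)"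
    by (rule has_sum_cmult_right)
  have FG: "\<bar>F p\<bar> \<le> (2 * \<mu>) ^ K * G p" if "p \<in> UNIV - A" for p
  proof -
    obtain i j where p: "p = (i, j)" by (cases p)
    have g0: "0 \<le> real_of_int (coeff2 g i j)" using le[of i j] by linarith
    have \<mu>0: "0 \<le> \<mu>" using x by simp
    show ?thesis
    proof (cases "coeff2 f i j = 0")
      case True
      thus ?thesis using g0 \<mu>0 by (simp add: p F_def G_def mono2_def)
    next
      case False
      hence K: "K \<le> i + j" using A(2)[of i j] that p by force
      have "mono2 x y (i, j) \<le> \<mu> ^ i * \<mu> ^ j"
        unfolding mono2_def using x y by (auto intro!: mult_mono power_mono)
      also have "\<dots> = (2 * \<mu>) ^ (i + j) * mono2 (1 / 2) (1 / 2) (i, j)"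
        by (simp add: mono2_def power_add power_mult_distrib power_divide)
      also have "\<dots> \<le> (2 * \<mu>) ^ K * mono2 (1 / 2) (1 / 2) (i, j)"
        using K \<mu>0 \<mu> by (intro mult_right_mono power_decreasing) (auto simp: mono2_def)
      finally have m: "mono2 x y (i, j) \<le> (2 * \<mu>) ^ K * mono2 (1 / 2) (1 / 2) (i, j)" .
      have "\<bar>F p\<bar> = of_int \<bar>coeff2 f i j\<bar> * mono2 x y (i, j)"
        using x y by (simp add: p F_def abs_mult mono2_def)
      also have "\<dots> \<le> of_int (coeff2 g i j) * ((2 * \<mu>) ^ K * mono2 (1 / 2) (1 / 2) (i, j))"
        using le[of i j] m g0 x y by (intro mult_mono) (auto simp: mono2_def)
      finally show ?thesis by (simp add: p G_def mult_ac)
    qed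
  qed
  have "v - sum F A \<le> (2 * \<mu>) ^ K * (s - sum G A)"
    by (rule has_sum_mono[OF hF hG]) (use FG in force)
  moreover have "-1 * (v - sum F A) \<le> (2 * \<mu>) ^ K * (s - sum G A)"
    by (rule has_sum_mono[OF has_sum_cmult_right[OF hF] hG]) (use FG in force)
  ultimately have "\<bar>v - sum F A\<bar> \<le> (2 * \<mu>) ^ K * (s - sum G A)"
    unfolding abs_le_iff by simp
  also have "\<dots> \<le> (2 * \<mu>) ^ K * s"
  proof (rule mult_left_mono)
    have "0 \<le> real_of_int (coeff2 g i j)" for i j using le[of i j] by linarith
    hence "0 \<le> sum G A" by (intro sum_nonneg) (auto simp: G_def mono2_def)
    thus "s - sum G A \<le> s" by simp
  qed (use x in auto)
  finally show ?thesis by (simp add: F_def)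
qed

text \<open>Any two weights differ by a factor \<epsilon>, so the terms other than the largest sum
  to at most half of its weight, while its own coefficient is a nonzero integer. The bound is stated
  for any \<open>q\<close>, since the position of the largest weight is unknown.\<close>

lemma dominant_term_bound:
  fixes e :: "'a \<Rightarrow> int" and w :: "'a \<Rightarrow> real"
  assumes fin: "finite A" and q: "q \<in> A" and e: "\<And>p. p \<in> A \<Longrightarrow> e p \<noteq> 0" and w: "\<And>p. p \<in> A \<Longrightarrow> w p > 0"
    and sep: "\<And>p q. p \<in> A \<Longrightarrow> q \<in> A \<Longrightarrow> p \<noteq> q \<Longrightarrow> w p \<le> \<epsilon> * w q \<or> w q \<le> \<epsilon> * w p"
    and \<epsilon>: "0 < \<epsilon>" "\<epsilon> < 1" "\<epsilon> * (\<Sum>p\<in>A. of_int \<bar>e p\<bar>) \<le> 1 / 2"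
  shows "\<bar>\<Sum>p\<in>A. of_int (e p) * w p\<bar> \<ge> w q / 2"
proof -
  have "Max (w ` A) \<in> w ` A" using fin q by (intro Max_in) auto
  then obtain p where p: "p \<in> A" "w p = Max (w ` A)" by auto
  have max: "w r \<le> w p" if "r \<in> A" for r using that fin p by simp
  have small: "w r \<le> \<epsilon> * w p" if "r \<in> A - {p}" for r
  proof (rule ccontr)
    assume "\<not> ?thesis"
    hence "w p \<le> \<epsilon> * w r" using sep[of r p] that p by auto
    also have "\<dots> < 1 * w r" using \<epsilon> w that by (intro mult_strict_right_mono) auto
    finally show False using max[of r] that by simp
  qed
  have "\<bar>\<Sum>r\<in>A - {p}. of_int (e r) * w r\<bar> \<le> (\<Sum>r\<in>A - {p}. \<bar>of_int (e r) * w r\<bar>)"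
    by (rule sum_abs)
  also have "\<dots> \<le> (\<Sum>r\<in>A - {p}. of_int \<bar>e r\<bar> * (\<epsilon> * w p))"
    using small w by (intro sum_mono) (auto simp: abs_mult abs_of_pos intro!: mult_left_mono)
  also have "\<dots> = (\<Sum>r\<in>A - {p}. of_int \<bar>e r\<bar>) * (\<epsilon> * w p)"
    by (simp add: sum_distrib_right)
  also have "\<dots> \<le> (\<Sum>r\<in>A. of_int \<bar>e r\<bar>) * (\<epsilon> * w p)"
    using fin p w[of p] \<epsilon> by (intro mult_right_mono sum_mono2) auto
  also have "\<dots> = (\<epsilon> * (\<Sum>r\<in>A. of_int \<bar>e r\<bar>)) * w p" by (simp add: mult_ac)
  also have "\<dots> \<le> 1 / 2 * w p" using \<epsilon> w[of p] p by (intro mult_right_mono) auto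
  finally have rest: "\<bar>\<Sum>r\<in>A - {p}. of_int (e r) * w r\<bar> \<le> w p / 2" by simp
  have "\<bar>real_of_int (e p)\<bar> \<ge> 1" using e[of p] p by linarith
  hence "1 * w p \<le> \<bar>of_int (e p)\<bar> * w p" using w[of p] p by (intro mult_right_mono) auto
  hence "w p \<le> \<bar>of_int (e p) * w p\<bar>" using w[of p] p by (simp add: abs_mult)
  moreover have "(\<Sum>r\<in>A. of_int (e r) * w r) = of_int (e p) * w p + (\<Sum>r\<in>A - {p}. of_int (e r) * w r)"
    using fin p(1) by (rule sum.remove)
  ultimately have "\<bar>\<Sum>r\<in>A. of_int (e r) * w r\<bar> \<ge> w p / 2" using rest by linarith
  thus ?thesis using max[OF q] by linarith
qed

section \<open>The subtractive Euclidean algorithm\<close>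

text \<open>For strictly opposite signs, either d + e does not have the sign opposite to d, or |d| +
  |d + e| = |e| < |d| + |e|; likewise with e. This drives the descent for both kinds of linear
  forms.\<close>

lemma opposite_signs:
  fixes d e s :: int
  assumes "\<not> ((d \<ge> 0 \<and> e \<ge> 0) \<or> (d \<le> 0 \<and> e \<le> 0))" "\<bar>d\<bar> + \<bar>e\<bar> \<le> s + 1"
  shows "d \<noteq> 0 \<or> d + e \<noteq> 0" "(d \<ge> 0 \<and> d + e \<ge> 0) \<or> (d \<le> 0 \<and> d + e \<le> 0) \<or> \<bar>d\<bar> + \<bar>d + e\<bar> \<le> s"
    "d + e \<noteq> 0 \<or> e \<noteq> 0" "(d + e \<ge> 0 \<and> e \<ge> 0) \<or> (d + e \<le> 0 \<and> e \<le> 0) \<or> \<bar>d + e\<bar> + \<bar>e\<bar> \<le> s"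
  using assms by linarith+

lemma abs_linear_form_ge:
  fixes d e :: int and a b :: real
  assumes "a > 0" "b > 0" "(d \<ge> 0 \<and> e \<ge> 0) \<or> (d \<le> 0 \<and> e \<le> 0)" "d \<noteq> 0 \<or> e \<noteq> 0"
  shows "min a b \<le> \<bar>of_int d * a + of_int e * b\<bar>"
proof -
  have "\<bar>of_int d * a + of_int e * b\<bar> = of_int \<bar>d\<bar> * a + of_int \<bar>e\<bar> * b"
  proof (cases "d \<ge> 0 \<and> e \<ge> 0")
    case True
    hence "0 \<le> of_int d * a + of_int e * b" using assms by simp
    thus ?thesis using True by simp
  next
    case False
    hence de: "d \<le> 0" "e \<le> 0" using assms by auto
    hence "of_int d * a + of_int e * b \<le> 0"
      using assms by (intro add_nonpos_nonpos mult_nonpos_nonneg) auto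
    thus ?thesis using de by simp
  qed
  moreover have "min a b \<le> of_int \<bar>d\<bar> * a + of_int \<bar>e\<bar> * b"
  proof (cases "d = 0")
    case True
    hence "1 * b \<le> of_int \<bar>e\<bar> * b" using assms by (intro mult_right_mono) auto
    thus ?thesis using True assms by (simp add: min_le_iff_disj)
  next
    case False
    hence "1 * a \<le> of_int \<bar>d\<bar> * a" using assms by (intro mult_right_mono) auto
    moreover have "0 \<le> of_int \<bar>e\<bar> * b" using assms by simp
    ultimately show ?thesis by linarith
  qed
  ultimately show ?thesis by simp
qed

text \<open>\<open>\<alpha> n\<close> and \<open>\<beta> n\<close> are the frequencies of the two blocks of steps
  at level \<open>n\<close>, \<open>l n\<close> and \<open>m n\<close> are the lengths of these blocks, and \<open>x n\<close> and \<open>y n\<close> their weights.\<close>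

locale farey_orbit =
  fixes \<alpha> \<beta> x y :: "nat \<Rightarrow> real" and l m :: "nat \<Rightarrow> nat"
  assumes init_pos: "\<alpha> 0 > 0" "\<beta> 0 > 0" "x 0 > 0" "y 0 > 0"
    and init_sum: "\<alpha> 0 + \<beta> 0 = 1"
    and init_length: "l 0 = 1" "m 0 = 1"
    and init_indep: "\<And>d e :: int. of_int d * \<alpha> 0 + of_int e * \<beta> 0 = 0 \<Longrightarrow> d = 0 \<and> e = 0"
    and step_less: "\<And>n. \<beta> n < \<alpha> n \<Longrightarrow> \<alpha> (Suc n) = \<alpha> n - \<beta> n \<and> \<beta> (Suc n) = \<beta> n \<and>
       x (Suc n) = x n \<and> y (Suc n) = x n * y n \<and> l (Suc n) = l n \<and> m (Suc n) = l n + m n"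
    and step_greater: "\<And>n. \<not> \<beta> n < \<alpha> n \<Longrightarrow> \<alpha> (Suc n) = \<alpha> n \<and> \<beta> (Suc n) = \<beta> n - \<alpha> n \<and>
       x (Suc n) = x n * y n \<and> y (Suc n) = y n \<and> l (Suc n) = l n + m n \<and> m (Suc n) = m n"
    and decay: "\<alpha> 0 * ln (x 0) + \<beta> 0 * ln (y 0) < 0"
    and summable_init: "mono2 (x 0) (y 0) summable_on steps_x (\<alpha> 0) (\<beta> 0)"
      "mono2 (x 0) (y 0) summable_on steps_y (\<alpha> 0) (\<beta> 0)"
begin

section \<open>Positivity, monotonicity and growth along the orbit\<close>

lemma indep: "of_int d * \<alpha> n + of_int e * \<beta> n = 0 \<Longrightarrow> d = 0 \<and> e = 0"
proof (induction n arbitrary: d e)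
  case (Suc n)
  show ?case
  proof (cases "\<beta> n < \<alpha> n")
    case True
    hence "of_int d * \<alpha> n + of_int (e - d) * \<beta> n = 0"
      using Suc.prems step_less[of n] by (simp add: algebra_simps)
    from Suc.IH[OF this] show ?thesis by simp
  next
    case False
    hence "of_int (d - e) * \<alpha> n + of_int e * \<beta> n = 0"
      using Suc.prems step_greater[of n] by (simp add: algebra_simps)
    from Suc.IH[OF this] show ?thesis by simp
  qed
qed (use init_indep in blast)

lemma neq: "\<alpha> n \<noteq> \<beta> n"
  using indep[of 1 n "-1"] by auto

lemma pos: "\<alpha> n > 0" "\<beta> n > 0" "x n > 0" "y n > 0" "l n > 0" "m n > 0"
proof -
  have "\<alpha> n > 0 \<and> \<beta> n > 0 \<and> x n > 0 \<and> y n > 0 \<and> l n > 0 \<and> m n > 0"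
  proof (induction n)
    case (Suc n)
    thus ?case using step_less[of n] step_greater[of n] neq[of n] by (cases "\<beta> n < \<alpha> n") auto
  qed (use init_pos init_length in auto)
  thus "\<alpha> n > 0" "\<beta> n > 0" "x n > 0" "y n > 0" "l n > 0" "m n > 0" by auto
qed

lemma step_cases:
  obtains (less) "\<beta> n < \<alpha> n" "\<alpha> (Suc n) = \<alpha> n - \<beta> n" "\<beta> (Suc n) = \<beta> n"
       "x (Suc n) = x n" "y (Suc n) = x n * y n" "l (Suc n) = l n" "m (Suc n) = l n + m n"
  | (greater) "\<alpha> n < \<beta> n" "\<alpha> (Suc n) = \<alpha> n" "\<beta> (Suc n) = \<beta> n - \<alpha> n"
       "x (Suc n) = x n * y n" "y (Suc n) = y n" "l (Suc n) = l n + m n" "m (Suc n) = m n"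
  using step_less[of n] step_greater[of n] neq[of n] by (cases "\<beta> n < \<alpha> n") auto

lemma length_mono: "n \<le> k \<Longrightarrow> l n \<le> l k" "n \<le> k \<Longrightarrow> m n \<le> m k"
proof -
  have "l n \<le> l (Suc n)" "m n \<le> m (Suc n)" for n by (cases n rule: step_cases; simp)+
  thus "n \<le> k \<Longrightarrow> l n \<le> l k" "n \<le> k \<Longrightarrow> m n \<le> m k" by (blast intro: lift_Suc_mono_le)+
qed

lemma freq_antimono: "n \<le> k \<Longrightarrow> \<alpha> k \<le> \<alpha> n" "n \<le> k \<Longrightarrow> \<beta> k \<le> \<beta> n"
proof -
  have "\<alpha> (Suc n) \<le> \<alpha> n" "\<beta> (Suc n) \<le> \<beta> n" for n
    using pos[of n] by (cases n rule: step_cases; simp)+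
  thus "n \<le> k \<Longrightarrow> \<alpha> k \<le> \<alpha> n" "n \<le> k \<Longrightarrow> \<beta> k \<le> \<beta> n" by (blast intro: lift_Suc_antimono_le)+
qed

lemma freq_le_1: "\<alpha> n \<le> 1" "\<beta> n \<le> 1"
  using freq_antimono[of 0 n] init_sum init_pos by auto

text \<open>Lets factors \<open>2 ^ n\<close>, produced by the recursion, be absorbed into bounds
  exponential in the block lengths.\<close>

lemma total_length: "n + 2 \<le> l n + m n"
proof (induction n)
  case (Suc n)
  thus ?case using pos(5,6)[of n] by (cases n rule: step_cases) auto
qed (simp add: init_length)

text \<open>Steps of one kind only would subtract a fixed positive frequency forever.\<close>

lemma infinitely_many_steps: "\<exists>n\<ge>k. \<beta> n < \<alpha> n" "\<exists>n\<ge>k. \<alpha> n < \<beta> n"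
proof -
  show "\<exists>n\<ge>k. \<beta> n < \<alpha> n"
  proof (rule ccontr)
    assume *: "\<not> ?thesis"
    have "\<beta> (k + i) = \<beta> k - real i * \<alpha> k \<and> \<alpha> (k + i) = \<alpha> k" for i
    proof (induction i)
      case (Suc i)
      have "\<not> \<beta> (k + i) < \<alpha> (k + i)" using * by auto
      thus ?case using Suc step_greater[of "k + i"] by (auto simp: algebra_simps)
    qed auto
    moreover obtain i where "\<beta> k < real i * \<alpha> k" using pos[of k] reals_Archimedean3 by blast
    ultimately show False using pos(2)[of "k + i"] by simp
  qed
  show "\<exists>n\<ge>k. \<alpha> n < \<beta> n"
  proof (rule ccontr)
    assume *: "\<not> ?thesis"
    have "\<alpha> (k + i) = \<alpha> k - real i * \<beta> k \<and> \<beta> (k + i) = \<beta> k" for i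
    proof (induction i)
      case (Suc i)
      have "\<not> \<alpha> (k + i) < \<beta> (k + i)" using * by auto
      hence "\<beta> (k + i) < \<alpha> (k + i)" using neq[of "k + i"] by linarith
      thus ?case using Suc step_less[of "k + i"] by (auto simp: algebra_simps)
    qed auto
    moreover obtain i where "\<alpha> k < real i * \<beta> k" using pos[of k] reals_Archimedean3 by blast
    ultimately show False using pos(1)[of "k + i"] by simp
  qed
qed

lemma length_unbounded: "\<exists>n. \<forall>k\<ge>n. B \<le> l k \<and> B \<le> m k"
proof -
  have "\<exists>n. B \<le> l n" for B
  proof (induction B)
    case (Suc B)
    then obtain n where n: "B \<le> l n" by blast
    obtain k where "k \<ge> n" "\<alpha> k < \<beta> k" using infinitely_many_steps by blast
    hence "l (Suc k) = l k + m k" "l k \<ge> l n" using step_greater[of k] length_mono by auto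
    thus ?case using n pos(6)[of k] by (intro exI[of _ "Suc k"]) linarith
  qed auto
  moreover have "\<exists>n. B \<le> m n" for B
  proof (induction B)
    case (Suc B)
    then obtain n where n: "B \<le> m n" by blast
    obtain k where "k \<ge> n" "\<beta> k < \<alpha> k" using infinitely_many_steps by blast
    hence "m (Suc k) = l k + m k" "m k \<ge> m n" using step_less[of k] length_mono by auto
    thus ?case using n pos(5)[of k] by (intro exI[of _ "Suc k"]) linarith
  qed auto
  ultimately obtain n1 n2 where "B \<le> l n1" "B \<le> m n2" by meson
  thus ?thesis using length_mono[of n1] length_mono[of n2]
    by (intro exI[of _ "max n1 n2"]) (auto intro: order_trans)
qed

text \<open>\<open>rate\<close> is minus the mean logarithmic weight of a step, and
  \<open>skew\<close> the change of the logarithm when a right step is replaced by an up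
  step.\<close>

definition rate :: real where "rate = - (\<alpha> 0 * ln (x 0) + \<beta> 0 * ln (y 0))"
definition skew :: real where "skew = ln (y 0) - ln (x 0)"

lemma rate_pos: "rate > 0" using decay by (simp add: rate_def)

text \<open>The two blocks contain l n * \<beta> 0 - \<beta> n and m n * \<beta> 0 + \<alpha> n up
  steps. Their logarithmic weights thus deviate from the mean rate by the bounded amounts \<beta> n
  and \<alpha> n times \<open>skew\<close>.\<close>

lemma ln_xy: "ln (x n) = - (rate * l n + \<beta> n * skew)" "ln (y n) = - (rate * m n - \<alpha> n * skew)"
proof -
  have "ln (x n) = - (rate * l n + \<beta> n * skew) \<and> ln (y n) = - (rate * m n - \<alpha> n * skew)"
  proof (induction n)
    case 0
    have a: "\<alpha> 0 = 1 - \<beta> 0" using init_sum by simp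
    show ?case unfolding rate_def skew_def init_length a by (simp add: algebra_simps)
  next
    case (Suc n)
    have ln: "ln (x n * y n) = ln (x n) + ln (y n)" using pos[of n] by (simp add: ln_mult)
    show ?case
    proof (cases n rule: step_cases)
      case less
      show ?thesis unfolding less(2-) ln using Suc by (simp add: algebra_simps)
    next
      case greater
      show ?thesis unfolding greater(2-) ln using Suc by (simp add: algebra_simps)
    qed
  qed
  thus "ln (x n) = - (rate * l n + \<beta> n * skew)" "ln (y n) = - (rate * m n - \<alpha> n * skew)" by auto
qed

lemma exp_bounds:
  "\<exists>n1. \<forall>n\<ge>n1. exp (- 2 * rate * l n) \<le> x n \<and> x n \<le> exp (- (rate / 2) * l n) \<and>
      exp (- 2 * rate * m n) \<le> y n \<and> y n \<le> exp (- (rate / 2) * m n)"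
proof -
  \<comment> \<open>From this length on, the bounded deviation is at most half of
    \<open>rate\<close> times the length; hence the factors 1/2 and 2.\<close>
  obtain B :: nat where B: "2 * \<bar>skew\<bar> / rate \<le> real B" using real_arch_simple by blast
  obtain n1 where n1: "\<And>k. k \<ge> n1 \<Longrightarrow> B \<le> l k \<and> B \<le> m k" using length_unbounded by blast
  have "exp (- 2 * rate * l n) \<le> x n \<and> x n \<le> exp (- (rate / 2) * l n) \<and>
      exp (- 2 * rate * m n) \<le> y n \<and> y n \<le> exp (- (rate / 2) * m n)" if n: "n \<ge> n1" for n
  proof -
    have "rate * real B \<ge> 2 * \<bar>skew\<bar>" using B rate_pos by (simp add: field_simps)
    moreover have "rate * real B \<le> rate * l n" "rate * real B \<le> rate * m n"
      using n1[OF n] rate_pos by auto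
    ultimately have lm: "rate * l n \<ge> 2 * \<bar>skew\<bar>" "rate * m n \<ge> 2 * \<bar>skew\<bar>" by linarith+
    have "\<bar>\<beta> n * skew\<bar> \<le> 1 * \<bar>skew\<bar>" "\<bar>\<alpha> n * skew\<bar> \<le> 1 * \<bar>skew\<bar>"
      using freq_le_1[of n] pos[of n] unfolding abs_mult by (intro mult_right_mono; simp)+
    hence sk: "\<beta> n * skew \<le> \<bar>skew\<bar>" "- \<bar>skew\<bar> \<le> \<beta> n * skew"
        "\<alpha> n * skew \<le> \<bar>skew\<bar>" "- \<bar>skew\<bar> \<le> \<alpha> n * skew"
      by linarith+
    have "- 2 * rate * l n \<le> ln (x n)" "ln (x n) \<le> - (rate / 2) * l n"
      "- 2 * rate * m n \<le> ln (y n)" "ln (y n) \<le> - (rate / 2) * m n"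
      unfolding ln_xy using lm sk abs_ge_zero[of skew] by linarith+
    hence "exp (- 2 * rate * l n) \<le> exp (ln (x n))" "exp (ln (x n)) \<le> exp (- (rate / 2) * l n)"
      "exp (- 2 * rate * m n) \<le> exp (ln (y n))" "exp (ln (y n)) \<le> exp (- (rate / 2) * m n)"
      by (simp_all only: exp_le_cancel_iff)
    thus ?thesis using pos[of n] by simp
  qed
  thus ?thesis by blast
qed

definition U :: "nat \<Rightarrow> real" where "U n = sum_x (\<alpha> n) (\<beta> n) (x n) (y n)"
definition V :: "nat \<Rightarrow> real" where "V n = sum_y (\<alpha> n) (\<beta> n) (x n) (y n)"

lemma summable:
  "mono2 (x n) (y n) summable_on steps_x (\<alpha> n) (\<beta> n)" "mono2 (x n) (y n) summable_on steps_y (\<alpha> n) (\<beta> n)"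
proof -
  have "mono2 (x n) (y n) summable_on steps_x (\<alpha> n) (\<beta> n) \<and> mono2 (x n) (y n) summable_on steps_y (\<alpha> n) (\<beta> n)"
  proof (induction n)
    case (Suc n)
    note p = pos[of n]
    show ?case
    proof (cases n rule: step_cases)
      case less
      thus ?thesis using farey_sums_less(1,2)[OF p(2) less(1)] Suc by simp
    next
      case greater
      thus ?thesis using farey_sums_greater(1,2)[OF p(1) greater(1)] Suc by simp
    qed
  qed (use summable_init in auto)
  thus "mono2 (x n) (y n) summable_on steps_x (\<alpha> n) (\<beta> n)" "mono2 (x n) (y n) summable_on steps_y (\<alpha> n) (\<beta> n)"
    by auto
qed

lemma UV_less: "\<beta> n < \<alpha> n \<Longrightarrow> U n = U (Suc n) + V (Suc n)" "\<beta> n < \<alpha> n \<Longrightarrow> V n = x n * V (Suc n)"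
  unfolding U_def V_def using farey_sums_less(3,4)[OF pos(2) _ summable(1), of n] step_less[of n] by auto

lemma UV_greater: "\<alpha> n < \<beta> n \<Longrightarrow> U n = U (Suc n)" "\<alpha> n < \<beta> n \<Longrightarrow> V n = x n * U (Suc n) + V (Suc n)"
  unfolding U_def V_def using farey_sums_greater(3,4)[OF pos(1) _ summable, of n] step_greater[of n] by auto

text \<open>Solving for the next level divides by \<open>x n\<close>, as
  \<open>V (Suc n) = V n / x n\<close> in the first case; there
  \<open>y (Suc n) = x n * y n\<close>, so multiplying \<open>U\<close> and \<open>V\<close> by the
  current \<open>y\<close> cancels the division. Powers of \<open>b\<close> clear the weights,
  \<open>\<gamma>\<close> clears the initial sums, and a step costs at most one subtraction, whence
  \<open>2 ^ n\<close>.\<close>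

lemma mult_size_orbit:
  assumes W: "finite W" and x0: "mult_size W (real b * x 0) S" and y0: "mult_size W (real b * y 0) S"
    and b: "b \<ge> 1" "b \<le> S" and \<kappa>: "mult_size W (\<gamma> * U 0) \<kappa>" "mult_size W (\<gamma> * V 0) \<kappa>"
  shows "mult_size W (real b ^ l n * x n) (S ^ l n)" "mult_size W (real b ^ m n * y n) (S ^ m n)"
    "mult_size W (real b ^ m n * (\<gamma> * y n * U n)) (2 ^ n * \<kappa> * S ^ m n)"
    "mult_size W (real b ^ (l n + m n) * (\<gamma> * y n * V n)) (2 ^ n * \<kappa> * S ^ (l n + m n))"
proof -
  have bpow: "mult_size W (real b ^ k) (S ^ k)" for k
    using mult_size_mono[OF mult_size_power[OF W mult_size_of_nat[OF W, of b]], of k "S ^ k"] b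
    by (simp add: power_mono)
  have S: "S \<ge> 1" using b by simp
  have "mult_size W (real b ^ l n * x n) (S ^ l n) \<and> mult_size W (real b ^ m n * y n) (S ^ m n) \<and>
    mult_size W (real b ^ m n * (\<gamma> * y n * U n)) (2 ^ n * \<kappa> * S ^ m n) \<and>
    mult_size W (real b ^ (l n + m n) * (\<gamma> * y n * V n)) (2 ^ n * \<kappa> * S ^ (l n + m n))"
  proof (induction n)
    case 0
    have "mult_size W (real b * y 0 * (\<gamma> * U 0)) (S * \<kappa>)"
      by (intro mult_size_mult W y0 \<kappa>)
    moreover have "mult_size W (real b ^ 1 * (real b * y 0 * (\<gamma> * V 0))) (S ^ 1 * (S * \<kappa>))"
      by (intro mult_size_mult W y0 \<kappa> bpow)
    ultimately show ?case using x0 y0 by (simp add: init_length mult_ac power2_eq_square)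
  next
    case (Suc n)
    note IH = Suc[THEN conjunct1] Suc[THEN conjunct2, THEN conjunct1]
      Suc[THEN conjunct2, THEN conjunct2, THEN conjunct1] Suc[THEN conjunct2, THEN conjunct2, THEN conjunct2]
    have xy: "mult_size W ((real b ^ l n * x n) * (real b ^ m n * y n)) (S ^ l n * S ^ m n)"
      by (intro mult_size_mult W IH)
    have xu: "mult_size W ((real b ^ l n * x n) * (real b ^ m n * (\<gamma> * y n * U n)) - real b ^ (l n + m n) * (\<gamma> * y n * V n))
        (S ^ l n * (2 ^ n * \<kappa> * S ^ m n) + 2 ^ n * \<kappa> * S ^ (l n + m n))"
      by (intro mult_size_diff mult_size_mult W IH)
    have xu': "mult_size W (real b ^ (l n + m n) * (\<gamma> * y n * V n) - (real b ^ l n * x n) * (real b ^ m n * (\<gamma> * y n * U n)))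
        (2 ^ n * \<kappa> * S ^ (l n + m n) + S ^ l n * (2 ^ n * \<kappa> * S ^ m n))"
      by (intro mult_size_diff mult_size_mult W IH)
    have v: "mult_size W (real b ^ k * (real b ^ (l n + m n) * (\<gamma> * y n * V n))) (S ^ k * (2 ^ n * \<kappa> * S ^ (l n + m n)))" for k
      by (intro mult_size_mult W IH bpow)
    have xu'': "mult_size W (real b ^ k * (real b ^ (l n + m n) * (\<gamma> * y n * V n) - (real b ^ l n * x n) * (real b ^ m n * (\<gamma> * y n * U n))))
        (S ^ k * (2 ^ n * \<kappa> * S ^ (l n + m n) + S ^ l n * (2 ^ n * \<kappa> * S ^ m n)))" for k
      by (intro mult_size_mult W bpow xu')
    show ?case
    proof (cases n rule: step_cases)
      case less
      have u: "(real b ^ l n * x n) * (real b ^ m n * (\<gamma> * y n * U n)) - real b ^ (l n + m n) * (\<gamma> * y n * V n)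
          = real b ^ (l n + m n) * (\<gamma> * y (Suc n) * U (Suc n))"
        unfolding less UV_less[OF less(1)] by (simp add: power_add algebra_simps)
      have v': "real b ^ l n * (real b ^ (l n + m n) * (\<gamma> * y n * V n))
          = real b ^ (l n + (l n + m n)) * (\<gamma> * y (Suc n) * V (Suc n))"
        unfolding less UV_less[OF less(1)] by (simp add: power_add algebra_simps)
      show ?thesis unfolding less(6,7)
      proof (intro conjI)
        show "mult_size W (real b ^ l n * x (Suc n)) (S ^ l n)" using IH less by simp
        show "mult_size W (real b ^ (l n + m n) * y (Suc n)) (S ^ (l n + m n))"
          using xy less by (simp add: power_add mult_ac)
        show "mult_size W (real b ^ (l n + m n) * (\<gamma> * y (Suc n) * U (Suc n))) (2 ^ Suc n * \<kappa> * S ^ (l n + m n))"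
          by (rule mult_size_mono[OF xu[unfolded u]]) (simp add: power_add algebra_simps)
        show "mult_size W (real b ^ (l n + (l n + m n)) * (\<gamma> * y (Suc n) * V (Suc n)))
            (2 ^ Suc n * \<kappa> * S ^ (l n + (l n + m n)))"
          by (rule mult_size_mono[OF v[of "l n", unfolded v']]) (simp add: power_add algebra_simps)
      qed
    next
      case greater
      have v': "real b ^ m n * (real b ^ (l n + m n) * (\<gamma> * y n * V n) - (real b ^ l n * x n) * (real b ^ m n * (\<gamma> * y n * U n)))
          = real b ^ (l n + m n + m n) * (\<gamma> * y (Suc n) * V (Suc n))"
        unfolding greater UV_greater[OF greater(1)] by (simp add: power_add algebra_simps)
      show ?thesis unfolding greater(6,7)
      proof (intro conjI)
        show "mult_size W (real b ^ m n * y (Suc n)) (S ^ m n)" using IH greater by simp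
        show "mult_size W (real b ^ (l n + m n) * x (Suc n)) (S ^ (l n + m n))"
          using xy greater by (simp add: power_add mult_ac)
        show "mult_size W (real b ^ m n * (\<gamma> * y (Suc n) * U (Suc n))) (2 ^ Suc n * \<kappa> * S ^ m n)"
          using mult_size_mono[OF IH(3)] UV_greater[OF greater(1)] greater by simp
        show "mult_size W (real b ^ (l n + m n + m n) * (\<gamma> * y (Suc n) * V (Suc n)))
            (2 ^ Suc n * \<kappa> * S ^ (l n + m n + m n))"
          by (rule mult_size_mono[OF xu''[of "m n", unfolded v']]) (simp add: power_add algebra_simps)
      qed
    qed
  qed
  thus "mult_size W (real b ^ l n * x n) (S ^ l n)" "mult_size W (real b ^ m n * y n) (S ^ m n)"
    "mult_size W (real b ^ m n * (\<gamma> * y n * U n)) (2 ^ n * \<kappa> * S ^ m n)"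
    "mult_size W (real b ^ (l n + m n) * (\<gamma> * y n * V n)) (2 ^ n * \<kappa> * S ^ (l n + m n))"
    by auto
qed

text \<open>A step of the first kind moves 1 from \<open>\<alpha> / \<beta>\<close> to
  \<open>m / l\<close>, so \<open>\<Phi>\<close> is invariant under it; after it
  \<open>l \<le> m\<close>, and the assumption bounds \<open>\<Psi>\<close> outright by
  \<open>K + 1\<close>. The second kind exchanges the roles.\<close>

lemma ratios_bounded:
  assumes K: "K \<ge> 0" "\<And>n. n \<ge> n0 \<Longrightarrow> m n \<le> l n \<Longrightarrow> \<alpha> n \<le> K * \<beta> n"
    "\<And>n. n \<ge> n0 \<Longrightarrow> l n \<le> m n \<Longrightarrow> \<beta> n \<le> K * \<alpha> n"
  shows "\<exists>\<kappa>\<ge>1. \<forall>n\<ge>n0. \<alpha> n \<le> \<kappa> * \<beta> n \<and> \<beta> n \<le> \<kappa> * \<alpha> n \<and> real (l n) \<le> \<kappa> * m n \<and> real (m n) \<le> \<kappa> * l n"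
proof -
  define \<Phi> where "\<Phi> n = real (m n) / l n + \<alpha> n / \<beta> n" for n
  define \<Psi> where "\<Psi> n = real (l n) / m n + \<beta> n / \<alpha> n" for n
  define \<kappa> where "\<kappa> = Max {K + 1, \<Phi> n0, \<Psi> n0}"
  have \<kappa>: "K + 1 \<le> \<kappa>" "\<Phi> n0 \<le> \<kappa>" "\<Psi> n0 \<le> \<kappa>" by (simp_all add: \<kappa>_def)
  have "\<Phi> n \<le> \<kappa> \<and> \<Psi> n \<le> \<kappa>" if "n \<ge> n0" for n
    using that
  proof (induction n rule: dec_induct)
    case (step n)
    note p = pos[of n] pos[of "Suc n"]
    show ?case
    proof (cases n rule: step_cases)
      case less
      have "\<Phi> (Suc n) = \<Phi> n"
        unfolding \<Phi>_def less using p by (simp add: add_divide_distrib diff_divide_distrib)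
      moreover have lm: "l (Suc n) \<le> m (Suc n)" unfolding less by simp
      hence "\<beta> (Suc n) \<le> K * \<alpha> (Suc n)" using K(3)[of "Suc n"] step(1) by simp
      hence "\<beta> (Suc n) / \<alpha> (Suc n) \<le> K" using p(7) by (simp add: divide_le_eq)
      moreover have "real (l (Suc n)) / m (Suc n) \<le> 1" using lm p(12) by (simp add: divide_le_eq_1)
      ultimately show ?thesis using step(3) \<kappa> unfolding \<Psi>_def by linarith
    next
      case greater
      have "\<Psi> (Suc n) = \<Psi> n"
        unfolding \<Psi>_def greater using p by (simp add: add_divide_distrib diff_divide_distrib)
      moreover have lm: "m (Suc n) \<le> l (Suc n)" unfolding greater by simp
      hence "\<alpha> (Suc n) \<le> K * \<beta> (Suc n)" using K(2)[of "Suc n"] step(1) by simp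
      hence "\<alpha> (Suc n) / \<beta> (Suc n) \<le> K" using p(8) by (simp add: divide_le_eq)
      moreover have "real (m (Suc n)) / l (Suc n) \<le> 1" using lm p(11) by (simp add: divide_le_eq_1)
      ultimately show ?thesis using step(3) \<kappa> unfolding \<Phi>_def by linarith
    qed
  qed (use \<kappa> in auto)
  hence "\<alpha> n / \<beta> n \<le> \<kappa> \<and> \<beta> n / \<alpha> n \<le> \<kappa> \<and> real (l n) / m n \<le> \<kappa> \<and> real (m n) / l n \<le> \<kappa>"
    if "n \<ge> n0" for n
  proof -
    have "0 \<le> \<alpha> n / \<beta> n" "0 \<le> \<beta> n / \<alpha> n" "0 \<le> real (l n) / m n" "0 \<le> real (m n) / l n"
      using pos[of n] by simp_all
    moreover have "\<Phi> n \<le> \<kappa>" "\<Psi> n \<le> \<kappa>"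
      using \<open>\<And>n. n0 \<le> n \<Longrightarrow> \<Phi> n \<le> \<kappa> \<and> \<Psi> n \<le> \<kappa>\<close> that by auto
    ultimately show ?thesis unfolding \<Phi>_def \<Psi>_def by linarith
  qed
  hence "\<alpha> n \<le> \<kappa> * \<beta> n \<and> \<beta> n \<le> \<kappa> * \<alpha> n \<and> real (l n) \<le> \<kappa> * m n \<and> real (m n) \<le> \<kappa> * l n" if "n \<ge> n0" for n
    using that pos[of n] by (simp add: divide_le_eq)
  thus ?thesis using \<kappa> K(1) by (intro exI[of _ \<kappa>]) auto
qed

text \<open>Passing to the next level turns the coefficients into (d, d + e) or (d + e, e). With
  opposite signs this lowers |d| + |e| or makes the signs agree, and then nothing cancels.
  Frequencies decrease, so the last level bounds whichever level the descent stops at.\<close>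

lemma linear_form_freq:
  fixes d e :: int
  assumes "\<bar>d\<bar> + \<bar>e\<bar> \<le> int s" "d \<noteq> 0 \<or> e \<noteq> 0"
  shows "min (\<alpha> (n + s)) (\<beta> (n + s)) \<le> \<bar>of_int d * \<alpha> n + of_int e * \<beta> n\<bar>"
  using assms
proof (induction s arbitrary: n d e)
  case (Suc s)
  show ?case
  proof (cases "(d \<ge> 0 \<and> e \<ge> 0) \<or> (d \<le> 0 \<and> e \<le> 0)")
    case True
    have "min (\<alpha> (n + Suc s)) (\<beta> (n + Suc s)) \<le> min (\<alpha> n) (\<beta> n)"
      using freq_antimono[of n "n + Suc s"] by auto
    also have "\<dots> \<le> \<bar>of_int d * \<alpha> n + of_int e * \<beta> n\<bar>"
      using True Suc.prems by (intro abs_linear_form_ge pos) auto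
    finally show ?thesis .
  next
    case False
    note os = opposite_signs[OF this, of "int s"]
    have "\<bar>d\<bar> + \<bar>e\<bar> \<le> int s + 1" using Suc.prems by simp
    note os = os[OF this]
    have *: "min (\<alpha> (Suc n + s)) (\<beta> (Suc n + s)) \<le> \<bar>of_int d' * \<alpha> (Suc n) + of_int e' * \<beta> (Suc n)\<bar>"
      if "d' \<noteq> 0 \<or> e' \<noteq> 0" "(d' \<ge> 0 \<and> e' \<ge> 0) \<or> (d' \<le> 0 \<and> e' \<le> 0) \<or> \<bar>d'\<bar> + \<bar>e'\<bar> \<le> int s" for d' e' :: int
    proof (cases "\<bar>d'\<bar> + \<bar>e'\<bar> \<le> int s")
      case True
      thus ?thesis using Suc.IH[of d' e' "Suc n"] that by auto
    next
      case False
      have "min (\<alpha> (Suc n + s)) (\<beta> (Suc n + s)) \<le> min (\<alpha> (Suc n)) (\<beta> (Suc n))"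
        using freq_antimono[of "Suc n" "Suc n + s"] by auto
      also have "\<dots> \<le> \<bar>of_int d' * \<alpha> (Suc n) + of_int e' * \<beta> (Suc n)\<bar>"
        using False that by (intro abs_linear_form_ge pos) auto
      finally show ?thesis .
    qed
    show ?thesis
    proof (cases n rule: step_cases)
      case less
      have "of_int d * \<alpha> n + of_int e * \<beta> n = of_int d * \<alpha> (Suc n) + of_int (d + e) * \<beta> (Suc n)"
        unfolding less by (simp add: algebra_simps)
      thus ?thesis using *[OF os(1,2)] by simp
    next
      case greater
      have "of_int d * \<alpha> n + of_int e * \<beta> n = of_int (d + e) * \<alpha> (Suc n) + of_int e * \<beta> (Suc n)"
        unfolding greater by (simp add: algebra_simps)
      thus ?thesis using *[OF os(3,4)] by simp
    qed
  qed
qed auto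

text \<open>The dual descent: the logarithms are followed backwards from level n + s to level n,
  where they are smallest in absolute value. Monomials of bounded degree are thereby separated by
  any prescribed factor once n is large.\<close>

lemma linear_form_ln:
  fixes d e :: int
  assumes lt1: "\<And>k. k \<ge> n \<Longrightarrow> x k < 1 \<and> y k < 1"
    and "\<bar>d\<bar> + \<bar>e\<bar> \<le> int s" "d \<noteq> 0 \<or> e \<noteq> 0"
  shows "min (- ln (x n)) (- ln (y n)) \<le> \<bar>of_int d * ln (x (n + s)) + of_int e * ln (y (n + s))\<bar>"
  using assms(2,3)
proof (induction s arbitrary: d e)
  case (Suc s)
  have neg: "- ln (x k) > 0" "- ln (y k) > 0" if "k \<ge> n" for k
    using lt1[OF that] pos[of k] by auto
  have mono: "- ln (x (n + k)) \<ge> - ln (x n) \<and> - ln (y (n + k)) \<ge> - ln (y n)" for k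
  proof (induction k)
    case (Suc k)
    have "ln (x (n + k) * y (n + k)) = ln (x (n + k)) + ln (y (n + k))"
      using pos[of "n + k"] by (simp add: ln_mult)
    thus ?case using Suc neg[of "n + k"] by (cases "n + k" rule: step_cases) auto
  qed simp
  have same: "min (- ln (x n)) (- ln (y n)) \<le> \<bar>of_int d' * ln (x (n + k)) + of_int e' * ln (y (n + k))\<bar>"
    if "d' \<noteq> 0 \<or> e' \<noteq> 0" "(d' \<ge> 0 \<and> e' \<ge> 0) \<or> (d' \<le> 0 \<and> e' \<le> 0)" for d' e' :: int and k
  proof -
    have "min (- ln (x n)) (- ln (y n)) \<le> min (- ln (x (n + k))) (- ln (y (n + k)))"
      using mono[of k] by auto
    also have "\<dots> \<le> \<bar>of_int d' * (- ln (x (n + k))) + of_int e' * (- ln (y (n + k)))\<bar>"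
      using that neg[of "n + k"] by (intro abs_linear_form_ge) simp_all
    also have "\<dots> = \<bar>of_int d' * ln (x (n + k)) + of_int e' * ln (y (n + k))\<bar>" by simp
    finally show ?thesis .
  qed
  show ?case
  proof (cases "(d \<ge> 0 \<and> e \<ge> 0) \<or> (d \<le> 0 \<and> e \<le> 0)")
    case True
    thus ?thesis using same Suc.prems by blast
  next
    case False
    note os = opposite_signs[OF this, of "int s"]
    have "\<bar>d\<bar> + \<bar>e\<bar> \<le> int s + 1" using Suc.prems by simp
    note os = os[OF this]
    have *: "min (- ln (x n)) (- ln (y n)) \<le> \<bar>of_int d' * ln (x (n + s)) + of_int e' * ln (y (n + s))\<bar>"
      if "d' \<noteq> 0 \<or> e' \<noteq> 0" "(d' \<ge> 0 \<and> e' \<ge> 0) \<or> (d' \<le> 0 \<and> e' \<le> 0) \<or> \<bar>d'\<bar> + \<bar>e'\<bar> \<le> int s" for d' e' :: int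
      using that same[of d' e' s] Suc.IH[of d' e'] by blast
    have ln: "ln (x (n + s) * y (n + s)) = ln (x (n + s)) + ln (y (n + s))"
      using pos[of "n + s"] by (simp add: ln_mult)
    show ?thesis
    proof (cases "n + s" rule: step_cases)
      case less
      hence "of_int d * ln (x (n + Suc s)) + of_int e * ln (y (n + Suc s))
          = of_int (d + e) * ln (x (n + s)) + of_int e * ln (y (n + s))"
        using ln by (simp add: algebra_simps)
      thus ?thesis using *[OF os(3,4)] by simp
    next
      case greater
      hence "of_int d * ln (x (n + Suc s)) + of_int e * ln (y (n + Suc s))
          = of_int d * ln (x (n + s)) + of_int (d + e) * ln (y (n + s))"
        using ln by (simp add: algebra_simps)
      thus ?thesis using *[OF os(1,2)] by simp
    qed
  qed
qed auto

end

section \<open>The transcendence argument\<close>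

text \<open>Algebraicity of the initial data, expressed on one module: \<open>b\<close> clears the
  denominators of the weights, and \<open>\<gamma>\<close> those of 1, \<open>U 0\<close> and
  \<open>V 0\<close> together.\<close>

locale algebraic_farey_orbit = farey_orbit +
  fixes W :: "real set" and b S \<kappa> :: nat and \<gamma> :: real
  assumes W: "finite W" "1 \<in> W" and bS: "1 \<le> b" "b \<le> S" and \<kappa>1: "1 \<le> \<kappa>" and \<gamma>: "\<gamma> > 0"
    and size_x: "mult_size W (real b * x 0) S" and size_y: "mult_size W (real b * y 0) S"
    and size_\<gamma>: "mult_size W \<gamma> \<kappa>" "mult_size W (\<gamma> * U 0) \<kappa>" "mult_size W (\<gamma> * V 0) \<kappa>"
begin

lemmas sizes = mult_size_orbit[OF W(1) size_x size_y bS size_\<gamma>(2,3)]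

lemma S1: "1 \<le> S" using bS by simp

lemma eventually_small:
  assumes "\<epsilon> > 0"
  shows "\<exists>n1. \<forall>n\<ge>n1. x n \<le> \<epsilon> \<and> y n \<le> \<epsilon>"
proof -
  obtain n0 where n0: "\<forall>n\<ge>n0. exp (- 2 * rate * l n) \<le> x n \<and> x n \<le> exp (- (rate / 2) * l n) \<and>
      exp (- 2 * rate * m n) \<le> y n \<and> y n \<le> exp (- (rate / 2) * m n)" using exp_bounds by blast
  obtain B :: nat where B: "- 2 * ln \<epsilon> / rate \<le> real B" using real_arch_simple by blast
  obtain n1 where n1: "\<And>n. n \<ge> n1 \<Longrightarrow> B \<le> l n \<and> B \<le> m n" using length_unbounded by blast
  have "x n \<le> \<epsilon> \<and> y n \<le> \<epsilon>" if n: "n \<ge> max n0 n1" for n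
  proof -
    have "exp (- (rate / 2) * k) \<le> \<epsilon>" if "B \<le> k" for k :: nat
    proof -
      have "- 2 * ln \<epsilon> \<le> rate * B" using B rate_pos by (simp add: field_simps)
      moreover have "rate * B \<le> rate * k" using that rate_pos by simp
      ultimately have "- (rate / 2) * k \<le> ln \<epsilon>" by simp
      hence "exp (- (rate / 2) * k) \<le> exp (ln \<epsilon>)" by (simp only: exp_le_cancel_iff)
      thus ?thesis using assms by simp
    qed
    hence "exp (- (rate / 2) * l n) \<le> \<epsilon>" "exp (- (rate / 2) * m n) \<le> \<epsilon>" using n1[of n] n by auto
    thus ?thesis using n0 n by (meson max.boundedE order_trans)
  qed
  thus ?thesis by blast
qed

text \<open>Runs of equal Farey steps are bounded, since a long run would make \<open>V n\<close> or \<open>U n - 1\<close> too small.\<close>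

lemma freq_ratio_bounded:
  "\<exists>K\<ge>0. \<exists>n0. \<forall>n\<ge>n0. (m n \<le> l n \<longrightarrow> \<alpha> n \<le> K * \<beta> n) \<and> (l n \<le> m n \<longrightarrow> \<beta> n \<le> K * \<alpha> n)"
proof -
  obtain C D :: nat where C: "C > 0"
    and CD: "\<And>z T. mult_size W z T \<Longrightarrow> z \<noteq> 0 \<Longrightarrow> T \<ge> 1 \<Longrightarrow> \<bar>z\<bar> * (real C * real T ^ D) \<ge> 1"
    using mult_size_lower_bound[OF W] by blast
  define E where "E = \<gamma> * (real C * real \<kappa> ^ D)"
  define B where "B = real b * real (2 * S) ^ D"
  have E: "E > 0" using \<gamma> C \<kappa>1 by (simp add: E_def)
  have B: "B \<ge> 1"
  proof -
    have "1 * 1 \<le> real b * real (2 * S) ^ D" using bS S1 by (intro mult_mono one_le_power) auto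
    thus ?thesis by (simp add: B_def)
  qed
  \<comment> \<open>Liouville's inequality for \<open>V n\<close> and \<open>U n - 1\<close> at
    once. Powers of \<open>b\<close>, \<open>S\<close> and 2 are at most exponential in the total
    length and are collected in one base \<open>B\<close>.\<close>
  have lower: "1 \<le> v * (E * B ^ (l n + m n))"
    if z: "mult_size W (real b ^ k * (\<gamma> * y n * v)) T" "T \<le> 2 ^ (l n + m n) * \<kappa> * S ^ (l n + m n)"
      "k \<le> l n + m n" "v > 0" "y n \<le> 1" for v k T n
  proof -
    let ?t = "l n + m n"
    have z': "mult_size W (real b ^ k * (\<gamma> * y n * v)) (\<kappa> * (2 * S) ^ ?t)"
      using mult_size_mono[OF z(1,2)] by (simp add: power_mult_distrib mult_ac)
    have "1 \<le> \<bar>real b ^ k * (\<gamma> * y n * v)\<bar> * (real C * real (\<kappa> * (2 * S) ^ ?t) ^ D)"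
      using z bS \<gamma> pos(4)[of n] \<kappa>1 S1 by (intro CD[OF z']) auto
    also have "\<bar>real b ^ k * (\<gamma> * y n * v)\<bar> = real b ^ k * (\<gamma> * y n * v)"
      using z \<gamma> pos(4)[of n] by simp
    also have "\<dots> \<le> real b ^ ?t * (\<gamma> * 1 * v)"
      using z \<gamma> pos(4)[of n] bS by (intro mult_mono power_increasing) auto
    also have "real b ^ ?t * (\<gamma> * 1 * v) * (real C * real (\<kappa> * (2 * S) ^ ?t) ^ D)
        = v * (E * (real b ^ ?t * (real (2 * S) ^ ?t) ^ D))"
      by (simp add: E_def power_mult_distrib mult_ac)
    also have "(real (2 * S) ^ ?t) ^ D = (real (2 * S) ^ D) ^ ?t"
      by (simp only: power_mult[symmetric] mult.commute)
    also have "real b ^ ?t * (real (2 * S) ^ D) ^ ?t = B ^ ?t"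
      by (simp only: B_def power_mult_distrib)
    finally show ?thesis by (simp add: mult_right_mono)
  qed
  have n2: "2 ^ n \<le> (2 :: nat) ^ (l n + m n - 1)" for n
    using total_length[of n] by (intro power_increasing) auto
  obtain n0 where n0: "\<forall>n\<ge>n0. exp (- 2 * rate * l n) \<le> x n \<and> x n \<le> exp (- (rate / 2) * l n) \<and>
      exp (- 2 * rate * m n) \<le> y n \<and> y n \<le> exp (- (rate / 2) * m n)" using exp_bounds by blast
  obtain n1 where n1: "\<forall>n\<ge>n1. x n \<le> 1 / 2 \<and> y n \<le> 1 / 2" using eventually_small[of "1 / 2"] by auto
  define K where "K = 2 / rate * (\<bar>ln (4 * E)\<bar> + 2 * ln B)"
  \<comment> \<open>Here \<open>w\<close> is the weight of the longer block, of length
    \<open>L\<close>. Liouville loses at most B^(2 L), whereas \<open>w ^ k\<close> gains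
    exp(-(rate/2) k L); comparing exponents bounds \<open>k\<close> uniformly.\<close>
  have bound: "real k \<le> K" if "1 \<le> 4 * w ^ k * (E * B ^ t)" "w \<le> exp (- (rate / 2) * L)" "w > 0" "t \<le> 2 * L" "L > 0"
    for w :: real and k t L :: nat
  proof -
    have "4 * E > 0" using E by simp
    have "1 \<le> (4 * E) * (w ^ k * B ^ t)" using that(1) by (simp add: mult_ac)
    also have "\<dots> \<le> (4 * E) * (exp (- (rate / 2) * L) ^ k * B ^ (2 * L))"
      using E B that by (intro mult_left_mono mult_mono power_mono power_increasing) auto
    also have "\<dots> = exp (ln (4 * E)) * (exp (real k * (- (rate / 2) * L)) * exp (real (2 * L) * ln B))"
      using \<open>4 * E > 0\<close> B by (simp only: exp_of_nat_mult) simp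
    also have "\<dots> = exp (ln (4 * E) + (real k * (- (rate / 2) * L) + real (2 * L) * ln B))"
      by (simp only: exp_add)
    finally have "0 \<le> ln (4 * E) + (real k * (- (rate / 2) * L) + real (2 * L) * ln B)"
      by (simp only: one_le_exp_iff)
    hence "rate / 2 * (real k * real L) \<le> ln (4 * E) + 2 * (real L * ln B)"
      by (simp add: algebra_simps)
    also have "ln (4 * E) \<le> \<bar>ln (4 * E)\<bar> * real L"
    proof -
      have "\<bar>ln (4 * E)\<bar> * 1 \<le> \<bar>ln (4 * E)\<bar> * real L" using that by (intro mult_left_mono) auto
      thus ?thesis by linarith
    qed
    finally have "(rate / 2 * real k) * real L \<le> (\<bar>ln (4 * E)\<bar> + 2 * ln B) * real L"
      by (simp add: algebra_simps)
    hence "rate / 2 * real k \<le> \<bar>ln (4 * E)\<bar> + 2 * ln B" using that by simp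
    thus ?thesis using rate_pos by (simp add: K_def field_simps)
  qed
  have K0: "K \<ge> 0" using rate_pos B by (simp add: K_def)
  define k where "k = nat \<lfloor>K\<rfloor> + 1"
  have kK: "real k > K" using K0 by (simp add: k_def) linarith
  have "(m n \<le> l n \<longrightarrow> \<alpha> n \<le> real k * \<beta> n) \<and> (l n \<le> m n \<longrightarrow> \<beta> n \<le> real k * \<alpha> n)" if n: "n \<ge> max n0 n1" for n
  proof (intro conjI impI)
    let ?t = "l n + m n"
    have xy: "x n \<le> 1 / 2" "y n \<le> 1 / 2" "x n \<le> exp (- (rate / 2) * l n)" "y n \<le> exp (- (rate / 2) * m n)"
      using n0 n1 n by auto
    have p: "0 < \<alpha> n" "0 < \<beta> n" "0 < x n" "0 < y n" by (rule pos)+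
    {
      assume lm: "m n \<le> l n"
      show "\<alpha> n \<le> real k * \<beta> n"
      proof (rule ccontr)
        assume "\<not> ?thesis"
        hence less: "real k * \<beta> n < \<alpha> n" by simp
        \<comment> \<open>More than \<open>k\<close> right steps precede the first up step, so
          \<open>x n ^ k\<close> divides every monomial of \<open>V n\<close>.\<close>
        have "V n \<le> 4 * (x n ^ k * y n ^ 0)"
          unfolding V_def sum_y_def
        proof (rule infsum_mono2_le)
          fix i j assume ij: "(i, j) \<in> steps_y (\<alpha> n) (\<beta> n)"
          have "1 * \<alpha> n \<le> (real j + 1) * \<alpha> n" using p by (intro mult_right_mono) auto
          hence "real k * \<beta> n < real i * \<beta> n" using ij less by (auto simp: steps_y_def)
          thus "k \<le> i \<and> 0 \<le> j" using p by simp
        qed (use xy p in auto)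
        moreover have "V n > 0"
        proof -
          define i where "i = nat \<lceil>\<alpha> n / \<beta> n\<rceil>"
          have i: "real i = of_int \<lceil>\<alpha> n / \<beta> n\<rceil>" using p by (simp add: i_def)
          have "\<alpha> n / \<beta> n \<le> real i" "real i - 1 < \<alpha> n / \<beta> n" unfolding i by linarith+
          hence "(i, 0) \<in> steps_y (\<alpha> n) (\<beta> n)" using p by (simp add: steps_y_def field_simps)
          hence "infsum (mono2 (x n) (y n)) {(i, 0)} \<le> V n"
            unfolding V_def sum_y_def using p
            by (intro infsum_mono2 summable) (auto simp: mono2_def)
          moreover have "x n ^ i > 0" using p by simp
          ultimately show ?thesis by (simp add: mono2_def)
        qed
        moreover have "1 \<le> V n * (E * B ^ ?t)"
        proof (rule lower)
          show "mult_size W (real b ^ ?t * (\<gamma> * y n * V n)) (2 ^ n * \<kappa> * S ^ ?t)" by (rule sizes)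
          show "2 ^ n * \<kappa> * S ^ ?t \<le> 2 ^ ?t * \<kappa> * S ^ ?t"
            using total_length[of n] by (intro mult_right_mono power_increasing) auto
        qed (use xy \<open>V n > 0\<close> in auto)
        moreover have "0 \<le> E * B ^ ?t" using E B by simp
        ultimately have "1 \<le> 4 * (x n ^ k * y n ^ 0) * (E * B ^ ?t)"
          by (meson mult_right_mono order_trans)
        hence "1 \<le> 4 * x n ^ k * (E * B ^ ?t)" by simp
        hence "real k \<le> K" using xy lm pos[of n] by (intro bound[of "x n" k ?t "l n"]) auto
        thus False using kK by simp
      qed
    next
      assume lm: "l n \<le> m n"
      show "\<beta> n \<le> real k * \<alpha> n"
      proof (rule ccontr)
        assume "\<not> ?thesis"
        hence less: "real k * \<alpha> n < \<beta> n" by simp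
        have zero: "(0, 0) \<in> steps_x (\<alpha> n) (\<beta> n)" using p by (simp add: steps_x_def)
        have eq: "U n - 1 = infsum (mono2 (x n) (y n)) (steps_x (\<alpha> n) (\<beta> n) - {(0, 0)})"
          using zero summable[of n] unfolding U_def sum_x_def
          by (subst infsum_Diff) (auto simp: mono2_def)
        \<comment> \<open>At least \<open>k\<close> up steps lie between the right step at the
          origin and the next one, so \<open>y n ^ k\<close> divides every monomial of
          \<open>U n - 1\<close>.\<close>
        have "U n - 1 \<le> 4 * (x n ^ 0 * y n ^ k)"
          unfolding eq
        proof (rule infsum_mono2_le)
          fix i j assume ij: "(i, j) \<in> steps_x (\<alpha> n) (\<beta> n) - {(0, 0)}"
          have "i \<noteq> 0"
          proof
            assume "i = 0"
            hence "j = 0" using ij p by (auto simp: steps_x_def mult_le_0_iff)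
            thus False using \<open>i = 0\<close> ij by simp
          qed
          hence "1 * \<beta> n \<le> real i * \<beta> n" using p by (intro mult_right_mono) auto
          hence "real k * \<alpha> n < (real j + 1) * \<alpha> n" using ij less by (auto simp: steps_x_def)
          thus "0 \<le> i \<and> k \<le> j" using p by simp
        qed (use xy p in auto)
        moreover have "U n - 1 > 0"
        proof -
          define j where "j = nat \<lfloor>\<beta> n / \<alpha> n\<rfloor>"
          have j: "real j = of_int \<lfloor>\<beta> n / \<alpha> n\<rfloor>" using p by (simp add: j_def)
          have "real j \<le> \<beta> n / \<alpha> n" "\<beta> n / \<alpha> n < real j + 1" unfolding j by linarith+
          hence "(1, j) \<in> steps_x (\<alpha> n) (\<beta> n) - {(0, 0)}" using p by (simp add: steps_x_def field_simps)
          hence "infsum (mono2 (x n) (y n)) {(1, j)} \<le> U n - 1"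
            unfolding eq using p
            by (intro infsum_mono2 summable_on_subset_banach[OF summable(1)]) (auto simp: mono2_def)
          moreover have "x n * y n ^ j > 0" using p by simp
          ultimately show ?thesis by (simp add: mono2_def)
        qed
        moreover have "1 \<le> (U n - 1) * (E * B ^ ?t)"
        proof (rule lower)
          have "mult_size W (real b ^ m n * (\<gamma> * y n * U n) - \<gamma> * (real b ^ m n * y n)) (2 ^ n * \<kappa> * S ^ m n + \<kappa> * S ^ m n)"
            by (intro mult_size_diff mult_size_mult sizes size_\<gamma> W)
          thus "mult_size W (real b ^ m n * (\<gamma> * y n * (U n - 1))) (2 ^ n * \<kappa> * S ^ m n + \<kappa> * S ^ m n)"
            by (simp add: algebra_simps)
          have "2 ^ n * \<kappa> * S ^ m n + \<kappa> * S ^ m n = (2 ^ n + 1) * (\<kappa> * S ^ m n)" by (simp add: algebra_simps)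
          also have "\<dots> \<le> 2 ^ ?t * (\<kappa> * S ^ ?t)"
          proof (intro mult_mono power_increasing)
            have "(2 :: nat) ^ n + 1 \<le> 2 ^ Suc n" by simp
            also have "\<dots> \<le> 2 ^ ?t" using total_length[of n] by (intro power_increasing) auto
            finally show "(2 :: nat) ^ n + 1 \<le> 2 ^ ?t" .
          qed (use S1 in auto)
          finally show "2 ^ n * \<kappa> * S ^ m n + \<kappa> * S ^ m n \<le> 2 ^ ?t * \<kappa> * S ^ ?t" by (simp add: mult_ac)
        qed (use xy \<open>U n - 1 > 0\<close> in auto)
        moreover have "0 \<le> E * B ^ ?t" using E B by simp
        ultimately have "1 \<le> 4 * (x n ^ 0 * y n ^ k) * (E * B ^ ?t)"
          by (meson mult_right_mono order_trans)
        hence "1 \<le> 4 * y n ^ k * (E * B ^ ?t)" by simp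
        hence "real k \<le> K" using xy lm pos[of n] by (intro bound[of "y n" k ?t "m n"]) auto
        thus False using kK by simp
      qed
    }
  qed
  thus ?thesis by (intro exI[of _ "real k"] conjI exI[of _ "max n0 n1"] allI impI) auto
qed

lemma ratios:
  obtains r n0 where "r \<ge> 1" "\<And>n. n \<ge> n0 \<Longrightarrow> \<alpha> n \<le> r * \<beta> n" "\<And>n. n \<ge> n0 \<Longrightarrow> \<beta> n \<le> r * \<alpha> n"
    "\<And>n. n \<ge> n0 \<Longrightarrow> real (l n) \<le> r * m n" "\<And>n. n \<ge> n0 \<Longrightarrow> real (m n) \<le> r * l n"
proof -
  obtain K n0 where K: "K \<ge> 0" "\<And>n. n \<ge> n0 \<Longrightarrow> m n \<le> l n \<Longrightarrow> \<alpha> n \<le> K * \<beta> n"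
      "\<And>n. n \<ge> n0 \<Longrightarrow> l n \<le> m n \<Longrightarrow> \<beta> n \<le> K * \<alpha> n"
    using freq_ratio_bounded by blast
  from ratios_bounded[OF this] show ?thesis using that by blast
qed

text \<open>Integer forms in \<alpha> n and \<beta> n, divided by \<alpha> n + \<beta> n, stay away
  from 0 because the ratios are bounded, so a limit of normalised slopes is irrational. Membership
  in \<open>steps_x\<close> depends on signs of such forms, which are eventually those of the
  nonzero limits.\<close>

lemma limit_slope:
  obtains \<sigma> :: "nat \<Rightarrow> nat" and a c :: real where "strict_mono \<sigma>" "a > 0" "c > 0"
    "\<And>d e :: int. of_int d * a + of_int e * c = 0 \<Longrightarrow> d = 0 \<and> e = 0"
    "\<And>B. \<forall>\<^sub>F k in sequentially. \<forall>i<B. \<forall>j<B.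
       (i, j) \<in> steps_x (\<alpha> (\<sigma> k)) (\<beta> (\<sigma> k)) \<longleftrightarrow> (i, j) \<in> steps_x a c"
proof -
  obtain r n0 where r: "r \<ge> 1" "\<And>n. n \<ge> n0 \<Longrightarrow> \<alpha> n \<le> r * \<beta> n" "\<And>n. n \<ge> n0 \<Longrightarrow> \<beta> n \<le> r * \<alpha> n"
    using ratios by metis
  define A where "A n = \<alpha> n / (\<alpha> n + \<beta> n)" for n
  define A' where "A' n = \<beta> n / (\<alpha> n + \<beta> n)" for n
  have s: "\<alpha> n + \<beta> n > 0" for n using pos(1,2)[of n] by simp
  have AA': "A' n = 1 - A n" for n using s[of n] by (simp add: A_def A'_def field_simps)
  have "A n \<in> {0..1}" for n using pos(1,2)[of n] by (simp add: A_def)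
  then obtain a \<sigma> where a: "a \<in> {0..1}" "strict_mono \<sigma>" "(A \<circ> \<sigma>) \<longlonglongrightarrow> a"
    using seq_compactE[OF compact_imp_seq_compact[OF compact_Icc[of 0 "1::real"]]] by metis
  define c where "c = 1 - a"
  have limA: "(\<lambda>k. A (\<sigma> k)) \<longlonglongrightarrow> a" using a by (simp add: o_def)
  have limA': "(\<lambda>k. A' (\<sigma> k)) \<longlonglongrightarrow> c" unfolding AA' c_def by (intro tendsto_intros limA)
  \<comment> \<open>One step leaves the larger of the two frequencies as the new total, hence at
    least half of the old total; the bounded ratio gives each frequency its share.\<close>
  have half: "min (\<alpha> (n + t)) (\<beta> (n + t)) \<ge> (\<alpha> n + \<beta> n) / (2 ^ t * (r + 1))" if n: "n \<ge> n0" for n t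
  proof -
    have total: "\<alpha> (n + t) + \<beta> (n + t) \<ge> (\<alpha> n + \<beta> n) / 2 ^ t"
    proof (induction t)
      case (Suc t)
      have "\<alpha> (Suc (n + t)) + \<beta> (Suc (n + t)) \<ge> (\<alpha> (n + t) + \<beta> (n + t)) / 2"
        by (cases "n + t" rule: step_cases) auto
      thus ?case using Suc by simp
    qed simp
    have "(\<alpha> (n + t) + \<beta> (n + t)) / (r + 1) \<le> \<alpha> (n + t)" "(\<alpha> (n + t) + \<beta> (n + t)) / (r + 1) \<le> \<beta> (n + t)"
      using r(1) r(2,3)[of "n + t"] n by (auto simp: divide_le_eq algebra_simps)
    moreover have "(\<alpha> n + \<beta> n) / (2 ^ t * (r + 1)) \<le> (\<alpha> (n + t) + \<beta> (n + t)) / (r + 1)"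
      using divide_right_mono[OF total, of "r + 1"] r(1) by simp
    ultimately show ?thesis by simp
  qed
  have indep': "of_int d * a + of_int e * c \<noteq> 0" if de: "d \<noteq> 0 \<or> e \<noteq> 0" for d e :: int
  proof -
    define t where "t = nat (\<bar>d\<bar> + \<bar>e\<bar>)"
    have "1 / (2 ^ t * (r + 1)) \<le> \<bar>of_int d * A n + of_int e * A' n\<bar>" if n: "n \<ge> n0" for n
    proof -
      have "(\<alpha> n + \<beta> n) / (2 ^ t * (r + 1)) \<le> min (\<alpha> (n + t)) (\<beta> (n + t))" by (rule half[OF n])
      also have "\<dots> \<le> \<bar>of_int d * \<alpha> n + of_int e * \<beta> n\<bar>"
        using de by (intro linear_form_freq) (auto simp: t_def)
      finally have "(\<alpha> n + \<beta> n) / (2 ^ t * (r + 1)) / (\<alpha> n + \<beta> n) \<le> \<bar>of_int d * \<alpha> n + of_int e * \<beta> n\<bar> / (\<alpha> n + \<beta> n)"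
        using s[of n] by (intro divide_right_mono) auto
      also have "\<dots> = \<bar>(of_int d * \<alpha> n + of_int e * \<beta> n) / (\<alpha> n + \<beta> n)\<bar>"
        using s[of n] by simp
      also have "(of_int d * \<alpha> n + of_int e * \<beta> n) / (\<alpha> n + \<beta> n) = of_int d * A n + of_int e * A' n"
        by (simp add: A_def A'_def add_divide_distrib)
      finally show ?thesis using s[of n] by simp
    qed
    hence "\<forall>k\<ge>n0. 1 / (2 ^ t * (r + 1)) \<le> \<bar>of_int d * A (\<sigma> k) + of_int e * A' (\<sigma> k)\<bar>"
      using strict_mono_imp_increasing[OF a(2)] order_trans by blast
    moreover have "(\<lambda>k. \<bar>of_int d * A (\<sigma> k) + of_int e * A' (\<sigma> k)\<bar>) \<longlonglongrightarrow> \<bar>of_int d * a + of_int e * c\<bar>"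
      by (intro tendsto_intros limA limA')
    ultimately have "1 / (2 ^ t * (r + 1)) \<le> \<bar>of_int d * a + of_int e * c\<bar>"
      by (intro LIMSEQ_le_const) blast+
    moreover have "1 / (2 ^ t * (r + 1)) > 0" using r(1) by simp
    ultimately show ?thesis by auto
  qed
  have ac: "a > 0" "c > 0"
    using indep'[of 1 0] indep'[of 0 1] a(1) by (auto simp: c_def)
  have "\<forall>\<^sub>F k in sequentially. (i, j) \<in> steps_x (\<alpha> (\<sigma> k)) (\<beta> (\<sigma> k)) \<longleftrightarrow> (i, j) \<in> steps_x a c" for i j
  \<comment> \<open>At the origin the form \<open>i * \<beta> - j * \<alpha>\<close> vanishes
    identically, so its sign is not governed by a nonzero limit.\<close>
  proof (cases "i = 0 \<and> j = 0")
    case True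
    have "(0, 0) \<in> steps_x (\<alpha> (\<sigma> k)) (\<beta> (\<sigma> k))" for k using pos by (simp add: steps_x_def)
    thus ?thesis using True ac by (auto simp: steps_x_def)
  next
    case False
    have sign: "\<forall>\<^sub>F k in sequentially. (0 \<le> real_of_int d * A (\<sigma> k) + of_int e * A' (\<sigma> k) \<longleftrightarrow> 0 \<le> of_int d * a + of_int e * c) \<and>
        (0 < real_of_int d * A (\<sigma> k) + of_int e * A' (\<sigma> k) \<longleftrightarrow> 0 < of_int d * a + of_int e * c)"
      if de: "d \<noteq> 0 \<or> e \<noteq> 0" for d e :: int
    proof -
      have lim: "(\<lambda>k. real_of_int d * A (\<sigma> k) + of_int e * A' (\<sigma> k)) \<longlonglongrightarrow> of_int d * a + of_int e * c"
        by (intro tendsto_intros limA limA')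
      consider "of_int d * a + of_int e * c > 0" | "of_int d * a + of_int e * c < 0"
        using indep'[OF de] by linarith
      thus ?thesis
      proof cases
        case 1
        show ?thesis using order_tendstoD(1)[OF lim 1] by eventually_elim (use 1 in auto)
      next
        case 2
        show ?thesis using order_tendstoD(2)[OF lim 2] by eventually_elim (use 2 in auto)
      qed
    qed
    have "(- int j) \<noteq> 0 \<or> int i \<noteq> 0" "int j + 1 \<noteq> 0 \<or> - int i \<noteq> 0" using False by auto
    from sign[OF this(1)] sign[OF this(2)] show ?thesis
    proof eventually_elim
      case (elim k)
      have "(i, j) \<in> steps_x (\<alpha> (\<sigma> k)) (\<beta> (\<sigma> k)) \<longleftrightarrow> (i, j) \<in> steps_x (A (\<sigma> k)) (A' (\<sigma> k))"
        unfolding A_def A'_def by (rule steps_x_scale[OF s, symmetric])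
      also have "\<dots> \<longleftrightarrow> (i, j) \<in> steps_x a c" using elim by (simp add: steps_x_def algebra_simps)
      finally show ?case .
    qed
  qed
  hence "\<forall>\<^sub>F k in sequentially. \<forall>p\<in>{..<B} \<times> {..<B}.
      p \<in> steps_x (\<alpha> (\<sigma> k)) (\<beta> (\<sigma> k)) \<longleftrightarrow> p \<in> steps_x a c" for B
    by (intro eventually_ball_finite) auto
  hence "\<forall>\<^sub>F k in sequentially. \<forall>i<B. \<forall>j<B.
       (i, j) \<in> steps_x (\<alpha> (\<sigma> k)) (\<beta> (\<sigma> k)) \<longleftrightarrow> (i, j) \<in> steps_x a c" for B
    by (rule eventually_mono[where P = "\<lambda>k. \<forall>p\<in>{..<B} \<times> {..<B}. p \<in> steps_x (\<alpha> (\<sigma> k)) (\<beta> (\<sigma> k)) \<longleftrightarrow> p \<in> steps_x a c"]) auto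
  thus ?thesis using that[OF a(2) ac] indep' by blast
qed

text \<open>The order of quantifiers is essential: the base \<open>B\<close> precedes the choice of
  \<open>N\<close> and \<open>P\<close>, whose coefficients enter only \<open>E\<close>.\<close>

lemma relation_lower_bound:
  "\<exists>B\<ge>1. \<forall>N P. \<exists>E>0. \<forall>n. y n \<le> 1 \<longrightarrow> (\<Sum>k\<le>N. box_value N (P k) (x n) (y n) * U n ^ k) \<noteq> 0 \<longrightarrow>
     1 \<le> \<bar>\<Sum>k\<le>N. box_value N (P k) (x n) (y n) * U n ^ k\<bar> * (E * (B :: real) ^ (N * (l n + m n)))"
proof -
  obtain C D :: nat where C: "C > 0"
    and CD: "\<And>z T. mult_size W z T \<Longrightarrow> z \<noteq> 0 \<Longrightarrow> T \<ge> 1 \<Longrightarrow> \<bar>z\<bar> * (real C * real T ^ D) \<ge> 1"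
    using mult_size_lower_bound[OF W] by blast
  define B where "B = real b ^ 2 * (real (2 * S) ^ 2) ^ D"
  have B: "B \<ge> 1"
  proof -
    have "1 * 1 \<le> real b ^ 2 * (real (2 * S) ^ 2) ^ D" using bS S1 by (intro mult_mono one_le_power) auto
    thus ?thesis by (simp add: B_def)
  qed
  show ?thesis
  proof (rule exI[of _ B], intro conjI allI B)
    fix N :: nat and P :: "nat \<Rightarrow> nat \<Rightarrow> nat \<Rightarrow> int"
    define I where "I = {..N} \<times> {..N} \<times> {..N}"
    define Q where "Q = (\<Sum>u\<in>I. nat (case u of (k, p, q) \<Rightarrow> \<bar>P k p q\<bar>)) + 1"
    define E where "E = \<gamma> ^ N * (real C * (real Q * real \<kappa> ^ N) ^ D)"
    have Q1: "1 \<le> Q" by (simp add: Q_def)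
    have E: "E > 0" using \<gamma> C \<kappa>1 Q1 by (simp add: E_def)
    have "1 \<le> \<bar>R\<bar> * (E * B ^ (N * (l n + m n)))"
      if y1: "y n \<le> 1" and R: "R = (\<Sum>k\<le>N. box_value N (P k) (x n) (y n) * U n ^ k)" "R \<noteq> 0" for n R
    proof -
      define t where "t = l n + m n"
      \<comment> \<open>Every term is padded to degree \<open>N\<close> in the weights and in
        \<open>U n\<close>, with \<open>\<gamma> * (b ^ m n * y n)\<close> filling the missing
        powers of \<open>U n\<close>. All terms then share the multiplier in \<open>f_eq\<close>,
        and each factor has a known size.\<close>
      define f where "f = (\<lambda>(k, p, q). of_int (P k p q) * (real b ^ (l n * (N - p)) * (real b ^ l n * x n) ^ p *
         (real b ^ (m n * (N - q)) * (real b ^ m n * y n) ^ q) *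
         ((\<gamma> * (real b ^ m n * y n)) ^ (N - k) * (real b ^ m n * (\<gamma> * y n * U n)) ^ k)))"
      have bpow: "mult_size W (real b ^ k) (S ^ k)" for k
        using mult_size_mono[OF mult_size_power[OF W(1) mult_size_of_nat[OF W(1), of b]], of k "S ^ k"] bS
        by (simp add: power_mono)
      have f_size: "mult_size W (f u) (nat (case u of (k, p, q) \<Rightarrow> \<bar>P k p q\<bar>) * (\<kappa> ^ N * (2 * S) ^ (2 * N * t)))"
        if uI: "u \<in> I" for u
      proof -
        obtain k p q where u: "u = (k, p, q)" "k \<le> N" "p \<le> N" "q \<le> N" using uI by (auto simp: I_def)
        have fs: "mult_size W (f u) (nat \<bar>P k p q\<bar> * (S ^ (l n * (N - p)) * (S ^ l n) ^ p *
            (S ^ (m n * (N - q)) * (S ^ m n) ^ q) *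
            ((\<kappa> * S ^ m n) ^ (N - k) * (2 ^ n * \<kappa> * S ^ m n) ^ k)))"
          unfolding u f_def prod.case
          by (intro mult_size_mult mult_size_of_int mult_size_power sizes size_\<gamma> bpow W)
        have e1: "S ^ (l n * (N - p)) * (S ^ l n) ^ p = S ^ (l n * N)"
          using u by (simp flip: power_mult power_add distrib_left)
        have e2: "S ^ (m n * (N - q)) * (S ^ m n) ^ q = S ^ (m n * N)"
          using u by (simp flip: power_mult power_add distrib_left)
        have "(\<kappa> * S ^ m n) ^ (N - k) * (2 ^ n * \<kappa> * S ^ m n) ^ k \<le> \<kappa> ^ N * (2 ^ t * S ^ m n) ^ N"
        proof -
          have "(\<kappa> * S ^ m n) ^ (N - k) * (2 ^ n * \<kappa> * S ^ m n) ^ k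
              \<le> (\<kappa> * (2 ^ t * S ^ m n)) ^ (N - k) * (\<kappa> * (2 ^ t * S ^ m n)) ^ k"
          proof -
            have 1: "\<kappa> * S ^ m n \<le> \<kappa> * (2 ^ t * S ^ m n)" by simp
            have "(2 :: nat) ^ n \<le> 2 ^ t" using total_length[of n] by (intro power_increasing) (auto simp: t_def)
            hence 2: "2 ^ n * \<kappa> * S ^ m n \<le> \<kappa> * (2 ^ t * S ^ m n)" by simp
            show ?thesis by (rule mult_le_mono[OF power_mono[OF 1] power_mono[OF 2]]) auto
          qed
          also have "\<dots> = (\<kappa> * (2 ^ t * S ^ m n)) ^ N" using u by (simp flip: power_add)
          finally show ?thesis by (simp add: power_mult_distrib)
        qed
        hence "S ^ (l n * N) * S ^ (m n * N) * ((\<kappa> * S ^ m n) ^ (N - k) * (2 ^ n * \<kappa> * S ^ m n) ^ k)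
            \<le> S ^ (l n * N) * S ^ (m n * N) * (\<kappa> ^ N * (2 ^ t * S ^ m n) ^ N)"
          by simp
        also have "\<dots> = \<kappa> ^ N * (2 ^ (t * N) * S ^ (N * (l n + m n + m n)))"
          by (simp add: power_mult_distrib power_add algebra_simps flip: power_mult)
        also have "\<dots> \<le> \<kappa> ^ N * (2 ^ (2 * N * t) * S ^ (2 * N * t))"
        proof -
          have 1: "(2 :: nat) ^ (t * N) \<le> 2 ^ (2 * N * t)" by (rule power_increasing) auto
          have 2: "S ^ (N * (l n + m n + m n)) \<le> S ^ (2 * N * t)"
            using S1 by (intro power_increasing) (auto simp: t_def algebra_simps)
          show ?thesis by (rule mult_left_mono[OF mult_le_mono[OF 1 2]]) simp
        qed
        finally have e3: "nat \<bar>P k p q\<bar> * (S ^ (l n * N) * S ^ (m n * N) * ((\<kappa> * S ^ m n) ^ (N - k) * (2 ^ n * \<kappa> * S ^ m n) ^ k))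
            \<le> nat \<bar>P k p q\<bar> * (\<kappa> ^ N * (2 * S) ^ (2 * N * t))"
          by (simp add: power_mult_distrib)
        show ?thesis using mult_size_mono[OF fs[unfolded e1 e2] e3] by (simp add: u)
      qed
      have "mult_size W (\<Sum>u\<in>I. f u) (\<Sum>u\<in>I. nat (case u of (k, p, q) \<Rightarrow> \<bar>P k p q\<bar>) * (\<kappa> ^ N * (2 * S) ^ (2 * N * t)))"
        by (intro mult_size_sum f_size W) (auto simp: I_def)
      also have "(\<Sum>u\<in>I. nat (case u of (k, p, q) \<Rightarrow> \<bar>P k p q\<bar>) * (\<kappa> ^ N * (2 * S) ^ (2 * N * t)))
          = (\<Sum>u\<in>I. nat (case u of (k, p, q) \<Rightarrow> \<bar>P k p q\<bar>)) * (\<kappa> ^ N * (2 * S) ^ (2 * N * t))"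
        by (rule sum_distrib_right[symmetric])
      finally have sumf: "mult_size W (\<Sum>u\<in>I. f u) (Q * (\<kappa> ^ N * (2 * S) ^ (2 * N * t)))"
        by (rule mult_size_mono) (simp add: Q_def)
      have f_eq: "(\<Sum>u\<in>I. f u) = \<gamma> ^ N * y n ^ N * real b ^ (N * (t + m n)) * R"
      proof -
        have "f (k, p, q) = \<gamma> ^ N * y n ^ N * real b ^ (N * (t + m n)) * (of_int (P k p q) * (x n ^ p * y n ^ q) * U n ^ k)"
          if "k \<le> N" "p \<le> N" "q \<le> N" for k p q
        proof -
          have e1: "real b ^ (l n * (N - p)) * (real b ^ l n * x n) ^ p = real b ^ (l n * N) * x n ^ p"
            using that by (simp add: power_mult_distrib flip: power_mult power_add distrib_left mult.assoc)
          have e2: "real b ^ (m n * (N - q)) * (real b ^ m n * y n) ^ q = real b ^ (m n * N) * y n ^ q"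
            using that by (simp add: power_mult_distrib flip: power_mult power_add distrib_left mult.assoc)
          have e3: "(\<gamma> * (real b ^ m n * y n)) ^ (N - k) * (real b ^ m n * (\<gamma> * y n * U n)) ^ k
              = (\<gamma> * (real b ^ m n * y n)) ^ N * U n ^ k"
          proof -
            have "(real b ^ m n * (\<gamma> * y n * U n)) ^ k = (\<gamma> * (real b ^ m n * y n)) ^ k * U n ^ k"
              by (simp add: power_mult_distrib mult_ac)
            moreover have "(\<gamma> * (real b ^ m n * y n)) ^ N = (\<gamma> * (real b ^ m n * y n)) ^ (N - k) * (\<gamma> * (real b ^ m n * y n)) ^ k"
              using that by (simp flip: power_add)
            ultimately show ?thesis by (simp only: mult.assoc)
          qed
          show ?thesis unfolding f_def prod.case e1 e2 e3
            by (simp add: power_mult_distrib power_add t_def algebra_simps flip: power_mult)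
        qed
        hence "(\<Sum>u\<in>I. f u) = (\<Sum>(k, p, q)\<in>I. \<gamma> ^ N * y n ^ N * real b ^ (N * (t + m n)) *
            (of_int (P k p q) * (x n ^ p * y n ^ q) * U n ^ k))"
          by (intro sum.cong) (auto simp: I_def)
        also have "\<dots> = \<gamma> ^ N * y n ^ N * real b ^ (N * (t + m n)) * (\<Sum>k\<le>N. \<Sum>(p, q)\<in>{..N} \<times> {..N}.
            of_int (P k p q) * (x n ^ p * y n ^ q) * U n ^ k)"
          by (simp add: I_def sum.cartesian_product sum_distrib_left case_prod_unfold)
        also have "(\<Sum>k\<le>N. \<Sum>(p, q)\<in>{..N} \<times> {..N}. of_int (P k p q) * (x n ^ p * y n ^ q) * U n ^ k) = R"
          unfolding R box_value_def by (simp add: sum_distrib_right case_prod_unfold)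
        finally show ?thesis .
      qed
      have y: "0 < y n" by (rule pos)
      have "1 \<le> \<bar>\<Sum>u\<in>I. f u\<bar> * (real C * real (Q * (\<kappa> ^ N * (2 * S) ^ (2 * N * t))) ^ D)"
      proof (rule CD[OF sumf])
        show "(\<Sum>u\<in>I. f u) \<noteq> 0" unfolding f_eq using \<gamma> y bS R by simp
        show "1 \<le> Q * (\<kappa> ^ N * (2 * S) ^ (2 * N * t))" using \<kappa>1 S1 Q1 by simp
      qed
      also have "\<dots> \<le> (\<gamma> ^ N * 1 * real b ^ (N * (2 * t)) * \<bar>R\<bar>) * (real C * real (Q * (\<kappa> ^ N * (2 * S) ^ (2 * N * t))) ^ D)"
      proof -
        have 1: "y n ^ N \<le> 1" using y y1 by (intro power_le_one) auto
        have 2: "real b ^ (N * (t + m n)) \<le> real b ^ (N * (2 * t))"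
          using bS by (intro power_increasing) (auto simp: t_def)
        have "\<bar>\<Sum>u\<in>I. f u\<bar> = \<gamma> ^ N * y n ^ N * real b ^ (N * (t + m n)) * \<bar>R\<bar>"
          unfolding f_eq using \<gamma> y by (simp add: abs_mult)
        also have "\<dots> \<le> \<gamma> ^ N * 1 * real b ^ (N * (2 * t)) * \<bar>R\<bar>"
          using y \<gamma> by (intro mult_right_mono mult_mono order_refl 1 2) auto
        finally show ?thesis by (rule mult_right_mono) simp
      qed
      also have "\<dots> = \<bar>R\<bar> * (E * (real b ^ (N * (2 * t)) * (real (2 * S) ^ (2 * N * t)) ^ D))"
        by (simp add: E_def power_mult_distrib mult_ac)
      also have "real b ^ (N * (2 * t)) = (real b ^ 2) ^ (N * t)"
        by (simp add: mult_ac flip: power_mult)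
      also have "(real (2 * S) ^ (2 * N * t)) ^ D = ((real (2 * S) ^ 2) ^ D) ^ (N * t)"
        by (simp only: power_mult[symmetric] mult_ac)
      also have "(real b ^ 2) ^ (N * t) * ((real (2 * S) ^ 2) ^ D) ^ (N * t) = B ^ (N * t)"
        by (simp only: B_def power_mult_distrib)
      finally show ?thesis by (simp only: t_def)
    qed
    thus "\<exists>E>0. \<forall>n. y n \<le> 1 \<longrightarrow> (\<Sum>k\<le>N. box_value N (P k) (x n) (y n) * U n ^ k) \<noteq> 0 \<longrightarrow>
        1 \<le> \<bar>\<Sum>k\<le>N. box_value N (P k) (x n) (y n) * U n ^ k\<bar> * (E * B ^ (N * (l n + m n)))"
      using E by (intro exI[of _ E]) auto
  qed
qed

theorem impossible: False
proof -
  obtain r :: real and n0 where r: "r \<ge> 1" "\<And>n. n \<ge> n0 \<Longrightarrow> real (l n) \<le> r * m n" "\<And>n. n \<ge> n0 \<Longrightarrow> real (m n) \<le> r * l n"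
    using ratios by metis
  obtain n1 where n1: "\<forall>n\<ge>n1. exp (- 2 * rate * l n) \<le> x n \<and> x n \<le> exp (- (rate / 2) * l n) \<and>
      exp (- 2 * rate * m n) \<le> y n \<and> y n \<le> exp (- (rate / 2) * m n)" using exp_bounds by blast
  define t where "t n = l n + m n" for n
  \<comment> \<open>By the bounded ratios each block has length at least t n / (r + 1), so this
    exponent serves both weights in terms of the total length.\<close>
  define c where "c = rate / (2 * (r + 1))"
  have c: "c > 0" using rate_pos r by (simp add: c_def)
  define \<mu> where "\<mu> n = exp (- c * t n)" for n
  have xy_le: "x n \<le> \<mu> n" "y n \<le> \<mu> n" if n: "n \<ge> max n0 n1" for n
  proof -
    have "real (t n) \<le> (r + 1) * l n" "real (t n) \<le> (r + 1) * m n"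
      using r(2,3)[of n] n by (simp_all add: t_def algebra_simps)
    hence "c * t n \<le> c * ((r + 1) * l n)" "c * t n \<le> c * ((r + 1) * m n)"
      using c by (simp_all only: mult_le_cancel_left_pos)
    moreover have "c * ((r + 1) * z) = rate / 2 * z" for z
    proof -
      have "2 * (r + 1) \<noteq> 0" using r(1) by simp
      hence "c * (2 * (r + 1)) = rate" unfolding c_def by (rule nonzero_eq_divide_eq[THEN iffD1, OF _ refl])
      hence "rate = c * (2 * (r + 1))" ..
      thus ?thesis by (simp add: algebra_simps)
    qed
    ultimately have "- (rate / 2) * l n \<le> - c * t n" "- (rate / 2) * m n \<le> - c * t n" by auto
    hence "exp (- (rate / 2) * l n) \<le> \<mu> n" "exp (- (rate / 2) * m n) \<le> \<mu> n"
      unfolding \<mu>_def by (simp_all only: exp_le_cancel_iff)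
    thus "x n \<le> \<mu> n" "y n \<le> \<mu> n" using n1 n by (meson max.boundedE order_trans)+
  qed
  have xy_ge: "exp (- 2 * rate * t n) \<le> x n" "exp (- 2 * rate * t n) \<le> y n" if n: "n \<ge> max n0 n1" for n
  proof -
    have "- 2 * rate * t n \<le> - 2 * rate * l n" "- 2 * rate * t n \<le> - 2 * rate * m n"
      using rate_pos by (auto simp: t_def)
    hence "exp (- 2 * rate * t n) \<le> exp (- 2 * rate * l n)" "exp (- 2 * rate * t n) \<le> exp (- 2 * rate * m n)"
      by (simp_all only: exp_le_cancel_iff)
    thus "exp (- 2 * rate * t n) \<le> x n" "exp (- 2 * rate * t n) \<le> y n"
      using n1 n by (meson max.boundedE order_trans)+
  qed
  have t_ge: "n \<le> t n" for n using total_length[of n] by (simp add: t_def)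
  have small: "\<forall>\<^sub>F n in sequentially. a * exp (- q * t n) \<le> \<epsilon>" if "\<epsilon> > 0" "q > 0" "a \<ge> 0" for a q \<epsilon> :: real
  proof -
    have "filterlim (\<lambda>n. real (t n)) at_top sequentially"
      by (rule filterlim_at_top_mono[OF filterlim_real_sequentially]) (use t_ge in auto)
    hence "filterlim (\<lambda>n. q * real (t n)) at_top sequentially"
      using that by (intro filterlim_tendsto_pos_mult_at_top[OF tendsto_const])
    hence "(\<lambda>n. exp (- (q * real (t n)))) \<longlonglongrightarrow> 0"
      by (intro filterlim_compose[OF exp_at_bot]) (simp add: filterlim_uminus_at_bot)
    hence "(\<lambda>n. a * exp (- (q * real (t n)))) \<longlonglongrightarrow> a * 0" by (intro tendsto_intros)
    hence "\<forall>\<^sub>F n in sequentially. a * exp (- (q * real (t n))) < \<epsilon>"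
      using order_tendstoD(2)[of _ "a * 0" sequentially \<epsilon>] that by simp
    thus ?thesis by eventually_elim simp
  qed
  have \<mu>_small: "\<forall>\<^sub>F n in sequentially. 2 * \<mu> n \<le> exp (- (c / 2) * t n)"
  proof -
    have "\<forall>\<^sub>F n in sequentially. 2 * exp (- (c / 2) * t n) \<le> 1"
      using small[of 1 "c / 2" 2] c by simp
    thus ?thesis
    proof eventually_elim
      case (elim n)
      have "- c * t n = - (c / 2) * t n + - (c / 2) * t n" by (simp add: field_simps)
      hence "2 * \<mu> n = (2 * exp (- (c / 2) * t n)) * exp (- (c / 2) * t n)"
        unfolding \<mu>_def by (simp only: exp_add mult.assoc)
      also have "\<dots> \<le> 1 * exp (- (c / 2) * t n)" using elim by (intro mult_right_mono) auto
      finally show ?case by simp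
    qed
  qed

  obtain \<sigma> :: "nat \<Rightarrow> nat" and a e :: real where \<sigma>: "strict_mono \<sigma>" and ae: "a > 0" "e > 0"
    and ae_indep: "\<And>d f :: int. of_int d * a + of_int f * e = 0 \<Longrightarrow> d = 0 \<and> f = 0"
    and agree: "\<And>B. \<forall>\<^sub>F k in sequentially. \<forall>i<B. \<forall>j<B.
       (i, j) \<in> steps_x (\<alpha> (\<sigma> k)) (\<beta> (\<sigma> k)) \<longleftrightarrow> (i, j) \<in> steps_x a e"
    by (rule limit_slope) (rule that)
  obtain B :: real where B: "B \<ge> 1" and lower: "\<forall>N P. \<exists>E>0. \<forall>n. y n \<le> 1 \<longrightarrow>
      (\<Sum>k\<le>N. box_value N (P k) (x n) (y n) * U n ^ k) \<noteq> 0 \<longrightarrow>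
      1 \<le> \<bar>\<Sum>k\<le>N. box_value N (P k) (x n) (y n) * U n ^ k\<bar> * (E * B ^ (N * (l n + m n)))"
    using relation_lower_bound by (elim exE conjE) (rule that)
  \<comment> \<open>Vanishing to order \<open>M\<close> makes \<open>R n\<close> about exp(-(c/2) M
    t), while Liouville's bound allows B^(N t). With M = N (Q + 1) this \<open>Q\<close> leaves a
    margin of exp(-t), and the exponents 2 and 3 give M^2 = N^3 < (N + 1)^3, more unknowns than
    conditions.\<close>
  obtain Q :: nat where Q: "(ln B + 1) / (c / 2) \<le> real Q" using real_arch_simple by blast
  have Q': "ln B + 1 \<le> c / 2 * Q" using Q c by (simp add: field_simps)
  define N where "N = (Q + 1) ^ 2"
  define M where "M = (Q + 1) ^ 3"
  have N1: "N \<ge> 1" by (simp add: N_def)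
  have NM: "M = N * (Q + 1)" by (simp add: N_def M_def power2_eq_square power3_eq_cube)

  define G where "G = ind2 (steps_x a e)"
  define I where "I = {..N} \<times> {..N} \<times> {..N}"
  define co where "co = (\<lambda>(i, j) (k, p, q). if p \<le> i \<and> q \<le> j then coeff2 (G ^ k) (i - p) (j - q) else 0)"
  obtain z where z: "\<exists>u\<in>I. z u \<noteq> 0" "\<And>v. v \<in> {..<M} \<times> {..<M} \<Longrightarrow> (\<Sum>u\<in>I. co v u * z u) = 0"
  proof -
    \<comment> \<open>Any bound on the entries will do, as the solution is fixed before n
      grows.\<close>
    define mx where "mx = nat (Max (insert 0 ((\<lambda>(v, u). \<bar>co v u\<bar>) ` (({..<M} \<times> {..<M}) \<times> I))))"
    have fin: "finite I" by (simp add: I_def)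
    have "\<bar>co v u\<bar> \<le> int mx" if "u \<in> I" "v \<in> {..<M} \<times> {..<M}" for u v
    proof -
      have "\<bar>co v u\<bar> \<le> Max (insert 0 ((\<lambda>(v, u). \<bar>co v u\<bar>) ` (({..<M} \<times> {..<M}) \<times> I)))"
        using that fin by (intro Max_ge) (auto intro!: image_eqI[of _ _ "(v, u)"])
      also have "\<dots> \<le> int mx" unfolding mx_def by linarith
      finally show ?thesis .
    qed
    moreover have "card ({..<M} \<times> {..<M}) < card I"
    proof -
      have "card ({..<M} \<times> {..<M}) = N ^ 3"
        by (simp add: M_def N_def flip: power_mult power_add)
      also have "\<dots> < (N + 1) ^ 3" by (intro power_strict_mono) auto
      also have "\<dots> = card I" by (simp add: I_def power3_eq_cube)
      finally show ?thesis .
    qed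
    ultimately show ?thesis using that fin by (elim integer_pigeonhole[rotated 3]) auto
  qed
  define P where "P k p q = z (k, p, q)" for k p q
  have vanish: "coeff2 (relation2 N P (steps_x a e)) i j = 0" if "i < M" "j < M" for i j
  proof -
    have "(\<Sum>u\<in>I. co (i, j) u * z u) = 0" using z(2)[of "(i, j)"] that by simp
    moreover have "coeff2 (relation2 N P (steps_x a e)) i j = (\<Sum>u\<in>I. co (i, j) u * z u)"
      unfolding coeff2_relation2 I_def co_def G_def P_def by (rule sum.cong) auto
    ultimately show ?thesis by simp
  qed
  obtain k1 p1 q1 where "k1 \<le> N" "p1 \<le> N" "q1 \<le> N" "P k1 p1 q1 \<noteq> 0"
    using z(1) by (auto simp: I_def P_def)
  then obtain i0 j0 where ij0: "coeff2 (relation2 N P (steps_x a e)) i0 j0 \<noteq> 0"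
    using relation2_nonzero[OF ae ae_indep] by blast

  define R where "R n = (\<Sum>k\<le>N. box_value N (P k) (x n) (y n) * U n ^ k)" for n
  define f where "f n = relation2 N P (steps_x (\<alpha> n) (\<beta> n))" for n
  define g where "g n = relation2 N (\<lambda>k p q. \<bar>P k p q\<bar>) (steps_x (\<alpha> n) (\<beta> n))" for n
  \<comment> \<open>4 bounds \<open>sum_x\<close> at (1/2, 1/2) for every slope, so \<open>H\<close>
    majorizes \<open>h n\<close> independently of n; the added 1 makes it positive.\<close>
  define H where "H = (\<Sum>k\<le>N. box_value N (\<lambda>p q. \<bar>P k p q\<bar>) (1 / 2) (1 / 2) * 4 ^ k) + 1"
  define h where "h n = (\<Sum>k\<le>N. box_value N (\<lambda>p q. \<bar>P k p q\<bar>) (1 / 2) (1 / 2) * sum_x (\<alpha> n) (\<beta> n) (1 / 2) (1 / 2) ^ k)" for n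
  have box_nonneg: "0 \<le> box_value N (\<lambda>p q. \<bar>P k p q\<bar>) (1 / 2) (1 / 2)" for k
    unfolding box_value_def by (intro sum_nonneg) auto
  have H: "H > 0" unfolding H_def using box_nonneg by (intro add_nonneg_pos sum_nonneg) auto
  have f_eval: "eval2 (f n) (x n) (y n) (R n)" for n
    unfolding f_def R_def U_def sum_x_def by (intro eval2_relation2 summable)
  have g_eval: "eval2 (g n) (1 / 2) (1 / 2) (h n)" for n
    unfolding g_def h_def sum_x_def by (intro eval2_relation2 summable_mono2) auto
  have fg: "\<bar>coeff2 (f n) i j\<bar> \<le> coeff2 (g n) i j" for n i j
    unfolding f_def g_def by (rule abs_coeff2_relation2)
  have h_le: "h n \<le> H" for n
  proof -
    have "sum_x (\<alpha> n) (\<beta> n) (1 / 2) (1 / 2) \<le> 4"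
      using infsum_mono2_le[of "1 / 2" "1 / 2" "steps_x (\<alpha> n) (\<beta> n)" 0 0] by (simp add: sum_x_def)
    moreover have "0 \<le> sum_x (\<alpha> n) (\<beta> n) (1 / 2) (1 / 2)"
      unfolding sum_x_def by (intro infsum_nonneg) (auto simp: mono2_def)
    ultimately have "h n \<le> H - 1"
      unfolding h_def H_def using box_nonneg by (auto intro!: sum_mono mult_left_mono power_mono)
    thus ?thesis by simp
  qed
  have tail: "\<bar>R n - (\<Sum>(i, j)\<in>A. of_int (coeff2 (f n) i j) * mono2 (x n) (y n) (i, j))\<bar> \<le> (2 * \<mu> n) ^ K * H"
    if n: "n \<ge> max n0 n1" "\<mu> n \<le> 1 / 2" and A: "finite A" "\<And>i j. i + j < K \<Longrightarrow> (i, j) \<notin> A \<Longrightarrow> coeff2 (f n) i j = 0"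
    for n A K
  proof -
    have "\<bar>R n - (\<Sum>(i, j)\<in>A. of_int (coeff2 (f n) i j) * mono2 (x n) (y n) (i, j))\<bar> \<le> (2 * \<mu> n) ^ K * h n"
      using xy_le[OF n(1)] pos(3,4)[of n] n A by (intro eval2_tail[OF f_eval g_eval fg]) auto
    also have "\<dots> \<le> (2 * \<mu> n) ^ K * H" using h_le by (intro mult_left_mono) (auto simp: \<mu>_def)
    finally show ?thesis .
  qed

  define D where "D = i0 + j0"
  obtain K0 :: nat where K0: "(2 * rate * D + 1) / (c / 2) \<le> real K0" using real_arch_simple by blast
  \<comment> \<open>At level n the monomial at (i0, j0) is at least exp(-2 rate D t), and the tail
    from degree \<open>K\<close> on about exp(-(c/2) K t), so the monomial wins by a factor exp(t).
    Moreover K > D puts (i0, j0) into the box.\<close>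
  define K where "K = max K0 (D + 1)"
  have "(2 * rate * D + 1) / (c / 2) \<le> real K" using K0 by (simp add: K_def)
  hence K: "2 * rate * D + 1 \<le> c / 2 * K" using c by (simp add: field_simps)
  define cf where "cf = (\<lambda>(i, j). coeff2 (relation2 N P (steps_x a e)) i j)"
  define A where "A = {p \<in> {..<K} \<times> {..<K}. cf p \<noteq> 0}"
  have finA: "finite A" by (simp add: A_def)
  have A0: "(i0, j0) \<in> A" using ij0 by (auto simp: A_def cf_def K_def D_def)
  define Z where "Z = (\<Sum>p\<in>A. real_of_int \<bar>cf p\<bar>)"
  have Z: "Z > 0"
    unfolding Z_def by (rule sum_pos2[OF finA A0]) (use A0 in \<open>auto simp: A_def\<close>)
  define \<epsilon> where "\<epsilon> = min (1 / 2) (1 / (2 * Z))"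
  have \<epsilon>: "0 < \<epsilon>" "\<epsilon> < 1" "\<epsilon> * Z \<le> 1 / 2"
  proof -
    have "\<epsilon> * Z \<le> 1 / (2 * Z) * Z" using Z by (intro mult_right_mono) (auto simp: \<epsilon>_def)
    thus "\<epsilon> * Z \<le> 1 / 2" using Z by simp
  qed (use Z in \<open>auto simp: \<epsilon>_def\<close>)
  obtain n2 where n2: "\<And>n. n \<ge> n2 \<Longrightarrow> x n \<le> \<epsilon> \<and> y n \<le> \<epsilon>" using eventually_small[OF \<epsilon>(1)] by blast
  \<comment> \<open>Exponents in the box differ by at most \<open>2 * K\<close> in the l^1 norm, so
    \<open>s\<close> levels suffice for the descent in \<open>linear_form_ln\<close>. Level n - s is
    already past \<open>n2\<close>, where both weights are at most \<epsilon>.\<close>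
  define s where "s = 2 * K"
  have sep: "mono2 (x n) (y n) p \<le> \<epsilon> * mono2 (x n) (y n) q \<or> mono2 (x n) (y n) q \<le> \<epsilon> * mono2 (x n) (y n) p"
    if n: "n \<ge> n2 + s" and pq: "p \<in> A" "q \<in> A" "p \<noteq> q" for n p q
  proof -
    obtain i j i' j' where ij: "p = (i, j)" "q = (i', j')" "i < K" "j < K" "i' < K" "j' < K"
      using pq by (auto simp: A_def)
    have "x k < 1 \<and> y k < 1" if "k \<ge> n - s" for k
    proof -
      have "n2 \<le> k" using n that by linarith
      from n2[OF this] show ?thesis using \<epsilon>(2) by simp
    qed
    hence h1: "min (- ln (x (n - s))) (- ln (y (n - s)))
        \<le> \<bar>of_int (int i - int i') * ln (x (n - s + s)) + of_int (int j - int j') * ln (y (n - s + s))\<bar>"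
      using ij pq by (intro linear_form_ln) (auto simp: s_def)
    have h2: "- ln \<epsilon> \<le> min (- ln (x (n - s))) (- ln (y (n - s)))"
      using n2[of "n - s"] n pos(3,4)[of "n - s"] \<epsilon>(1) by (simp add: ln_le_cancel_iff)
    have ln_mono: "ln (mono2 (x n) (y n) (i, j)) = real i * ln (x n) + real j * ln (y n)" for i j
      using pos(3,4)[of n] by (simp add: mono2_def ln_mult ln_realpow)
    have "- ln \<epsilon> \<le> \<bar>ln (mono2 (x n) (y n) p) - ln (mono2 (x n) (y n) q)\<bar>"
      using order_trans[OF h2 h1] n ij by (simp add: ln_mono algebra_simps)
    moreover have mpos: "mono2 (x n) (y n) p > 0" for p
      using pos(3,4)[of n] by (simp add: mono2_def split: prod.splits)
    moreover have "ln (\<epsilon> * mono2 (x n) (y n) p) = ln \<epsilon> + ln (mono2 (x n) (y n) p)" for p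
      using \<epsilon>(1) mpos[of p] by (simp add: ln_mult)
    ultimately have "ln (mono2 (x n) (y n) p) \<le> ln (\<epsilon> * mono2 (x n) (y n) q) \<or> ln (mono2 (x n) (y n) q) \<le> ln (\<epsilon> * mono2 (x n) (y n) p)"
      by (simp only:) linarith
    moreover have "\<epsilon> * mono2 (x n) (y n) p > 0" for p using \<epsilon>(1) mpos by simp
    ultimately show ?thesis using mpos by (simp only: ln_le_cancel_iff)
  qed

  have sub: "\<forall>\<^sub>F k in sequentially. Pr (\<sigma> k)" if "\<forall>\<^sub>F n in sequentially. Pr n" for Pr
    using eventually_subseq[OF \<sigma> that] .
  define B' where "B' = max K M"
  obtain E where E: "E > 0" "\<And>n. y n \<le> 1 \<Longrightarrow> R n \<noteq> 0 \<Longrightarrow> 1 \<le> \<bar>R n\<bar> * (E * B ^ (N * t n))"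
    using lower[THEN spec[of _ N], THEN spec[of _ P]] unfolding R_def t_def by blast
  have "\<forall>\<^sub>F n in sequentially. 1 * exp (- c * t n) \<le> 1 / 2" by (rule small) (use c in auto)
  note s1 = sub[OF this]
  have "\<forall>\<^sub>F n in sequentially. H * exp (- 1 * real (t n)) \<le> 1 / 4" by (rule small) (use H in auto)
  note s2 = sub[OF this]
  have "\<forall>\<^sub>F n in sequentially. H * E * exp (- 1 * real (t n)) \<le> 1 / 2" by (rule small) (use H E in auto)
  note s3 = sub[OF this]
  have "\<forall>\<^sub>F k in sequentially. False"
    using agree[of B'] sub[OF \<mu>_small] sub[OF eventually_ge_at_top[of "max n0 n1 + (n2 + s)"]] s1 s2 s3
  proof eventually_elim
    case (elim k)
    define n where "n = \<sigma> k"
    have n: "n \<ge> max n0 n1" "n \<ge> n2 + s" using elim by (auto simp: n_def)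
    have \<mu>: "\<mu> n \<le> 1 / 2" "2 * \<mu> n \<le> exp (- (c / 2) * t n)" "H * exp (- real (t n)) \<le> 1 / 4" "H * E * exp (- real (t n)) \<le> 1 / 2"
      using elim c H E by (auto simp: n_def \<mu>_def)
    have coeff: "coeff2 (f n) i j = cf (i, j)" if "i < B'" "j < B'" for i j
      unfolding f_def cf_def prod.case by (rule coeff2_relation2_cong[OF _ that]) (use elim(1) in \<open>auto simp: n_def\<close>)
    have pow: "(2 * \<mu> n) ^ j \<le> exp (- (c / 2 * j) * t n)" for j :: nat
    proof -
      have "(2 * \<mu> n) ^ j \<le> exp (- (c / 2) * t n) ^ j" using \<mu> by (intro power_mono) (auto simp: \<mu>_def)
      also have "\<dots> = exp (real j * (- (c / 2) * t n))" by (rule exp_of_nat_mult[symmetric])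
      finally show ?thesis by (simp add: mult_ac)
    qed
    have nonzero: "R n \<noteq> 0"
    proof -
      have "(\<Sum>(i, j)\<in>A. of_int (coeff2 (f n) i j) * mono2 (x n) (y n) (i, j)) = (\<Sum>p\<in>A. of_int (cf p) * mono2 (x n) (y n) p)"
        by (rule sum.cong) (auto simp: A_def coeff B'_def)
      moreover have "\<bar>R n - (\<Sum>(i, j)\<in>A. of_int (coeff2 (f n) i j) * mono2 (x n) (y n) (i, j))\<bar> \<le> (2 * \<mu> n) ^ K * H"
        using n \<mu> finA by (intro tail) (auto simp: A_def coeff B'_def)
      moreover have "\<bar>\<Sum>p\<in>A. of_int (cf p) * mono2 (x n) (y n) p\<bar> \<ge> mono2 (x n) (y n) (i0, j0) / 2"
      proof (rule dominant_term_bound[OF finA A0, where \<epsilon> = \<epsilon>])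
        show "mono2 (x n) (y n) p > 0" for p
          using pos(3,4)[of n] by (simp add: mono2_def split: prod.splits)
      qed (use sep[OF n(2)] \<epsilon> in \<open>auto simp: A_def Z_def\<close>)
      moreover have "(2 * \<mu> n) ^ K * H < mono2 (x n) (y n) (i0, j0) / 2"
      proof -
        have "exp (- (2 * rate * D) * real (t n)) = exp (real D * (- 2 * rate * t n))"
          by (simp add: mult_ac)
        also have "\<dots> = exp (- 2 * rate * t n) ^ i0 * exp (- 2 * rate * t n) ^ j0"
          by (simp only: exp_of_nat_mult D_def power_add)
        also have "\<dots> \<le> mono2 (x n) (y n) (i0, j0)"
          unfolding mono2_def using xy_ge[OF n(1)] pos(3,4)[of n] by (auto intro!: mult_mono power_mono)
        finally have low: "exp (- (2 * rate * D) * t n) \<le> mono2 (x n) (y n) (i0, j0)" .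
        have "(2 * \<mu> n) ^ K * H \<le> exp (- (c / 2 * K) * t n) * H"
          using H by (intro mult_right_mono pow) auto
        also have "\<dots> \<le> exp (- (2 * rate * D + 1) * t n) * H"
        proof (rule mult_right_mono)
          have "(2 * rate * D + 1) * t n \<le> (c / 2 * K) * t n" using K by (intro mult_right_mono) auto
          thus "exp (- (c / 2 * K) * t n) \<le> exp (- (2 * rate * D + 1) * t n)"
            by (simp only: exp_le_cancel_iff mult_minus_left neg_le_iff_le)
        qed (use H in auto)
        also have "\<dots> = exp (- (2 * rate * D) * t n) * (H * exp (- real (t n)))"
          by (simp add: algebra_simps flip: exp_add)
        also have "\<dots> \<le> exp (- (2 * rate * D) * t n) * (1 / 4)"
          using \<mu> by (intro mult_left_mono) auto
        also have "\<dots> < exp (- (2 * rate * D) * t n) / 2"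
          using exp_gt_zero[of "- (2 * rate * D) * t n"] by linarith
        finally show ?thesis using low by linarith
      qed
      ultimately show ?thesis by auto
    qed
    have "y n \<le> 1" using n2[of n] n \<epsilon> by auto
    hence "1 \<le> \<bar>R n\<bar> * (E * B ^ (N * t n))" using E nonzero by blast
    \<comment> \<open>The second use of \<open>tail\<close>, now with empty main part: coefficients
      of total degree below \<open>M\<close> lie in the box where the relation vanishes.\<close>
    also have "\<dots> \<le> ((2 * \<mu> n) ^ M * H) * (E * B ^ (N * t n))"
    proof (rule mult_right_mono)
      have "coeff2 (f n) i j = 0" if "i + j < M" for i j
        using that vanish[of i j] coeff[of i j] by (simp add: B'_def cf_def)
      thus "\<bar>R n\<bar> \<le> (2 * \<mu> n) ^ M * H" using tail[OF n(1) \<mu>(1), of "{}" M] by simp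
    qed (use E B in auto)
    also have "\<dots> = (2 * \<mu> n) ^ M * (H * E * B ^ (N * t n))" by (simp only: mult_ac)
    also have "\<dots> \<le> exp (- (c / 2 * M) * t n) * (H * E * B ^ (N * t n))"
      using H E B by (intro mult_right_mono pow) auto
    also have "B ^ (N * t n) = exp (real (N * t n) * ln B)" using B by (simp only: exp_of_nat_mult exp_ln)
    also have "exp (- (c / 2 * M) * t n) * (H * E * exp (real (N * t n) * ln B))
        = H * E * exp (- (c / 2 * M) * t n + real (N * t n) * ln B)"
      by (simp only: exp_add mult_ac)
    also have "\<dots> \<le> H * E * exp (- real (t n))"
    proof -
      have "(ln B + 1) * (N * t n) \<le> (c / 2 * Q) * (N * t n)"
        by (rule mult_right_mono[OF Q']) simp
      also have "\<dots> \<le> (c / 2 * (Q + 1)) * (N * t n)" using c by (intro mult_right_mono) auto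
      also have "\<dots> = (c / 2 * M) * t n" by (simp add: NM algebra_simps)
      finally have "(ln B + 1) * (N * t n) \<le> (c / 2 * M) * t n" .
      moreover have "1 * t n \<le> N * t n" using N1 by (rule mult_right_mono) simp
      hence "real (t n) \<le> real (N * t n)" by (simp only: mult_1 of_nat_le_iff)
      ultimately have "- (c / 2 * M) * t n + real (N * t n) * ln B \<le> - t n" by (simp add: algebra_simps)
      thus ?thesis using H E by simp
    qed
    also have "\<dots> \<le> 1 / 2" by (rule \<mu>)
    finally show False by simp
  qed
  thus False by simp
qed

end

section \<open>Symbolic dynamics of the interval map\<close>

locale contracted_map =
  fixes lam \<mu> \<delta> :: real
  assumes lam: "0 < lam" "lam < 1" and \<mu>: "\<mu> > 0" and \<delta>: "1 - lam < \<delta>" "\<delta> < d_bound lam \<mu>"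
    and irrational: "rotation_number lam \<mu> \<delta> \<notin> \<rat>"
begin

section \<open>Coding of the orbit of 0\<close>

abbreviation F :: "real \<Rightarrow> real" where "F \<equiv> pw_lift lam \<mu> \<delta>"
abbreviation \<rho> :: real where "\<rho> \<equiv> rotation_number lam \<mu> \<delta>"

lemma of_nat_mult_neq: "n > 0 \<Longrightarrow> real n * \<rho> \<noteq> of_int k"
proof
  assume "n > 0" "real n * \<rho> = of_int k"
  hence "\<rho> = of_int k / of_nat n" by (simp add: field_simps)
  thus False using irrational by auto
qed

lemma funpow_add_int: "(F ^^ n) (x + of_int k) = (F ^^ n) x + of_int k"
proof (induction n)
  case (Suc n)
  have "F (z + of_int k) = F z + of_int k" for z by (simp add: pw_lift_eq frac_def)
  thus ?case using Suc by simp
qed simp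

text \<open>Monotonicity and integer translations keep the (k n)-th iterate between k m and k (m +
  1), where m is the floor of the n-th. In the limit n \<rho> lies in [m, m + 1], and irrationality
  excludes the upper end.\<close>

lemma floor_orbit: "\<lfloor>(F ^^ n) 0\<rfloor> = \<lfloor>real n * \<rho>\<rfloor>"
proof (cases "n = 0")
  case False
  have mono: "mono (F ^^ n)" using mono_pw_lift[OF lam \<mu> \<delta>] by (rule mono_pow)
  have mult: "(F ^^ (Suc k * n)) 0 = (F ^^ n) ((F ^^ (k * n)) 0)" for k by (simp add: funpow_add)
  have lim: "(\<lambda>k. (F ^^ (k * n)) 0 / real (k * n)) \<longlonglongrightarrow> \<rho>"
    using LIMSEQ_subseq_LIMSEQ[OF rotation_number_limit[OF lam \<mu> \<delta>, of 0], of "\<lambda>k. k * n"] False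
    by (simp add: strict_mono_def o_def)
  define m where "m = \<lfloor>(F ^^ n) 0\<rfloor>"
  have lower: "real k * of_int m \<le> (F ^^ (k * n)) 0" for k
  proof (induction k)
    case (Suc k)
    have "real (Suc k) * of_int m = of_int m + of_int (int k * m)" by (simp add: algebra_simps)
    also have "\<dots> \<le> (F ^^ n) 0 + of_int (int k * m)" by (simp add: m_def)
    also have "\<dots> = (F ^^ n) (of_int (int k * m))" using funpow_add_int[of n 0 "int k * m"] by simp
    also have "\<dots> \<le> (F ^^ n) ((F ^^ (k * n)) 0)" using Suc by (intro monoD[OF mono]) simp
    finally show ?case by (simp only: mult)
  qed simp
  have upper: "(F ^^ (k * n)) 0 \<le> real k * of_int (m + 1)" for k
  proof (induction k)
    case (Suc k)
    have "(F ^^ (Suc k * n)) 0 \<le> (F ^^ n) (of_int (int k * (m + 1)))"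
      unfolding mult using Suc by (intro monoD[OF mono]) simp
    also have "\<dots> = (F ^^ n) 0 + of_int (int k * (m + 1))" using funpow_add_int[of n 0 "int k * (m + 1)"] by simp
    also have "\<dots> \<le> of_int (m + 1) + of_int (int k * (m + 1))" unfolding m_def by simp
    finally show ?case by (simp add: algebra_simps)
  qed simp
  have "of_int m / real n \<le> \<rho>"
  proof (rule LIMSEQ_le_const[OF lim], intro exI[of _ 1] allI impI)
    fix k :: nat assume "1 \<le> k"
    thus "of_int m / real n \<le> (F ^^ (k * n)) 0 / real (k * n)"
      using lower[of k] False by (simp add: field_simps)
  qed
  moreover have "\<rho> \<le> of_int (m + 1) / real n"
  proof (rule LIMSEQ_le_const2[OF lim], intro exI[of _ 1] allI impI)
    fix k :: nat assume "1 \<le> k"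
    thus "(F ^^ (k * n)) 0 / real (k * n) \<le> of_int (m + 1) / real n"
      using upper[of k] False by (simp add: field_simps)
  qed
  ultimately have "of_int m \<le> real n * \<rho>" "real n * \<rho> \<le> of_int (m + 1)"
    using False by (simp_all add: field_simps)
  thus ?thesis using of_nat_mult_neq[of n "m + 1"] False unfolding m_def[symmetric] by linarith
qed simp

definition orb :: "nat \<Rightarrow> real" where "orb n = frac ((F ^^ n) 0)"

text \<open>The Sturmian word of slope \<rho>.\<close>

definition symbol :: "nat \<Rightarrow> int" where "symbol n = \<lfloor>real (Suc n) * \<rho>\<rfloor> - \<lfloor>real n * \<rho>\<rfloor>"

lemma orb_range: "0 \<le> orb n" "orb n < 1"
  by (auto simp: orb_def frac_lt_1)

text \<open>The lift raises the integer part exactly on the second branch, so the increments in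
  \<open>floor_orbit\<close> record the branch.\<close>

lemma symbol_eq: "symbol n = (if orb n < eta lam \<delta> then 0 else 1)"
proof -
  let ?z = "(F ^^ n) 0"
  have m: "pw_map lam \<mu> \<delta> (frac ?z) \<in> {0..<1}"
    by (rule pw_map_in_unit[OF lam \<mu> \<delta>]) (simp add: frac_lt_1)
  have "F ?z = of_int (\<lfloor>?z\<rfloor> + (if frac ?z < eta lam \<delta> then 0 else 1)) + pw_map lam \<mu> \<delta> (frac ?z)"
    by (simp add: pw_lift_eq pw_map_def)
  hence "\<lfloor>F ?z\<rfloor> = \<lfloor>?z\<rfloor> + (if frac ?z < eta lam \<delta> then 0 else 1)"
    using m by (intro floor_unique) auto
  thus ?thesis using floor_orbit[of n] floor_orbit[of "Suc n"] by (simp add: symbol_def orb_def)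
qed

lemma symbol_01: "symbol n = 0 \<or> symbol n = 1" by (simp add: symbol_eq)

definition shift :: "nat \<Rightarrow> real" where "shift n = (if symbol n = 0 then \<delta> else \<mu> * (\<delta> - 1))"

lemma orb_Suc: "orb (Suc n) = lam * \<mu> ^ nat (symbol n) * orb n + shift n"
  using frac_pw_lift[OF lam \<mu> \<delta>, of "(F ^^ n) 0"]
  by (simp add: orb_def pw_map_def symbol_eq shift_def algebra_simps)

lemma orb_ge: "symbol n = 1 \<Longrightarrow> 1 - \<delta> \<le> lam * orb n" and orb_less: "symbol n = 0 \<Longrightarrow> lam * orb n < 1 - \<delta>"
  using less_eta_iff[OF lam \<mu> \<delta>, of "orb n"] by (auto simp: symbol_eq split: if_splits)

lemma floor_\<rho>: "\<lfloor>\<rho>\<rfloor> = 0"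
proof -
  have "\<lfloor>\<rho>\<rfloor> = \<lfloor>F 0\<rfloor>" using floor_orbit[of 1] by simp
  also have "F 0 = \<delta>" using eta_bounds[OF lam \<mu> \<delta>] by (simp add: pw_lift_def)
  also have "\<lfloor>\<delta>\<rfloor> = 0" using delta_less_1[OF lam \<mu> \<delta>] lam \<delta> by (simp add: floor_eq_iff)
  finally show ?thesis .
qed

lemma \<rho>_bounds: "0 < \<rho>" "\<rho> < 1"
proof -
  have "0 \<le> \<rho>" "\<rho> < 1" using floor_\<rho> by linarith+
  moreover have "\<rho> \<noteq> 0" using irrational by auto
  ultimately show "0 < \<rho>" "\<rho> < 1" by auto
qed

definition fl :: "nat \<Rightarrow> nat" where "fl n = nat \<lfloor>real n * \<rho>\<rfloor>"

lemma int_fl: "int (fl n) = \<lfloor>real n * \<rho>\<rfloor>"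
  using \<rho>_bounds by (simp add: fl_def)

lemma fl_bounds: "real (fl n) \<le> real n * \<rho>" "real n * \<rho> < real (fl n) + 1"
proof -
  have "real (fl n) = of_int \<lfloor>real n * \<rho>\<rfloor>" using int_fl[of n] by (metis of_int_of_nat_eq)
  thus "real (fl n) \<le> real n * \<rho>" "real n * \<rho> < real (fl n) + 1" by linarith+
qed

lemma fl_eqI: "real k \<le> real n * \<rho> \<Longrightarrow> real n * \<rho> < real k + 1 \<Longrightarrow> fl n = k"
  using floor_unique[of "int k" "real n * \<rho>"] int_fl[of n] by simp

lemma fl_le: "fl n \<le> n"
proof -
  have "real n * \<rho> \<le> real n * 1" using \<rho>_bounds by (intro mult_left_mono) auto
  thus ?thesis using fl_bounds[of n] by simp
qed

lemma fl_0: "fl 0 = 0" by (simp add: fl_def)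

lemma fl_Suc: "fl (Suc n) = fl n + nat (symbol n)"
  using int_fl[of n] int_fl[of "Suc n"] symbol_01[of n] by (auto simp: symbol_def)

text \<open>The product of the slopes of the first n branches visited by the orbit of 0.\<close>

definition w :: "nat \<Rightarrow> real" where "w n = lam ^ n * \<mu> ^ fl n"

lemma w_0: "w 0 = 1" by (simp add: w_def fl_0)

lemma w_pos: "w n > 0" using lam \<mu> by (simp add: w_def)

lemma w_Suc: "w (Suc n) = lam * \<mu> ^ nat (symbol n) * w n"
  by (simp add: w_def fl_Suc power_add)

section \<open>Contraction on average along the orbit\<close>

lemma gap_pos: "\<delta> - \<mu> * (lam + \<delta> - 1) > 0"
  using jump_pos[OF lam \<mu> \<delta>] by simp

text \<open>The geometric mean of the slopes along the orbit; \<open>w n\<close> differs from its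
  n-th power by a bounded factor.\<close>

definition ratio :: real where "ratio = lam * \<mu> powr \<rho>"

lemma ratio_pos: "ratio > 0" using lam \<mu> by (simp add: ratio_def)

lemma w_eq: "w n = ratio ^ n * \<mu> powr (real (fl n) - real n * \<rho>)"
proof -
  have "ratio ^ n = lam ^ n * \<mu> powr (real n * \<rho>)"
    using \<mu> by (simp add: ratio_def power_mult_distrib powr_power mult.commute)
  moreover have "\<mu> ^ fl n = \<mu> powr (real n * \<rho>) * \<mu> powr (real (fl n) - real n * \<rho>)"
    using \<mu> by (simp add: powr_realpow flip: powr_add)
  ultimately show ?thesis by (simp add: w_def)
qed

text \<open>If \<open>ratio \<ge> 1\<close>, then \<open>lam * \<mu> > 1\<close> and the second branch has a fixed point \<open>e\<close>. The distance of the orbit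
  to \<open>e\<close> is multiplied by \<open>lam * \<mu>\<close> on the second branch; on the first branch it is
  multiplied by \<open>lam\<close> and increased by a fixed amount, so it would be unbounded.\<close>

lemma ratio_less_1: "ratio < 1"
proof (rule ccontr)
  assume "\<not> ratio < 1"
  hence r1: "ratio \<ge> 1" by simp
  have \<mu>1: "\<mu> > 1"
  proof (rule ccontr)
    assume "\<not> \<mu> > 1"
    hence "\<mu> powr \<rho> \<le> 1" using \<mu> \<rho>_bounds by (intro powr_le1) auto
    hence "lam * \<mu> powr \<rho> \<le> lam * 1" using lam by (intro mult_left_mono) auto
    thus False using r1 lam unfolding ratio_def by linarith
  qed
  have "\<mu> powr \<rho> < \<mu> powr 1" using \<mu>1 \<rho>_bounds by (intro powr_less_mono) auto
  hence "lam * \<mu> powr \<rho> < lam * \<mu>" using lam \<mu> by simp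
  hence lm: "lam * \<mu> > 1" using r1 by (simp add: ratio_def)
  define e where "e = \<mu> * (1 - \<delta>) / (lam * \<mu> - 1)"
  define \<kappa> where "\<kappa> = (\<delta> - \<mu> * (lam + \<delta> - 1)) / (lam * \<mu> - 1)"
  have \<kappa>: "\<kappa> > 0" using gap_pos lm by (simp add: \<kappa>_def)
  have e: "e * (lam * \<mu> - 1) = \<mu> * (1 - \<delta>)" "\<kappa> * (lam * \<mu> - 1) = \<delta> - \<mu> * (lam + \<delta> - 1)"
    using lm by (simp_all add: e_def \<kappa>_def)
  have e0: "e > 0" using lm \<mu> delta_less_1[OF lam \<mu> \<delta>] by (simp add: e_def)
  have "(e * (1 - lam) - \<delta>) * (lam * \<mu> - 1) = \<kappa> * (lam * \<mu> - 1)"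
  proof -
    have "(e * (1 - lam) - \<delta>) * (lam * \<mu> - 1) = (e * (lam * \<mu> - 1)) * (1 - lam) - \<delta> * (lam * \<mu> - 1)"
      by (simp add: algebra_simps)
    thus ?thesis unfolding e by (simp add: algebra_simps)
  qed
  hence \<kappa>_eq: "\<kappa> = e * (1 - lam) - \<delta>" using lm by simp
  have e_eq: "e = lam * \<mu> * e - \<mu> * (1 - \<delta>)" using e(1) by (simp add: algebra_simps)
  have step: "e - orb (Suc n) = lam * \<mu> ^ nat (symbol n) * (e - orb n) + \<kappa> * (1 - of_int (symbol n))" for n
  proof (cases "symbol n = 0")
    case True
    thus ?thesis unfolding orb_Suc shift_def \<kappa>_eq by (simp add: algebra_simps)
  next
    case False
    hence "symbol n = 1" using symbol_01[of n] by simp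
    thus ?thesis unfolding orb_Suc shift_def using e_eq by (simp add: algebra_simps)
  qed
  have formula: "e - orb n = w n * (e + \<kappa> * (\<Sum>k<n. (1 - of_int (symbol k)) / w (Suc k)))" for n
  proof (induction n)
    case 0
    show ?case by (simp add: orb_def w_0)
  next
    case (Suc n)
    have "lam * \<mu> ^ nat (symbol n) * (w n * (e + \<kappa> * (\<Sum>k<n. (1 - of_int (symbol k)) / w (Suc k)))) + \<kappa> * (1 - of_int (symbol n))
      = w (Suc n) * (e + \<kappa> * (\<Sum>k<n. (1 - of_int (symbol k)) / w (Suc k))) + \<kappa> * (1 - of_int (symbol n))"
      by (simp add: w_Suc)
    also have "\<dots> = w (Suc n) * (e + \<kappa> * (\<Sum>k<Suc n. (1 - of_int (symbol k)) / w (Suc k)))"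
      using w_pos[of "Suc n"] by (simp add: distrib_left)
    finally show ?case unfolding step Suc .
  qed
  \<comment> \<open>The exponent of \<mu> deviates from its mean by more than -1 over any window, so
    with \<open>ratio \<ge> 1\<close> the product of slopes is at least 1/\<mu>.\<close>
  have ratio_w: "w n / w k \<ge> 1 / \<mu>" if "k \<le> n" for k n
  proof -
    have "1 / \<mu> = \<mu> powr (-1)" using \<mu> by (simp add: powr_minus divide_inverse)
    also have "\<dots> \<le> \<mu> powr ((real (fl n) - real n * \<rho>) - (real (fl k) - real k * \<rho>))"
      using \<mu>1 fl_bounds[of n] fl_bounds[of k] by (intro powr_mono) auto
    also have "\<dots> = 1 * \<dots>" by simp
    also have "\<dots> \<le> ratio ^ (n - k) * \<mu> powr ((real (fl n) - real n * \<rho>) - (real (fl k) - real k * \<rho>))"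
      using r1 by (intro mult_right_mono one_le_power) auto
    also have "\<dots> = w n / w k"
      using ratio_pos that by (simp add: w_eq powr_diff power_diff mult_ac)
    finally show ?thesis .
  qed
  have count: "(\<Sum>k<n. 1 - of_int (symbol k)) = real n - real (fl n)" for n
  proof (induction n)
    case (Suc n)
    thus ?case using symbol_01[of n] by (auto simp: fl_Suc)
  qed (simp add: fl_0)
  \<comment> \<open>Each visit to the first branch pushes the orbit a further \<kappa> away from
    \<open>e\<close>, and at least a fraction 1/\<mu> of this survives until time n. There are at
    least n (1 - \<rho>) visits, but the distance never exceeds \<open>e\<close>.\<close>
  have bound: "\<kappa> / \<mu> * (real n * (1 - \<rho>)) \<le> e" for n
  proof -
    have "\<kappa> / \<mu> * (real n * (1 - \<rho>)) \<le> \<kappa> / \<mu> * (\<Sum>k<n. 1 - of_int (symbol k))"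
      unfolding count using \<kappa> \<mu> fl_bounds[of n] by (intro mult_left_mono) (auto simp: algebra_simps)
    also have "\<dots> = \<kappa> * (\<Sum>k<n. (1 - of_int (symbol k)) * (1 / \<mu>))"
      by (simp add: sum_distrib_left sum_distrib_right mult_ac)
    also have "\<dots> \<le> \<kappa> * (\<Sum>k<n. (1 - of_int (symbol k)) * (w n / w (Suc k)))"
    proof (intro mult_left_mono sum_mono)
      fix k assume "k \<in> {..<n}"
      thus "1 / \<mu> \<le> w n / w (Suc k)" by (intro ratio_w) auto
      show "0 \<le> 1 - real_of_int (symbol k)" using symbol_01[of k] by auto
    qed (use \<kappa> in auto)
    also have "\<dots> = w n * (\<kappa> * (\<Sum>k<n. (1 - of_int (symbol k)) / w (Suc k)))"
      by (simp add: sum_distrib_left mult_ac)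
    also have "\<dots> \<le> w n * (e + \<kappa> * (\<Sum>k<n. (1 - of_int (symbol k)) / w (Suc k)))"
      using e0 w_pos[of n] by simp
    also have "\<dots> \<le> e" using formula[of n] orb_range[of n] by linarith
    finally show ?thesis .
  qed
  obtain n :: nat where "e < real n * (\<kappa> / \<mu> * (1 - \<rho>))"
    using reals_Archimedean3[of "\<kappa> / \<mu> * (1 - \<rho>)"] \<kappa> \<mu> \<rho>_bounds by auto
  thus False using bound[of n] by (simp add: mult_ac)
qed

lemma summable_w: "summable w"
proof (rule summable_comparison_test)
  show "\<exists>N. \<forall>n\<ge>N. norm (w n) \<le> (1 + 1 / \<mu>) * ratio ^ n"
  proof (intro exI[of _ 0] allI impI)
    fix n
    define z where "z = real n * \<rho> - real (fl n)"
    have z: "0 \<le> z" "z < 1" using fl_bounds[of n] by (auto simp: z_def)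
    have "\<mu> powr (- z) \<le> 1 + 1 / \<mu>"
    proof (cases "\<mu> \<ge> 1")
      case True
      have "\<mu> powr (- z) \<le> \<mu> powr 0" using True z by (intro powr_mono) auto
      also have "\<dots> = 1" using \<mu> by simp
      finally show ?thesis using \<mu> by (simp add: add_increasing2)
    next
      case False
      hence "\<mu> powr (- z) \<le> \<mu> powr (- 1)" using z \<mu> by (intro powr_mono') auto
      also have "\<dots> = 1 / \<mu>" using \<mu> by (simp add: powr_minus divide_inverse)
      finally show ?thesis by simp
    qed
    hence "ratio ^ n * \<mu> powr (- z) \<le> ratio ^ n * (1 + 1 / \<mu>)"
      using ratio_pos by (intro mult_left_mono) auto
    thus "norm (w n) \<le> (1 + 1 / \<mu>) * ratio ^ n"
      using w_pos[of n] by (simp add: w_eq z_def mult.commute)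
  qed
  show "summable (\<lambda>n. (1 + 1 / \<mu>) * ratio ^ n)"
    using ratio_pos ratio_less_1 by (intro summable_mult summable_geometric) auto
qed

text \<open>By hypothesis the letters before time N, read backwards, are \<open>symbol 1\<close>,
  \<open>symbol 2\<close>, ..., so unrolling the affine branches produces the weights
  \<open>w k\<close>. The left side extends the first branch, which takes the value 1 at the
  discontinuity, to either side of it.\<close>

lemma backward:
  assumes "\<And>k. k \<le> K \<Longrightarrow> \<lfloor>real (N - k) * \<rho>\<rfloor> = \<lfloor>real N * \<rho>\<rfloor> - \<lfloor>real (Suc k) * \<rho>\<rfloor>" "K \<le> N"
  shows "lam * orb N + \<delta> = (\<Sum>k\<le>K. w k * shift k) + w (Suc K) * orb (N - K)"
  using assms
proof (induction K)
  case 0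
  have "symbol 0 = 0" using floor_\<rho> by (simp add: symbol_def)
  thus ?case by (simp add: w_Suc w_0 shift_def)
next
  case (Suc K)
  have IH: "lam * orb N + \<delta> = (\<Sum>k\<le>K. w k * shift k) + w (Suc K) * orb (N - K)"
    using Suc by auto
  have NK: "N - K = Suc (N - Suc K)" using Suc.prems by auto
  have "\<lfloor>real (N - Suc K) * \<rho>\<rfloor> = \<lfloor>real N * \<rho>\<rfloor> - \<lfloor>real (Suc (Suc K)) * \<rho>\<rfloor>"
    "\<lfloor>real (N - K) * \<rho>\<rfloor> = \<lfloor>real N * \<rho>\<rfloor> - \<lfloor>real (Suc K) * \<rho>\<rfloor>"
    using Suc.prems(1)[of "Suc K"] Suc.prems(1)[of K] by (simp_all only: le_refl le_SucI)
  hence symbol: "symbol (N - Suc K) = symbol (Suc K)" unfolding symbol_def NK[symmetric] by simp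
  hence "orb (N - K) = lam * \<mu> ^ nat (symbol (Suc K)) * orb (N - Suc K) + shift (Suc K)"
    unfolding NK orb_Suc by (simp add: shift_def)
  hence "w (Suc K) * orb (N - K) = w (Suc K) * shift (Suc K) + w (Suc (Suc K)) * orb (N - Suc K)"
    by (simp add: w_Suc[of "Suc K"] algebra_simps)
  thus ?case using IH by simp
qed

text \<open>The fractional parts of \<open>N * \<rho>\<close> just above and just below \<open>1 - \<rho>\<close> correspond to points of the orbit
  just above and just below the discontinuity; both have the same backward itinerary of length \<open>K\<close>.\<close>

lemma backward_itinerary:
  assumes "i \<in> {0, 1}"
  obtains N where "K \<le> N" "symbol N = i"
    "\<And>k. k \<le> K \<Longrightarrow> \<lfloor>real (N - k) * \<rho>\<rfloor> = \<lfloor>real N * \<rho>\<rfloor> - \<lfloor>real (Suc k) * \<rho>\<rfloor>"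
proof -
  define D where "D = (\<lambda>k. min (frac (real (Suc k) * \<rho>)) (1 - frac (real (Suc k) * \<rho>))) ` {..K}"
  \<comment> \<open>The least distance of \<rho>, ..., (K + 1) \<rho> from an integer; smaller
    perturbations leave the floors in question unchanged.\<close>
  define \<epsilon> where "\<epsilon> = Min D"
  have frac_pos: "frac (real (Suc k) * \<rho>) > 0" for k
    using of_nat_mult_neq[of "Suc k"] by (simp add: Ints_def) blast
  have "\<epsilon> \<in> D" unfolding \<epsilon>_def by (intro Min_in) (auto simp: D_def)
  hence \<epsilon>0: "\<epsilon> > 0" using frac_pos by (auto simp: D_def frac_lt_1)
  have \<epsilon>: "\<epsilon> \<le> frac (real (Suc k) * \<rho>)" "\<epsilon> \<le> 1 - frac (real (Suc k) * \<rho>)" if "k \<le> K" for k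
  proof -
    have "\<epsilon> \<le> min (frac (real (Suc k) * \<rho>)) (1 - frac (real (Suc k) * \<rho>))"
      unfolding \<epsilon>_def using that by (intro Min_le) (auto simp: D_def)
    thus "\<epsilon> \<le> frac (real (Suc k) * \<rho>)" "\<epsilon> \<le> 1 - frac (real (Suc k) * \<rho>)" by auto
  qed
  have "frac \<rho> = \<rho>" using \<rho>_bounds by (simp add: frac_eq)
  hence \<epsilon>\<rho>: "\<epsilon> \<le> \<rho>" "\<epsilon> \<le> 1 - \<rho>" using \<epsilon>[of 0] by auto
  \<comment> \<open>The symbol at N is 1 exactly when the fractional part of N \<rho> is at least 1
    - \<rho>; the target lies on the side prescribed by \<open>i\<close>.\<close>
  define target where "target = 1 - \<rho> + (if i = 1 then \<epsilon> / 2 else - (\<epsilon> / 2))"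
  have "0 \<le> target" "target \<le> 1" using \<epsilon>\<rho> \<epsilon>0 by (auto simp: target_def)
  then obtain N where N: "\<bar>frac (real N * \<rho>) - target\<bar> < \<epsilon> / 2"
    using Kronecker_approx_1_explicit[OF irrational, of target "\<epsilon> / 2"] \<epsilon>0 by (metis half_gt_zero)
  define e where "e = frac (real N * \<rho>) - (1 - \<rho>)"
  have e: "\<bar>e\<bar> < \<epsilon>" "i = 1 \<Longrightarrow> e > 0" "i = 0 \<Longrightarrow> e < 0"
  proof -
    consider "i = 1" | "i = 0" using assms by auto
    hence "\<bar>e\<bar> < \<epsilon> \<and> (i = 1 \<longrightarrow> e > 0) \<and> (i = 0 \<longrightarrow> e < 0)"
    proof cases
      case 1
      hence "target = 1 - \<rho> + \<epsilon> / 2" by (simp add: target_def)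
      thus ?thesis using N 1 unfolding e_def by (intro conjI impI) linarith+
    next
      case 2
      hence "target = 1 - \<rho> - \<epsilon> / 2" by (simp add: target_def)
      thus ?thesis using N 2 unfolding e_def by (intro conjI impI) linarith+
    qed
    thus "\<bar>e\<bar> < \<epsilon>" "i = 1 \<Longrightarrow> e > 0" "i = 0 \<Longrightarrow> e < 0" by auto
  qed
  have N_eq: "real N * \<rho> = of_int \<lfloor>real N * \<rho>\<rfloor> + (1 - \<rho>) + e" by (simp add: e_def frac_def)
  \<comment> \<open>For N up to \<open>K\<close>, the number (N + 1) \<rho> would lie within |e| <
    \<epsilon> of an integer, against the choice of \<epsilon>.\<close>
  have KN: "K < N"
  proof (rule ccontr)
    assume "\<not> K < N"
    hence *: "\<epsilon> \<le> frac (real (Suc N) * \<rho>)" "\<epsilon> \<le> 1 - frac (real (Suc N) * \<rho>)" using \<epsilon>[of N] by auto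
    have "real (Suc N) * \<rho> = of_int (\<lfloor>real N * \<rho>\<rfloor> + 1) + e" using N_eq by (simp add: algebra_simps)
    hence "frac (real (Suc N) * \<rho>) = frac e" by (simp add: frac_def)
    moreover have "frac e = (if e \<ge> 0 then e else e + 1)"
      using e(1) \<epsilon>\<rho> \<rho>_bounds by (auto simp: frac_unique_iff)
    ultimately show False using * e(1) by (auto split: if_splits)
  qed
  show ?thesis
  proof (rule that[of N])
    show "K \<le> N" using KN by simp
    have "real (Suc N) * \<rho> = of_int (\<lfloor>real N * \<rho>\<rfloor>) + 1 + e" using N_eq by (simp add: algebra_simps)
    hence "\<lfloor>real (Suc N) * \<rho>\<rfloor> = \<lfloor>real N * \<rho>\<rfloor> + i"
      using assms e \<epsilon>\<rho> \<rho>_bounds by (intro floor_unique) (auto simp: abs_less_iff)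
    thus "symbol N = i" by (simp add: symbol_def)
  next
    fix k assume k: "k \<le> K"
    define \<theta> where "\<theta> = real (Suc k) * \<rho>"
    have "real (N - k) * \<rho> = of_int (\<lfloor>real N * \<rho>\<rfloor> - \<lfloor>\<theta>\<rfloor>) + (1 - frac \<theta> + e)"
      using N_eq k KN by (simp add: of_nat_diff \<theta>_def frac_def algebra_simps)
    moreover have "0 \<le> 1 - frac \<theta> + e" "1 - frac \<theta> + e < 1"
      using \<epsilon>[OF k] e(1) unfolding \<theta>_def by auto
    ultimately show "\<lfloor>real (N - k) * \<rho>\<rfloor> = \<lfloor>real N * \<rho>\<rfloor> - \<lfloor>real (Suc k) * \<rho>\<rfloor>"
      unfolding \<theta>_def[symmetric] by (intro floor_unique) auto
  qed
qed

text \<open>Orbit points to the right of the discontinuity give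
  \<open>lam * orb N + \<delta> \<ge> 1\<close>, those to the left give less than 1. As the
  remainder lies between 0 and \<open>w (Suc K)\<close>, the partial sums are squeezed to 1.\<close>

lemma shift_sums: "(\<lambda>k. w k * shift k) sums 1"
proof -
  have bounds: "1 - w (Suc K) \<le> (\<Sum>k\<le>K. w k * shift k) \<and> (\<Sum>k\<le>K. w k * shift k) \<le> 1" for K
  proof
    obtain N where N: "K \<le> N" "symbol N = 1"
      "\<And>k. k \<le> K \<Longrightarrow> \<lfloor>real (N - k) * \<rho>\<rfloor> = \<lfloor>real N * \<rho>\<rfloor> - \<lfloor>real (Suc k) * \<rho>\<rfloor>"
      by (rule backward_itinerary[of 1 K]) (simp, rule that)
    have "w (Suc K) * orb (N - K) \<le> w (Suc K) * 1"
      using w_pos[of "Suc K"] orb_range[of "N - K"] by (intro mult_left_mono) auto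
    thus "1 - w (Suc K) \<le> (\<Sum>k\<le>K. w k * shift k)"
      using backward[OF N(3,1)] orb_ge[OF N(2)] by linarith
  next
    obtain N where N: "K \<le> N" "symbol N = 0"
      "\<And>k. k \<le> K \<Longrightarrow> \<lfloor>real (N - k) * \<rho>\<rfloor> = \<lfloor>real N * \<rho>\<rfloor> - \<lfloor>real (Suc k) * \<rho>\<rfloor>"
      by (rule backward_itinerary[of 0 K]) (simp, rule that)
    have "0 \<le> w (Suc K) * orb (N - K)" using w_pos[of "Suc K"] orb_range[of "N - K"] by simp
    thus "(\<Sum>k\<le>K. w k * shift k) \<le> 1"
      using backward[OF N(3,1)] orb_less[OF N(2)] by linarith
  qed
  have lim: "(\<lambda>K. 1 - w (Suc K)) \<longlonglongrightarrow> 1 - 0"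
    by (intro tendsto_intros LIMSEQ_Suc summable_LIMSEQ_zero summable_w)
  have "(\<lambda>K. \<Sum>k\<le>K. w k * shift k) \<longlonglongrightarrow> 1"
  proof (rule tendsto_sandwich)
    show "(\<lambda>K. 1 - w (Suc K)) \<longlonglongrightarrow> 1" using lim by simp
    show "(\<lambda>_. 1) \<longlonglongrightarrow> (1 :: real)" by simp
  qed (use bounds in auto)
  thus ?thesis by (simp add: sums_def_le)
qed

section \<open>Linear relations between the two step sums\<close>

lemma step_sums: "(\<lambda>k. w k * (1 - lam * \<mu> ^ nat (symbol k))) sums 1"
proof -
  have "(\<lambda>k. w k - w (Suc k)) sums (w 0 - 0)"
    by (intro telescope_sums' summable_LIMSEQ_zero summable_w)
  thus ?thesis by (simp add: w_0 w_Suc algebra_simps)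
qed

text \<open>The lattice point reached after k letters, whose monomial at (lam, lam \<mu>) is
  \<open>w k\<close>.\<close>

definition place :: "nat \<Rightarrow> nat \<times> nat" where "place k = (k - fl k, fl k)"

lemma bij_steps_x: "bij_betw place {k. symbol k = 0} (steps_x (1 - \<rho>) \<rho>)"
proof (rule bij_betwI[where g = "\<lambda>(i, j). i + j"])
  show "place \<in> {k. symbol k = 0} \<rightarrow> steps_x (1 - \<rho>) \<rho>"
  proof (intro Pi_I, simp)
    fix k assume "symbol k = 0"
    hence "fl (Suc k) = fl k" by (simp add: fl_Suc)
    thus "place k \<in> steps_x (1 - \<rho>) \<rho>"
      using fl_bounds[of k] fl_bounds[of "Suc k"] fl_le[of k]
      by (simp add: steps_x_def place_def of_nat_diff algebra_simps)
  qed
  have inv: "fl (i + j) = j \<and> symbol (i + j) = 0" if "(i, j) \<in> steps_x (1 - \<rho>) \<rho>" for i j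
  proof -
    have "real j \<le> real (i + j) * \<rho>" "real (Suc (i + j)) * \<rho> < real j + 1"
      using that by (auto simp: steps_x_def algebra_simps)
    hence "fl (i + j) = j" "fl (Suc (i + j)) = j"
      using \<rho>_bounds by (auto intro!: fl_eqI simp: algebra_simps)
    thus ?thesis using fl_Suc[of "i + j"] symbol_01[of "i + j"] by auto
  qed
  show "(\<lambda>(i, j). i + j) \<in> steps_x (1 - \<rho>) \<rho> \<rightarrow> {k. symbol k = 0}" using inv by auto
  show "place ((\<lambda>(i, j). i + j) p) = p" if "p \<in> steps_x (1 - \<rho>) \<rho>" for p
    using that inv by (cases p) (auto simp: place_def)
qed (use fl_le in \<open>auto simp: place_def\<close>)

lemma bij_steps_y: "bij_betw place {k. symbol k = 1} (steps_y (1 - \<rho>) \<rho>)"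
proof (rule bij_betwI[where g = "\<lambda>(i, j). i + j"])
  show "place \<in> {k. symbol k = 1} \<rightarrow> steps_y (1 - \<rho>) \<rho>"
  proof (intro Pi_I, simp)
    fix k assume "symbol k = 1"
    hence "fl (Suc k) = fl k + 1" by (simp add: fl_Suc)
    thus "place k \<in> steps_y (1 - \<rho>) \<rho>"
      using fl_bounds[of k] fl_bounds[of "Suc k"] fl_le[of k]
      by (simp add: steps_y_def place_def of_nat_diff algebra_simps)
  qed
  have inv: "fl (i + j) = j \<and> symbol (i + j) = 1" if ij: "(i, j) \<in> steps_y (1 - \<rho>) \<rho>" for i j
  proof -
    have *: "real (i + j) * \<rho> < real j + 1" "real (Suc j) \<le> real (Suc (i + j)) * \<rho>"
      using ij by (auto simp: steps_y_def algebra_simps)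
    hence "fl (i + j) = j" "fl (Suc (i + j)) = Suc j"
      using \<rho>_bounds by (auto intro!: fl_eqI simp: algebra_simps)
    thus ?thesis using fl_Suc[of "i + j"] symbol_01[of "i + j"] by auto
  qed
  show "(\<lambda>(i, j). i + j) \<in> steps_y (1 - \<rho>) \<rho> \<rightarrow> {k. symbol k = 1}" using inv by auto
  show "place ((\<lambda>(i, j). i + j) p) = p" if "p \<in> steps_y (1 - \<rho>) \<rho>" for p
    using that inv by (cases p) (auto simp: place_def)
qed (use fl_le in \<open>auto simp: place_def\<close>)

lemma mono2_place: "mono2 lam (lam * \<mu>) (place k) = w k"
  using fl_le[of k] by (simp add: mono2_def place_def w_def power_mult_distrib mult.assoc[symmetric] flip: power_add)

lemma summable_on_w: "w summable_on A"
proof -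
  have "w summable_on UNIV"
    using summable_w w_pos by (intro norm_summable_imp_summable_on) (simp add: less_imp_le)
  thus ?thesis by (rule summable_on_subset_banach) simp
qed

lemma sum_xy_w:
  "mono2 lam (lam * \<mu>) summable_on steps_x (1 - \<rho>) \<rho>" "mono2 lam (lam * \<mu>) summable_on steps_y (1 - \<rho>) \<rho>"
  "sum_x (1 - \<rho>) \<rho> lam (lam * \<mu>) = infsum w {k. symbol k = 0}"
  "sum_y (1 - \<rho>) \<rho> lam (lam * \<mu>) = infsum w {k. symbol k = 1}"
  using summable_on_reindex_bij_betw[OF bij_steps_x, of "mono2 lam (lam * \<mu>)"]
    summable_on_reindex_bij_betw[OF bij_steps_y, of "mono2 lam (lam * \<mu>)"]
    infsum_reindex_bij_betw[OF bij_steps_x, of "mono2 lam (lam * \<mu>)"]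
    infsum_reindex_bij_betw[OF bij_steps_y, of "mono2 lam (lam * \<mu>)"]
  by (simp_all add: mono2_place summable_on_w sum_x_def sum_y_def)

lemma linear_relation:
  assumes "(\<lambda>k. w k * g k) sums 1" "\<And>k. symbol k = 0 \<Longrightarrow> g k = p" "\<And>k. symbol k = 1 \<Longrightarrow> g k = q"
  shows "sum_x (1 - \<rho>) \<rho> lam (lam * \<mu>) * p + sum_y (1 - \<rho>) \<rho> lam (lam * \<mu>) * q = 1"
proof -
  have "((\<lambda>k. w k * p) has_sum (infsum w {k. symbol k = 0} * p)) {k. symbol k = 0}"
    by (intro has_sum_cmult_left has_sum_infsum summable_on_w)
  hence "((\<lambda>k. w k * g k) has_sum (infsum w {k. symbol k = 0} * p)) {k. symbol k = 0}"
    by (rule has_sum_cong[THEN iffD1, rotated]) (use assms(2) in auto)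
  moreover have "((\<lambda>k. w k * q) has_sum (infsum w {k. symbol k = 1} * q)) {k. symbol k = 1}"
    by (intro has_sum_cmult_left has_sum_infsum summable_on_w)
  hence "((\<lambda>k. w k * g k) has_sum (infsum w {k. symbol k = 1} * q)) {k. symbol k = 1}"
    by (rule has_sum_cong[THEN iffD1, rotated]) (use assms(3) in auto)
  ultimately have "((\<lambda>k. w k * g k) has_sum (infsum w {k. symbol k = 0} * p + infsum w {k. symbol k = 1} * q))
      ({k. symbol k = 0} \<union> {k. symbol k = 1})"
    by (rule has_sum_Un_disjoint) auto
  moreover have "{k. symbol k = 0} \<union> {k. symbol k = 1} = UNIV" using symbol_01 by auto
  ultimately have "(\<lambda>k. w k * g k) sums (infsum w {k. symbol k = 0} * p + infsum w {k. symbol k = 1} * q)"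
    by (intro has_sum_imp_sums) simp
  from sums_unique2[OF this assms(1)] show ?thesis by (simp only: sum_xy_w)
qed

text \<open>Cramer's rule for the two relations. The determinant is \<open>gap\<close>, the distance
  between the value of the map at 0 and its limit at 1.\<close>

lemma sum_x_sum_y:
  defines "X \<equiv> sum_x (1 - \<rho>) \<rho> lam (lam * \<mu>)" and "Y \<equiv> sum_y (1 - \<rho>) \<rho> lam (lam * \<mu>)"
    and "gap \<equiv> \<delta> - \<mu> * (lam + \<delta> - 1)"
  shows "gap * X = 1 - lam * \<mu> - \<mu> * \<delta> + \<mu>" "gap * Y = \<delta> - 1 + lam"
proof -
  have 1: "X * \<delta> + Y * (\<mu> * (\<delta> - 1)) = 1"
    unfolding X_def Y_def by (rule linear_relation[OF shift_sums]) (auto simp: shift_def)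
  have 2: "X * (1 - lam) + Y * (1 - lam * \<mu>) = 1"
    unfolding X_def Y_def by (rule linear_relation[OF step_sums]) auto
  have "gap * X = (X * \<delta> + Y * (\<mu> * (\<delta> - 1))) * (1 - lam * \<mu>) - (X * (1 - lam) + Y * (1 - lam * \<mu>)) * (\<mu> * (\<delta> - 1))"
    by (simp add: gap_def algebra_simps)
  thus "gap * X = 1 - lam * \<mu> - \<mu> * \<delta> + \<mu>" unfolding 1 2 by (simp add: algebra_simps)
  have "gap * Y = (X * (1 - lam) + Y * (1 - lam * \<mu>)) * \<delta> - (X * \<delta> + Y * (\<mu> * (\<delta> - 1))) * (1 - lam)"
    by (simp add: gap_def algebra_simps)
  thus "gap * Y = \<delta> - 1 + lam" unfolding 1 2 by (simp add: algebra_simps)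
qed

end

section \<open>Existence of the Euclidean orbit and the final contradiction\<close>

fun farey_step :: "real \<times> real \<times> real \<times> real \<times> nat \<times> nat \<Rightarrow> real \<times> real \<times> real \<times> real \<times> nat \<times> nat" where
  "farey_step (\<alpha>, \<beta>, x, y, l, m) =
     (if \<beta> < \<alpha> then (\<alpha> - \<beta>, \<beta>, x, x * y, l, l + m) else (\<alpha>, \<beta> - \<alpha>, x * y, y, l + m, m))"

lemma farey_orbit_exists:
  fixes \<alpha>0 \<beta>0 x0 y0 :: real
  obtains \<alpha> \<beta> x y :: "nat \<Rightarrow> real" and l m :: "nat \<Rightarrow> nat"
  where "\<alpha> 0 = \<alpha>0" "\<beta> 0 = \<beta>0" "x 0 = x0" "y 0 = y0" "l 0 = 1" "m 0 = 1"
    "\<And>n. \<beta> n < \<alpha> n \<Longrightarrow> \<alpha> (Suc n) = \<alpha> n - \<beta> n \<and> \<beta> (Suc n) = \<beta> n \<and>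
       x (Suc n) = x n \<and> y (Suc n) = x n * y n \<and> l (Suc n) = l n \<and> m (Suc n) = l n + m n"
    "\<And>n. \<not> \<beta> n < \<alpha> n \<Longrightarrow> \<alpha> (Suc n) = \<alpha> n \<and> \<beta> (Suc n) = \<beta> n - \<alpha> n \<and>
       x (Suc n) = x n * y n \<and> y (Suc n) = y n \<and> l (Suc n) = l n + m n \<and> m (Suc n) = m n"
proof -
  define st where "st n = (farey_step ^^ n) (\<alpha>0, \<beta>0, x0, y0, 1, 1)" for n
  define \<alpha> where "\<alpha> n = (case st n of (\<alpha>, \<beta>, x, y, l, m) \<Rightarrow> \<alpha>)" for n
  define \<beta> where "\<beta> n = (case st n of (\<alpha>, \<beta>, x, y, l, m) \<Rightarrow> \<beta>)" for n
  define x where "x n = (case st n of (\<alpha>, \<beta>, x, y, l, m) \<Rightarrow> x)" for n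
  define y where "y n = (case st n of (\<alpha>, \<beta>, x, y, l, m) \<Rightarrow> y)" for n
  define l where "l n = (case st n of (\<alpha>, \<beta>, x, y, l, m) \<Rightarrow> l)" for n
  define m where "m n = (case st n of (\<alpha>, \<beta>, x, y, l, m) \<Rightarrow> m)" for n
  have st: "st n = (\<alpha> n, \<beta> n, x n, y n, l n, m n)" for n
    by (simp add: \<alpha>_def \<beta>_def x_def y_def l_def m_def split: prod.splits)
  have Suc: "(\<alpha> (Suc n), \<beta> (Suc n), x (Suc n), y (Suc n), l (Suc n), m (Suc n))
      = farey_step (\<alpha> n, \<beta> n, x n, y n, l n, m n)" for n
    unfolding st[symmetric] by (simp add: st_def)
  have zero: "(\<alpha> 0, \<beta> 0, x 0, y 0, l 0, m 0) = (\<alpha>0, \<beta>0, x0, y0, 1, 1)"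
    unfolding st[symmetric] by (simp add: st_def)
  show ?thesis
  proof (rule that[of \<alpha> \<beta> x y l m])
    fix n
    show "\<beta> n < \<alpha> n \<Longrightarrow> \<alpha> (Suc n) = \<alpha> n - \<beta> n \<and> \<beta> (Suc n) = \<beta> n \<and>
       x (Suc n) = x n \<and> y (Suc n) = x n * y n \<and> l (Suc n) = l n \<and> m (Suc n) = l n + m n"
      using Suc[of n] by simp
    show "\<not> \<beta> n < \<alpha> n \<Longrightarrow> \<alpha> (Suc n) = \<alpha> n \<and> \<beta> (Suc n) = \<beta> n - \<alpha> n \<and>
       x (Suc n) = x n * y n \<and> y (Suc n) = y n \<and> l (Suc n) = l n + m n \<and> m (Suc n) = m n"
      using Suc[of n] by simp
  qed (use zero in auto)
qed

theorem theorem2: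
  fixes lam \<mu> \<delta> :: real
  assumes "algebraic lam" and "algebraic \<mu>" and "algebraic \<delta>"
    and "0 < lam" and "lam < 1" and "\<mu> > 0"
    and "1 - lam < \<delta>" and "\<delta> < d_bound lam \<mu>"
  shows "rotation_number lam \<mu> \<delta> \<in> \<rat>"
proof (rule ccontr)
  assume "rotation_number lam \<mu> \<delta> \<notin> \<rat>"
  then interpret contracted_map lam \<mu> \<delta> using assms by unfold_locales
  obtain \<alpha> \<beta> x y :: "nat \<Rightarrow> real" and l m :: "nat \<Rightarrow> nat"
    where init: "\<alpha> 0 = 1 - \<rho>" "\<beta> 0 = \<rho>" "x 0 = lam" "y 0 = lam * \<mu>" "l 0 = 1" "m 0 = 1"
    and step: "\<And>n. \<beta> n < \<alpha> n \<Longrightarrow> \<alpha> (Suc n) = \<alpha> n - \<beta> n \<and> \<beta> (Suc n) = \<beta> n \<and>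
       x (Suc n) = x n \<and> y (Suc n) = x n * y n \<and> l (Suc n) = l n \<and> m (Suc n) = l n + m n"
    "\<And>n. \<not> \<beta> n < \<alpha> n \<Longrightarrow> \<alpha> (Suc n) = \<alpha> n \<and> \<beta> (Suc n) = \<beta> n - \<alpha> n \<and>
       x (Suc n) = x n * y n \<and> y (Suc n) = y n \<and> l (Suc n) = l n + m n \<and> m (Suc n) = m n"
    by (rule farey_orbit_exists[of "1 - \<rho>" \<rho> lam "lam * \<mu>"]) (rule that)
  interpret farey_orbit \<alpha> \<beta> x y l m
  proof
    show "d = 0 \<and> e = 0" if "of_int d * \<alpha> 0 + of_int e * \<beta> 0 = 0" for d e :: int
    proof -
      have *: "of_int (e - d) * \<rho> = of_int (- d)" using that by (simp add: init algebra_simps)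
      have "e = d"
      proof (rule ccontr)
        assume "e \<noteq> d"
        hence "\<rho> = of_int (- d) / of_int (e - d)" using * by (simp add: field_simps)
        thus False using irrational by (metis Rats_divide Rats_of_int)
      qed
      thus ?thesis using * by simp
    qed
    \<comment> \<open>With these initial weights the mean (1 - \<rho>) ln (x 0) + \<rho> ln (y 0) is
      exactly ln ratio.\<close>
    have "ln ratio < 0" using ratio_pos ratio_less_1 by simp
    moreover have "ln ratio = ln lam + \<rho> * ln \<mu>" using lam \<mu> by (simp add: ratio_def ln_mult ln_powr)
    ultimately show "\<alpha> 0 * ln (x 0) + \<beta> 0 * ln (y 0) < 0"
      using lam \<mu> by (simp add: init ln_mult algebra_simps)
  qed (use lam \<mu> \<rho>_bounds sum_xy_w step in \<open>auto simp: init\<close>)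
  obtain W a s where W: "finite W" "1 \<in> W" and a: "a > (0 :: nat)"
    and s: "\<And>z. z \<in> {lam, \<mu>, \<delta>} \<Longrightarrow> mult_size W (real a * z) s"
    using mult_size_algebraic_finite[of "{lam, \<mu>, \<delta>}"] assms(1-3) by auto
  note sz = s[of lam, simplified] s[of \<mu>, simplified] s[of \<delta>, simplified]
  note aa = mult_size_of_nat[OF W(1), of a]
  define gap where "gap = \<delta> - \<mu> * (lam + \<delta> - 1)"
  have 1: "mult_size W (real a * (real a * lam)) (a * s)" and 2: "mult_size W ((real a * lam) * (real a * \<mu>)) (s * s)"
    by (intro mult_size_mult W aa sz)+
  have "mult_size W (real a * (real a * \<delta>) - (real a * \<mu>) * (real a * lam + real a * \<delta> - real a)) (a * s + s * (s + s + a))"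
    by (intro mult_size_add mult_size_diff mult_size_mult W aa sz)
  hence 3: "mult_size W (real a ^ 2 * gap) (a * s + s * (s + s + a))"
    by (simp add: gap_def power2_eq_square algebra_simps)
  have "mult_size W (real a * real a - (real a * lam) * (real a * \<mu>) - (real a * \<mu>) * (real a * \<delta>) + real a * (real a * \<mu>))
      (a * a + s * s + s * s + a * s)"
    by (intro mult_size_add mult_size_diff mult_size_mult W aa sz)
  hence 4: "mult_size W (real a ^ 2 * gap * U 0) (a * a + s * s + s * s + a * s)"
    using sum_x_sum_y(1) unfolding gap_def[symmetric]
    by (simp add: U_def init power2_eq_square mult.assoc) (simp add: algebra_simps)
  have "mult_size W (real a * (real a * \<delta>) - real a * real a + real a * (real a * lam)) (a * s + a * a + a * s)"
    by (intro mult_size_add mult_size_diff mult_size_mult W aa sz)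
  hence 5: "mult_size W (real a ^ 2 * gap * V 0) (a * s + a * a + a * s)"
    using sum_x_sum_y(2) unfolding gap_def[symmetric]
    by (simp add: V_def init power2_eq_square mult.assoc) (simp add: algebra_simps)
  \<comment> \<open>The weights, \<open>gap\<close>, \<open>gap * U 0\<close> and
    \<open>gap * V 0\<close> are integer polynomials of degree at most 2 in lam, \<mu> and \<delta>,
    so \<open>a ^ 2\<close> clears all denominators. The size bounds are sums so as to dominate each
    single size.\<close>
  interpret algebraic_farey_orbit \<alpha> \<beta> x y l m W "a ^ 2" "a ^ 2 + a * s + s * s"
    "1 + (a * s + s * (s + s + a)) + (a * a + s * s + s * s + a * s) + (a * s + a * a + a * s)" "real a ^ 2 * gap"
  proof
    show "mult_size W (real (a\<^sup>2) * x 0) (a ^ 2 + a * s + s * s)"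
      using mult_size_mono[OF 1] by (simp add: init power2_eq_square mult_ac)
    show "mult_size W (real (a\<^sup>2) * y 0) (a ^ 2 + a * s + s * s)"
      using mult_size_mono[OF 2] by (simp add: init power2_eq_square mult_ac)
    show "0 < real a ^ 2 * gap" using a gap_pos by (simp add: gap_def)
  qed (use W a mult_size_mono[OF 3] mult_size_mono[OF 4] mult_size_mono[OF 5] in auto)
  show False by (rule impossible)
qed

end
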